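(* Let $k\ge1$, $\boldsymbol h\in\mathrm{ord}_p(\mathcal O_{\mathcal K}\setminus\{0\})^k$ and $\boldsymbol d,\boldsymbol e\in\mathbb Z^k$ with $\boldsymbol e\ge\boldsymbol d$. For each $\boldsymbol i\in[\boldsymbol d,\boldsymbol e]$ let $s^{[\boldsymbol i]}=(s^{[\boldsymbol i]}_{\boldsymbol m})_{\boldsymbol m\in\mathbb Z_{\ge0}^k}\in I_{\boldsymbol h}^{[\boldsymbol i]}$, and for each $\boldsymbol m\in\mathbb Z_{\ge0}^k$ let $\tilde s^{[\boldsymbol i]}_{\boldsymbol m}\in\mathcal O_{\mathcal K}[[\Gamma]]\otimes_{\mathcal O_{\mathcal K}}\mathcal K$ be a lift of $s^{[\boldsymbol i]}_{\boldsymbol m}$. If there exists a non-negative integer $n$ such that $$p^{\langle\boldsymbol m,\boldsymbol h-(\boldsymbol j-\boldsymbol d)\rangle_k}\sum_{\boldsymbol i\in[\boldsymbol d,\boldsymbol j]}\Big(\prod_{t=1}^k\binom{j_t-d_t}{i_t-d_t}\Big)(-1)^{\sum_{t=1}^k(j_t-i_t)}\,\tilde s^{[\boldsymbol i]}_{\boldsymbol m}\in\mathcal O_{\mathcal K}[[\Gamma]]\otimes_{\mathcal O_{\mathcal K}}p^{-n}\mathcal O_{\mathcal K}$$ for each $\boldsymbol m\in\mathbb Z_{\ge0}^k$ and each $\boldsymbol j\in[\boldsymbol d,\boldsymbol e]$, then there is a unique element $s^{[\boldsymbol d,\boldsymbol e]}\in\big(I_{\boldsymbol h}^{[\boldsymbol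 d,\boldsymbol e]}\big)^0\otimes_{\mathcal O_{\mathcal K}}p^{-c^{[\boldsymbol d,\boldsymbol e]}-n}\mathcal O_{\mathcal K}$ whose image under the natural projection $I_{\boldsymbol h}^{[\boldsymbol d,\boldsymbol e]}\to I_{\boldsymbol h}^{[\boldsymbol i]}$ is $s^{[\boldsymbol i]}$ for each $\boldsymbol i\in[\boldsymbol d,\boldsymbol e]$. Here $c^{[\boldsymbol d,\boldsymbol e]}=\sum_{i=1}^kc^{[d_i,e_i]}$ with $$c^{[d_i,e_i]}=\mathrm{ord}_p((e_i-d_i)!)+2(e_i-d_i)+\Big\lfloor\tfrac{e_i-d_i+1}{p-1}\Big\rfloor+1\ \text{ if }d_i<e_i,\qquad c^{[d_i,e_i]}=0\ \text{ if }d_i=e_i.$$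
   Context: $p$ is a prime, $\mathrm{ord}_p$ is the valuation on $\mathbb C_p$ with $\mathrm{ord}_p(p)=1$, $\mathcal K\subset\mathbb C_p$ is a complete subfield with ring of integers $\mathcal O_{\mathcal K}$. $\langle\boldsymbol a,\boldsymbol b\rangle_k=\sum a_ib_i$; the order on $\mathbb Z^k$ is componentwise; $[\boldsymbol d,\boldsymbol e]=\{\boldsymbol i\in\mathbb Z^k:\boldsymbol d\le\boldsymbol i\le\boldsymbol e\}$; the superscript $[\boldsymbol i]$ means $[\boldsymbol i,\boldsymbol i]$. For $x\in\mathrm{ord}_p(\mathcal K^\times)$, $p^{x}$ denotes an element of $\mathcal K$ of valuation $x$ (the choice is irrelevant). For $1\le i\le k$, $\Gamma_i$ is a $p$-adic Lie group with a continuous character $\chi_i:\Gamma_i\to\mathbb Q_p^\times$ inducing an isomorphism $\Gamma_i\cong1+2p\mathbb Z_p$; $\gamma_i\in\Gamma_i$ is a topological generator and $u_i=\chi_i(\gamma_i)$. $\Gamma=\Gamma_1\times\cdots\times\Gamma_k$, $\mathcal O_{\mathcal K}[[\Gamma]]$ is the completed group algebra, $[\cdot]$ the tautological inclusion of $\Gamma$ into $\mathcal O_{\mathcal K}[[\Gamma]]^\times$. For $\boldsymbol m\in\mathbb Z_{\ge0}^k$, $(\Omega_{\boldsymbol m}^{[\boldsymbol d,\boldsymbol e]})$ is the ideal of $\mathcal O_{\mathcal K}[[\Gamma]]$ generated by $\Omega_{m_i}^{[d_i,e_i]}(\gamma_i)=\prod_{j=d_i}^{e_i}([\gamma_i]^{p^{m_i}}-u_i^{jp^{m_i}})$,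 $1\le i\le k$. Define $$I_{\boldsymbol h}^{[\boldsymbol d,\boldsymbol e]}=\Big\{(s_{\boldsymbol m})_{\boldsymbol m}\in\varprojlim_{\boldsymbol m}\Big(\tfrac{\mathcal O_{\mathcal K}[[\Gamma]]}{(\Omega_{\boldsymbol m}^{[\boldsymbol d,\boldsymbol e]})}\otimes_{\mathcal O_{\mathcal K}}\mathcal K\Big)\ \Big|\ (p^{\langle\boldsymbol h,\boldsymbol m\rangle_k}s_{\boldsymbol m})_{\boldsymbol m}\in\Big(\prod_{\boldsymbol m}\tfrac{\mathcal O_{\mathcal K}[[\Gamma]]}{(\Omega_{\boldsymbol m}^{[\boldsymbol d,\boldsymbol e]})}\Big)\otimes_{\mathcal O_{\mathcal K}}\mathcal K\Big\}$$ and let $(I_{\boldsymbol h}^{[\boldsymbol d,\boldsymbol e]})^0$ be the subset of those with $(p^{\langle\boldsymbol h,\boldsymbol m\rangle_k}s_{\boldsymbol m})_{\boldsymbol m}\in\prod_{\boldsymbol m}\mathcal O_{\mathcal K}[[\Gamma]]/(\Omega_{\boldsymbol m}^{[\boldsymbol d,\boldsymbol e]})$. Then $(I_{\boldsymbol h}^{[\boldsymbol d,\boldsymbol e]})^0\otimes_{\mathcal O_{\mathcal K}}p^{-c}\mathcal O_{\mathcal K}$ is the set of $s\in I_{\boldsymbol h}^{[\boldsymbol d,\boldsymbol e]}$ with $p^cs\in(I_{\boldsymbol h}^{[\boldsymbol d,\boldsymbol e]})^0$. The natural projection $I_{\boldsymbol h}^{[\boldsymbol d,\boldsymbol e]}\to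 I_{\boldsymbol h}^{[\boldsymbol i]}$ is induced by the quotient maps modulo $(\Omega_{\boldsymbol m}^{[\boldsymbol i]})\supset(\Omega_{\boldsymbol m}^{[\boldsymbol d,\boldsymbol e]})$. *)

theory Defs
  imports
    "HOL-Analysis.Analysis"
    "HOL-Algebra.Subrings"
    "HOL-Algebra.QuotRing"
    "HOL-Algebra.Generated_Groups"
    "HOL-Algebra.Product_Groups"
    "HOL-Algebra.Free_Abelian_Groups"
    "HOL-Computational_Algebra.Computational_Algebra"
begin

section \<open>The field of $p$-adic complex numbers\<close>

definition padic_dist :: "nat \<Rightarrow> ('c::field \<Rightarrow> ereal) \<Rightarrow> 'c \<Rightarrow> 'c \<Rightarrow> real" where
  "padic_dist p v x y = (if x = y then 0 else real p powr - real_of_ereal (v (x - y)))"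

definition padic_topology :: "nat \<Rightarrow> ('c::field \<Rightarrow> ereal) \<Rightarrow> 'c topology" where
  "padic_topology p v = Metric_space.mtopology UNIV (padic_dist p v)"

definition Q_p :: "nat \<Rightarrow> ('c::field_char_0 \<Rightarrow> ereal) \<Rightarrow> 'c set" where
  "Q_p p v = padic_topology p v closure_of \<rat>"

text \<open>The library has no $\mathbb{C}_p$. The predicate says that the ambient field, with the
  valuation \<open>v\<close>, is a completion of an algebraic closure of $\mathbb{Q}_p$, where
  $\mathbb{Q}_p$ is the closure of the rationals and $v(p) = 1$. This determines the valued field
  up to isomorphism.\<close>

definition is_C_p :: "nat \<Rightarrow> ('c::field_char_0 \<Rightarrow> ereal) \<Rightarrow> bool" where
  "is_C_p p v \<longleftrightarrow>
     Factorial_Ring.prime p \<and>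
     (\<forall>x. v x = \<infinity> \<longleftrightarrow> x = 0) \<and> (\<forall>x. v x \<noteq> -\<infinity>) \<and>
     (\<forall>x y. v (x * y) = v x + v y) \<and> (\<forall>x y. min (v x) (v y) \<le> v (x + y)) \<and>
     v (of_nat p) = 1 \<and>
     Metric_space.mcomplete (UNIV :: 'c set) (padic_dist p v) \<and>
     (\<forall>f :: 'c poly. 0 < Polynomial.degree f \<longrightarrow> (\<exists>x. poly f x = 0)) \<and>
     padic_topology p v closure_of
       {x. \<exists>f. f \<noteq> 0 \<and> (\<forall>i. Polynomial.coeff f i \<in> Q_p p v) \<and> poly f x = 0} = UNIV"

text \<open>A subset of the field with the inherited operations: used as a ring, as a multiplicative
  group, and as a module over a subring. The scalar multiplication is the one of the whole field.\<close>

definition scalars :: "'c::field set \<Rightarrow> ('c, 'c) module" where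
  "scalars A = \<lparr>carrier = A, monoid.mult = (*), monoid.one = 1, ring.zero = 0, ring.add = (+), module.smult = (*)\<rparr>"


section \<open>Tensor products, quotients and products of modules\<close>

definition tensor_relators ::
  "('r, 'x) ring_scheme \<Rightarrow> ('r, 'a, 'y) module_scheme \<Rightarrow> ('r, 'b, 'z) module_scheme
    \<Rightarrow> ('a \<times> 'b \<Rightarrow>\<^sub>0 int) set" where
  "tensor_relators R M N =
     {frag_of (x \<oplus>\<^bsub>M\<^esub> x', y) - frag_of (x, y) - frag_of (x', y) | x x' y.
        x \<in> carrier M \<and> x' \<in> carrier M \<and> y \<in> carrier N} \<union>
     {frag_of (x, y \<oplus>\<^bsub>N\<^esub> y') - frag_of (x, y) - frag_of (x, y') | x y y'.
        x \<in> carrier M \<and> y \<in> carrier N \<and> y' \<in> carrier N} \<union>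
     {frag_of (r \<odot>\<^bsub>M\<^esub> x, y) - frag_of (x, r \<odot>\<^bsub>N\<^esub> y) | r x y.
        r \<in> carrier R \<and> x \<in> carrier M \<and> y \<in> carrier N}"

definition tensor_null ::
  "('r, 'x) ring_scheme \<Rightarrow> ('r, 'a, 'y) module_scheme \<Rightarrow> ('r, 'b, 'z) module_scheme
    \<Rightarrow> ('a \<times> 'b \<Rightarrow>\<^sub>0 int) set" where
  "tensor_null R M N =
     generate (free_Abelian_group (carrier M \<times> carrier N)) (tensor_relators R M N)"

definition pure_tensor ::
  "('r, 'x) ring_scheme \<Rightarrow> ('r, 'a, 'y) module_scheme \<Rightarrow> ('r, 'b, 'z) module_scheme
    \<Rightarrow> 'a \<Rightarrow> 'b \<Rightarrow> ('a \<times> 'b \<Rightarrow>\<^sub>0 int) set" where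
  "pure_tensor R M N x y =
     tensor_null R M N #>\<^bsub>free_Abelian_group (carrier M \<times> carrier N)\<^esub> frag_of (x, y)"

text \<open>The map $f \otimes g$; the modules \<open>M\<close> and \<open>N\<close> are those of the \<^emph>\<open>target\<close>
  $M \otimes_R N$. An element of the source is a coset, which is mapped into a single coset of
  the target.\<close>

definition tensor_map ::
  "('r, 'x) ring_scheme \<Rightarrow> ('r, 'a, 'y) module_scheme \<Rightarrow> ('r, 'b, 'z) module_scheme
    \<Rightarrow> ('a' \<Rightarrow> 'a) \<Rightarrow> ('b' \<Rightarrow> 'b) \<Rightarrow> ('a' \<times> 'b' \<Rightarrow>\<^sub>0 int) set \<Rightarrow> ('a \<times> 'b \<Rightarrow>\<^sub>0 int) set" where
  "tensor_map R M N f g X =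
     tensor_null R M N <#>\<^bsub>free_Abelian_group (carrier M \<times> carrier N)\<^esub>
       frag_extend (\<lambda>(x, y). frag_of (f x, g y)) ` X"

text \<open>Scalars act through the second factor, so that $M \otimes_R K$ is at once a vector space
  over an extension field $K$ of $R$. The ring fields of the record (\<open>mult\<close>, \<open>one\<close>) play no role
  for a module.\<close>

definition tensor ::
  "('r, 'x) ring_scheme \<Rightarrow> ('r, 'a, 'y) module_scheme \<Rightarrow> ('r, 'b, 'z) module_scheme
    \<Rightarrow> ('r, ('a \<times> 'b \<Rightarrow>\<^sub>0 int) set) module" where
  "tensor R M N =
     (let T = free_Abelian_group (carrier M \<times> carrier N) Mod tensor_null R M N
      in \<lparr>carrier = carrier T, monoid.mult = undefined, monoid.one = undefined,
          ring.zero = \<one>\<^bsub>T\<^esub>, ring.add = (\<otimes>\<^bsub>T\<^esub>),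
          module.smult = (\<lambda>r. tensor_map R M N id (\<lambda>y. r \<odot>\<^bsub>N\<^esub> y))\<rparr>)"

text \<open>The ring \<open>A Quot I\<close> with its structure of an algebra over the scalars of \<open>A\<close>.\<close>

definition quot_algebra :: "('r, 'a, 'x) module_scheme \<Rightarrow> 'a set \<Rightarrow> ('r, 'a set) module" where
  "quot_algebra A I =
     \<lparr>carrier = carrier (A Quot I), monoid.mult = (\<otimes>\<^bsub>A Quot I\<^esub>), monoid.one = \<one>\<^bsub>A Quot I\<^esub>,
      ring.zero = \<zero>\<^bsub>A Quot I\<^esub>, ring.add = (\<oplus>\<^bsub>A Quot I\<^esub>),
      module.smult = (\<lambda>r X. I <+>\<^bsub>A\<^esub> (\<lambda>x. r \<odot>\<^bsub>A\<^esub> x) ` X)\<rparr>"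

definition prod_algebra :: "('i \<Rightarrow> ('r, 'a, 'x) module_scheme) \<Rightarrow> ('r, 'i \<Rightarrow> 'a) module" where
  "prod_algebra M =
     \<lparr>carrier = {x. \<forall>i. x i \<in> carrier (M i)},
      monoid.mult = (\<lambda>x y i. x i \<otimes>\<^bsub>M i\<^esub> y i), monoid.one = (\<lambda>i. \<one>\<^bsub>M i\<^esub>),
      ring.zero = (\<lambda>i. \<zero>\<^bsub>M i\<^esub>), ring.add = (\<lambda>x y i. x i \<oplus>\<^bsub>M i\<^esub> y i),
      module.smult = (\<lambda>r x i. r \<odot>\<^bsub>M i\<^esub> x i)\<rparr>"


section \<open>Completed group algebras\<close>

text \<open>The group algebra $A[G]$: finitely supported functions with the convolution product.\<close>

definition group_algebra :: "'c::field set \<Rightarrow> ('g, 'x) monoid_scheme \<Rightarrow> ('c, 'g \<Rightarrow> 'c) module" where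
  "group_algebra A G =
     \<lparr>carrier = {f. (\<forall>x\<in>carrier G. f x \<in> A) \<and> (\<forall>x. x \<notin> carrier G \<longrightarrow> f x = 0) \<and>
                    finite {x. f x \<noteq> 0}},
      monoid.mult = (\<lambda>f f' x. if x \<in> carrier G
                then \<Sum>y\<in>{y \<in> carrier G. f y \<noteq> 0}. f y * f' (inv\<^bsub>G\<^esub> y \<otimes>\<^bsub>G\<^esub> x) else 0),
      monoid.one = (\<lambda>x. if x = \<one>\<^bsub>G\<^esub> then 1 else 0),
      ring.zero = (\<lambda>x. 0),
      ring.add = (\<lambda>f f' x. f x + f' x),
      module.smult = (\<lambda>a f x. a * f x)\<rparr>"

definition group_algebra_map :: "('g \<Rightarrow> 'h) \<Rightarrow> ('g \<Rightarrow> 'c::field) \<Rightarrow> 'h \<Rightarrow> 'c" where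
  "group_algebra_map \<phi> f = (\<lambda>y. \<Sum>x\<in>{x. f x \<noteq> 0 \<and> \<phi> x = y}. f x)"

definition open_normal :: "('g, 'x) monoid_scheme \<Rightarrow> 'g topology \<Rightarrow> 'g set set" where
  "open_normal G T = {U. U \<lhd> G \<and> openin T U}"

text \<open>For a profinite group: the inverse limit of the group algebras $A[G/U]$ over the open normal
  subgroups $U$. The projection $G/U \to G/V$ for $U \subseteq V$ sends a coset $C$ to $VC$.\<close>

definition completed_group_algebra ::
  "'c::field set \<Rightarrow> ('g, 'x) monoid_scheme \<Rightarrow> 'g topology \<Rightarrow> ('c, 'g set \<Rightarrow> 'g set \<Rightarrow> 'c) module"
where
  "completed_group_algebra A G T =
     \<lparr>carrier = {l \<in> \<Pi>\<^sub>E U\<in>open_normal G T. carrier (group_algebra A (G Mod U)).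
        \<forall>U\<in>open_normal G T. \<forall>V\<in>open_normal G T. U \<subseteq> V \<longrightarrow>
          group_algebra_map (\<lambda>C. V <#>\<^bsub>G\<^esub> C) (l U) = l V},
      monoid.mult = (\<lambda>l l'. \<lambda>U\<in>open_normal G T. l U \<otimes>\<^bsub>group_algebra A (G Mod U)\<^esub> l' U),
      monoid.one = (\<lambda>U\<in>open_normal G T. \<one>\<^bsub>group_algebra A (G Mod U)\<^esub>),
      ring.zero = (\<lambda>U\<in>open_normal G T. \<zero>\<^bsub>group_algebra A (G Mod U)\<^esub>),
      ring.add = (\<lambda>l l'. \<lambda>U\<in>open_normal G T. l U \<oplus>\<^bsub>group_algebra A (G Mod U)\<^esub> l' U),
      module.smult = (\<lambda>a l. \<lambda>U\<in>open_normal G T. a \<odot>\<^bsub>group_algebra A (G Mod U)\<^esub> l U)\<rparr>"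

definition group_like ::
  "('g, 'x) monoid_scheme \<Rightarrow> 'g topology \<Rightarrow> 'g \<Rightarrow> 'g set \<Rightarrow> 'g set \<Rightarrow> 'c::field" where
  "group_like G T g = (\<lambda>U\<in>open_normal G T. \<lambda>C. if C = U #>\<^bsub>G\<^esub> g then 1 else 0)"


section \<open>The setting\<close>

text \<open>The index type \<open>'k\<close> stands for $\{1, \dots, k\}$. The fields are the prime $p$, the valuation
  on $\mathbb{C}_p$ (the type \<open>'c\<close>), the subfield $\mathcal{K}$, the groups $\Gamma_i$ and their
  topologies, the characters $\chi_i$ and the generators $\gamma_i$.\<close>

record ('c, 'g, 'k) iwasawa_data =
  prm :: nat
  val :: "'c \<Rightarrow> ereal"
  fld :: "'c set"
  grp :: "'k \<Rightarrow> 'g monoid"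
  gtop :: "'k \<Rightarrow> 'g topology"
  chr :: "'k \<Rightarrow> 'g \<Rightarrow> 'c"
  gen :: "'k \<Rightarrow> 'g"

definition one_units :: "nat \<Rightarrow> ('c::field_char_0 \<Rightarrow> ereal) \<Rightarrow> 'c set" where
  "one_units p v = {1 + 2 * of_nat p * z | z. z \<in> Q_p p v \<and> 0 \<le> v z}"

text \<open>Each $\chi_i$ is an isomorphism of topological groups from $\Gamma_i$ onto
  $1 + 2p\mathbb{Z}_p$. Such an isomorphism is automatically one of $p$-adic Lie groups, so the
  Lie structure of $\Gamma_i$ need not be mentioned.\<close>

definition iwasawa_setting :: "('c::field_char_0, 'g, 'k) iwasawa_data \<Rightarrow> bool" where
  "iwasawa_setting S \<longleftrightarrow>
     is_C_p (prm S) (val S) \<and>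
     subfield (fld S) (scalars UNIV) \<and>
     Metric_space.mcomplete (fld S) (padic_dist (prm S) (val S)) \<and>
     (\<forall>i. group (grp S i) \<and> topspace (gtop S i) = carrier (grp S i) \<and>
       chr S i \<in> iso (grp S i) (scalars (one_units (prm S) (val S))) \<and>
       homeomorphic_map (gtop S i)
         (subtopology (padic_topology (prm S) (val S)) (one_units (prm S) (val S))) (chr S i) \<and>
       gen S i \<in> carrier (grp S i) \<and>
       gtop S i closure_of generate (grp S i) {gen S i} = carrier (grp S i))"

definition O_K :: "('c::field_char_0, 'g, 'k) iwasawa_data \<Rightarrow> 'c set" where
  "O_K S = {x \<in> fld S. 0 \<le> val S x}"

abbreviation O_ring :: "('c::field_char_0, 'g, 'k) iwasawa_data \<Rightarrow> ('c, 'c) module" where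
  "O_ring S \<equiv> scalars (O_K S)"

abbreviation K_module :: "('c::field_char_0, 'g, 'k) iwasawa_data \<Rightarrow> ('c, 'c) module" where
  "K_module S \<equiv> scalars (fld S)"

text \<open>$p^x$, for $x$ in the value group of $\mathcal{K}$, is any element of valuation $x$; two choices
  differ by a unit of $\mathcal{O}_{\mathcal{K}}$.\<close>

definition p_pow :: "('c::field_char_0, 'g, 'k) iwasawa_data \<Rightarrow> real \<Rightarrow> 'c" where
  "p_pow S x = (SOME z. z \<in> fld S \<and> val S z = ereal x)"

definition pairing :: "('k::finite \<Rightarrow> real) \<Rightarrow> ('k \<Rightarrow> real) \<Rightarrow> real" where
  "pairing a b = (\<Sum>i\<in>UNIV. a i * b i)"

definition Gam :: "('c, 'g, 'k) iwasawa_data \<Rightarrow> ('k \<Rightarrow> 'g) monoid" where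
  "Gam S = product_group UNIV (grp S)"

definition Gam_top :: "('c, 'g, 'k) iwasawa_data \<Rightarrow> ('k \<Rightarrow> 'g) topology" where
  "Gam_top S = product_topology (gtop S) UNIV"

type_synonym ('c, 'g, 'k) iwasawa_elem = "('k \<Rightarrow> 'g) set \<Rightarrow> ('k \<Rightarrow> 'g) set \<Rightarrow> 'c"

definition Lam ::
  "('c::field_char_0, 'g, 'k) iwasawa_data \<Rightarrow> ('c, ('c, 'g, 'k) iwasawa_elem) module" where
  "Lam S = completed_group_algebra (O_K S) (Gam S) (Gam_top S)"

text \<open>The element $[\gamma_i]$, with $\Gamma_i$ embedded in $\Gamma$ as the $i$-th factor.\<close>

definition gam ::
  "('c::field_char_0, 'g, 'k) iwasawa_data \<Rightarrow> 'k \<Rightarrow> ('c, 'g, 'k) iwasawa_elem" where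
  "gam S i = group_like (Gam S) (Gam_top S) (\<lambda>j. if j = i then gen S i else \<one>\<^bsub>grp S j\<^esub>)"

definition Omega ::
  "('c::field_char_0, 'g, 'k) iwasawa_data \<Rightarrow> 'k \<Rightarrow> int \<Rightarrow> int \<Rightarrow> nat \<Rightarrow> ('c, 'g, 'k) iwasawa_elem"
where
  "Omega S i a b m =
     (\<Otimes>\<^bsub>Lam S\<^esub> j\<in>{a..b}.
        gam S i [^]\<^bsub>Lam S\<^esub> (prm S ^ m)
        \<ominus>\<^bsub>Lam S\<^esub> (chr S i (gen S i) powi (j * int (prm S ^ m))) \<odot>\<^bsub>Lam S\<^esub> \<one>\<^bsub>Lam S\<^esub>)"

definition Omega_ideal ::
  "('c::field_char_0, 'g, 'k) iwasawa_data \<Rightarrow> ('k \<Rightarrow> int) \<Rightarrow> ('k \<Rightarrow> int) \<Rightarrow> ('k \<Rightarrow> nat)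
    \<Rightarrow> ('c, 'g, 'k) iwasawa_elem set" where
  "Omega_ideal S d e m = Idl\<^bsub>Lam S\<^esub> {Omega S i (d i) (e i) (m i) | i. True}"

definition Lam_quot ::
  "('c::field_char_0, 'g, 'k) iwasawa_data \<Rightarrow> ('k \<Rightarrow> int) \<Rightarrow> ('k \<Rightarrow> int) \<Rightarrow> ('k \<Rightarrow> nat)
    \<Rightarrow> ('c, ('c, 'g, 'k) iwasawa_elem set) module" where
  "Lam_quot S d e m = quot_algebra (Lam S) (Omega_ideal S d e m)"


section \<open>The modules of compatible systems\<close>

type_synonym ('c, 'g, 'k) Lam_K_elem = "(('c, 'g, 'k) iwasawa_elem \<times> 'c \<Rightarrow>\<^sub>0 int) set"
type_synonym ('c, 'g, 'k) quot_K_elem = "(('c, 'g, 'k) iwasawa_elem set \<times> 'c \<Rightarrow>\<^sub>0 int) set"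

definition Lam_K ::
  "('c::field_char_0, 'g, 'k) iwasawa_data \<Rightarrow> ('c, ('c, 'g, 'k) Lam_K_elem) module" where
  "Lam_K S = tensor (O_ring S) (Lam S) (K_module S)"

text \<open>$\mathcal{O}_{\mathcal{K}}[[\Gamma]] \otimes p^{-n}\mathcal{O}_{\mathcal{K}}$ as a subset of
  $\mathcal{O}_{\mathcal{K}}[[\Gamma]] \otimes \mathcal{K}$.\<close>

definition Lam_lattice ::
  "('c::field_char_0, 'g, 'k) iwasawa_data \<Rightarrow> nat \<Rightarrow> ('c, 'g, 'k) Lam_K_elem set" where
  "Lam_lattice S n =
     tensor_map (O_ring S) (Lam S) (K_module S) id id `
       carrier (tensor (O_ring S) (Lam S) (scalars {x \<in> fld S. - ereal (real n) \<le> val S x}))"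

definition quot_K ::
  "('c::field_char_0, 'g, 'k) iwasawa_data \<Rightarrow> ('k \<Rightarrow> int) \<Rightarrow> ('k \<Rightarrow> int) \<Rightarrow> ('k \<Rightarrow> nat)
    \<Rightarrow> ('c, ('c, 'g, 'k) quot_K_elem) module" where
  "quot_K S d e m = tensor (O_ring S) (Lam_quot S d e m) (K_module S)"

text \<open>The quotient map from $\mathcal{O}_{\mathcal{K}}[[\Gamma]]$, and the one from its quotient by a
  smaller ideal, onto the quotient by \<open>Omega_ideal S d e m\<close>, both tensored with
  $\mathcal{K}$. The parameters \<open>d e m\<close> are those of the target.\<close>

definition proj_K ::
  "('c::field_char_0, 'g, 'k) iwasawa_data \<Rightarrow> ('k \<Rightarrow> int) \<Rightarrow> ('k \<Rightarrow> int) \<Rightarrow> ('k \<Rightarrow> nat)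
    \<Rightarrow> ('c, 'g, 'k) Lam_K_elem \<Rightarrow> ('c, 'g, 'k) quot_K_elem" where
  "proj_K S d e m =
     tensor_map (O_ring S) (Lam_quot S d e m) (K_module S)
       (\<lambda>x. Omega_ideal S d e m +>\<^bsub>Lam S\<^esub> x) id"

definition red_K ::
  "('c::field_char_0, 'g, 'k) iwasawa_data \<Rightarrow> ('k \<Rightarrow> int) \<Rightarrow> ('k \<Rightarrow> int) \<Rightarrow> ('k \<Rightarrow> nat)
    \<Rightarrow> ('c, 'g, 'k) quot_K_elem \<Rightarrow> ('c, 'g, 'k) quot_K_elem" where
  "red_K S d e m =
     tensor_map (O_ring S) (Lam_quot S d e m) (K_module S)
       (\<lambda>X. Omega_ideal S d e m <+>\<^bsub>Lam S\<^esub> X) id"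

definition limit_K ::
  "('c::field_char_0, 'g, 'k) iwasawa_data \<Rightarrow> ('k \<Rightarrow> int) \<Rightarrow> ('k \<Rightarrow> int)
    \<Rightarrow> (('k \<Rightarrow> nat) \<Rightarrow> ('c, 'g, 'k) quot_K_elem) set" where
  "limit_K S d e =
     {s. (\<forall>m. s m \<in> carrier (quot_K S d e m)) \<and>
         (\<forall>m m'. m \<le> m' \<longrightarrow> red_K S d e m (s m') = s m)}"

definition twist ::
  "('c::field_char_0, 'g, 'k::finite) iwasawa_data \<Rightarrow> ('k \<Rightarrow> real) \<Rightarrow> ('k \<Rightarrow> int) \<Rightarrow> ('k \<Rightarrow> int)
    \<Rightarrow> (('k \<Rightarrow> nat) \<Rightarrow> ('c, 'g, 'k) quot_K_elem) \<Rightarrow> ('k \<Rightarrow> nat) \<Rightarrow> ('c, 'g, 'k) quot_K_elem" where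
  "twist S h d e s m = p_pow S (pairing h (\<lambda>i. real (m i))) \<odot>\<^bsub>quot_K S d e m\<^esub> s m"

text \<open>$I_h^{[d,e]}$ and $(I_h^{[d,e]})^0$. Membership of a family in
  $(\prod_m \mathcal{O}_{\mathcal{K}}[[\Gamma]]/(\Omega_m)) \otimes \mathcal{K}$, respectively in
  $\prod_m \mathcal{O}_{\mathcal{K}}[[\Gamma]]/(\Omega_m)$, means being in the image of the canonical
  map to $\prod_m (\mathcal{O}_{\mathcal{K}}[[\Gamma]]/(\Omega_m) \otimes \mathcal{K})$.\<close>

definition I_mod ::
  "('c::field_char_0, 'g, 'k::finite) iwasawa_data \<Rightarrow> ('k \<Rightarrow> real) \<Rightarrow> ('k \<Rightarrow> int) \<Rightarrow> ('k \<Rightarrow> int)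
    \<Rightarrow> (('k \<Rightarrow> nat) \<Rightarrow> ('c, 'g, 'k) quot_K_elem) set" where
  "I_mod S h d e =
     {s \<in> limit_K S d e.
       \<exists>t\<in>carrier (tensor (O_ring S) (prod_algebra (Lam_quot S d e)) (K_module S)).
         \<forall>m. twist S h d e s m =
           tensor_map (O_ring S) (Lam_quot S d e m) (K_module S) (\<lambda>x. x m) id t}"

definition I_mod0 ::
  "('c::field_char_0, 'g, 'k::finite) iwasawa_data \<Rightarrow> ('k \<Rightarrow> real) \<Rightarrow> ('k \<Rightarrow> int) \<Rightarrow> ('k \<Rightarrow> int)
    \<Rightarrow> (('k \<Rightarrow> nat) \<Rightarrow> ('c, 'g, 'k) quot_K_elem) set" where
  "I_mod0 S h d e =
     {s \<in> I_mod S h d e.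
       \<exists>t\<in>carrier (prod_algebra (Lam_quot S d e)).
         \<forall>m. twist S h d e s m =
           pure_tensor (O_ring S) (Lam_quot S d e m) (K_module S) (t m) 1}"

text \<open>$(I_h^{[d,e]})^0 \otimes p^{-c}\mathcal{O}_{\mathcal{K}}$.\<close>

definition I_lattice ::
  "('c::field_char_0, 'g, 'k::finite) iwasawa_data \<Rightarrow> ('k \<Rightarrow> real) \<Rightarrow> ('k \<Rightarrow> int) \<Rightarrow> ('k \<Rightarrow> int)
    \<Rightarrow> nat \<Rightarrow> (('k \<Rightarrow> nat) \<Rightarrow> ('c, 'g, 'k) quot_K_elem) set" where
  "I_lattice S h d e c =
     {s \<in> I_mod S h d e. (\<lambda>m. of_nat (prm S ^ c) \<odot>\<^bsub>quot_K S d e m\<^esub> s m) \<in> I_mod0 S h d e}"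

definition I_proj ::
  "('c::field_char_0, 'g, 'k) iwasawa_data \<Rightarrow> ('k \<Rightarrow> int)
    \<Rightarrow> (('k \<Rightarrow> nat) \<Rightarrow> ('c, 'g, 'k) quot_K_elem) \<Rightarrow> ('k \<Rightarrow> nat) \<Rightarrow> ('c, 'g, 'k) quot_K_elem" where
  "I_proj S i s = (\<lambda>m. red_K S i i m (s m))"

definition c_const1 :: "nat \<Rightarrow> int \<Rightarrow> int \<Rightarrow> nat" where
  "c_const1 p a b =
     (if a < b
      then multiplicity p (fact (nat (b - a)) :: nat) + 2 * nat (b - a)
           + (nat (b - a) + 1) div (p - 1) + 1
      else 0)"

definition c_const :: "nat \<Rightarrow> ('k::finite \<Rightarrow> int) \<Rightarrow> ('k \<Rightarrow> int) \<Rightarrow> nat" where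
  "c_const p d e = (\<Sum>i\<in>UNIV. c_const1 p (d i) (e i))"

end

theory Submission
  imports Defs
begin

text \<open>
  Fix a level $m$, let $Y_t = [\gamma_t]^{p^{m_t}}$ and $q_t = u_t^{p^{m_t}}$. The generators
  of the ideals are products of the factors $Y_t - q_t^j$, and modulo the ideal of a point $i$
  the element $Y_t$ is the scalar $q_t^{i_t}$. So an element of the quotient by the ideal of the
  box \<open>{d..e}\<close> has a value at each of its points, and the theorem is about interpolation.

  \<^emph>\<open>Uniqueness.\<close> The differences of the nodes $q_t^j$ are invertible in the field. Hence
  the Lagrange polynomials in the $Y_t$, with denominators cleared, provide elements that carry
  the ideal of a point into the ideal of the box and that sum to a nonzero scalar
  (\<open>interpolation_multipliers\<close>). An element of the quotient over the field is therefore
  determined by its images at the points (\<open>quot_K_unique\<close>). The same fact shows that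
  elements found level by level form a compatible system.

  \<^emph>\<open>Existence.\<close> By binomial inversion the lift at $i$ is the sum over $j$ of the $j$-th
  finite difference of the lifts times the product of the $\binom{i_t - d_t}{j_t - d_t}$. It
  suffices to replace the binomial coefficients by polynomials in the $Y_t$ which take these
  values at the nodes (\<open>existence_at_level\<close>). What needs care is the denominator. The growth
  condition allows $p^{m_t (j_t - d_t)}$ in the coordinate $t$, whereas a divided difference of
  order $r$ at these nodes costs about $r m_t$ in general.

  The point is a formula for the divided differences of $i \mapsto \binom{i}{j}$ at the nodes
  $q^i$. The expansion $X^i = \sum_r \binom{i}{r}_q \prod_{s<r} (X - q^s)$, for $X = 1 + Z$,
  exhibits the one of order $r$ as the quotient of the coefficient of $Z^j$ in
  $\prod_{s<r} (Z - (q^s - 1))$ by $\prod_{s<r} (q^r - q^s)$. The numerator is divisible by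
  $(q - 1)^{r-j}$, and by lifting the exponent the denominator has the valuation of
  $(q-1)^r r!$. So the loss is at most the valuation of $(q - 1)^j r!$
  (\<open>binomial_interpolation\<close>). As $q_t - 1$ has valuation $m_t + 1$ for odd $p$ and
  $m_t + 2$ for $p = 2$, the loss in the coordinate $t$ exceeds $m_t (j_t - d_t)$ by no more
  than the summand $c^{[d_t,e_t]}$ of the constant in the theorem.

  The remaining parts supply the algebra: tensor products with the field, where all elements are
  pure tensors because the ring of integers is a valuation ring, and the ring structure of the
  completed group algebra.
\<close>


section \<open>Valued fields\<close>

text \<open>The ambient field plays the role of $\mathbb{C}_p$, and \<open>K\<close> that of the coefficient
  field; its ring of integers is \<open>integers\<close>.\<close>

locale p_valued_field =
  fixes p :: nat and v :: "'c::field_char_0 \<Rightarrow> ereal" and K :: "'c set"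
  assumes prime_p: "Factorial_Ring.prime p"
    and v_infinity_iff: "v x = \<infinity> \<longleftrightarrow> x = 0"
    and v_not_MInf: "v x \<noteq> -\<infinity>"
    and v_mult: "v (x * y) = v x + v y"
    and v_ultra: "min (v x) (v y) \<le> v (x + y)"
    and v_p: "v (of_nat p) = 1"
    and K_one: "1 \<in> K"
    and K_add: "x \<in> K \<Longrightarrow> y \<in> K \<Longrightarrow> x + y \<in> K"
    and K_uminus: "x \<in> K \<Longrightarrow> - x \<in> K"
    and K_mult: "x \<in> K \<Longrightarrow> y \<in> K \<Longrightarrow> x * y \<in> K"
    and K_inverse: "x \<in> K \<Longrightarrow> inverse x \<in> K"
begin

definition integers :: "'c set" where "integers = {x \<in> K. 0 \<le> v x}"

lemma v_zero [simp]: "v 0 = \<infinity>"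
  by (simp add: v_infinity_iff)

lemma v_finite: "x \<noteq> 0 \<Longrightarrow> v x = ereal (real_of_ereal (v x))"
  using v_infinity_iff[of x] v_not_MInf[of x] by (cases "v x") auto

lemma v_one [simp]: "v 1 = 0"
proof -
  have "v 1 = v 1 + v 1" using v_mult[of 1 1] by simp
  with v_finite[of 1] show ?thesis by (cases "v 1") (auto simp: zero_ereal_def)
qed

lemma v_uminus [simp]: "v (- x) = v x"
proof -
  have "v (-1) + v (-1) = 0" using v_mult[of "-1" "-1"] by simp
  then have "v (-1) = 0" by (cases "v (-1)") (auto simp: zero_ereal_def)
  then show ?thesis using v_mult[of "-1" x] by simp
qed

lemma v_diff: "min (v x) (v y) \<le> v (x - y)"
  using v_ultra[of x "- y"] by simp

lemma v_minus_commute: "v (x - y) = v (y - x)"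
  using v_uminus[of "x - y"] by simp

lemma v_add_eq: "v x < v y \<Longrightarrow> v (x + y) = v x"
  using v_ultra[of x y] v_diff[of "x + y" y] by (auto simp: min_def split: if_splits)

lemma v_power: "v (x ^ n) = ereal (real n) * v x"
proof (induction n)
  case (Suc n)
  have "ereal (real (Suc n)) * v x = v x + ereal (real n) * v x"
    by (cases "v x") (auto simp: algebra_simps)
  then show ?case using Suc by (simp add: v_mult)
qed (simp flip: zero_ereal_def)

lemma v_sum_ge:
  assumes "\<And>i. i \<in> I \<Longrightarrow> c \<le> v (f i)" shows "c \<le> v (sum f I)"
  using assms
proof (induction I rule: infinite_finite_induct)
  case (insert i I)
  then have "c \<le> min (v (f i)) (v (sum f I))" by simp
  also have "\<dots> \<le> v (f i + sum f I)" by (rule v_ultra)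
  finally show ?case using insert by simp
qed auto

lemma v_of_nat_nonneg: "0 \<le> v (of_nat n)"
proof -
  have "0 \<le> v (\<Sum>i<n. 1)" by (rule v_sum_ge) simp
  then show ?thesis by simp
qed

lemma v_of_int_nonneg: "0 \<le> v (of_int i)"
proof (cases "0 \<le> i")
  case True
  then show ?thesis using v_of_nat_nonneg[of "nat i"] by simp
next
  case False
  then show ?thesis using v_of_nat_nonneg[of "nat (- i)"] v_uminus[of "of_int i"] by simp
qed

lemma v_mult_ge_left: "0 \<le> v y \<Longrightarrow> v x \<le> v (x * y)"
  by (metis add.right_neutral add_left_mono v_mult)

lemma v_inverse: "x \<noteq> 0 \<Longrightarrow> v (inverse x) = - v x"
proof -
  assume "x \<noteq> 0"
  then have "v x + v (inverse x) = 0" using v_mult[of x "inverse x"] by simp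
  then show ?thesis by (cases "v x"; cases "v (inverse x)") (auto simp: zero_ereal_def)
qed

lemma v_divide: "y \<noteq> 0 \<Longrightarrow> v (x / y) = v x - v y"
  by (simp add: divide_inverse v_mult v_inverse minus_ereal_def)

lemma v_divide_nonneg: "y \<noteq> 0 \<Longrightarrow> v y \<le> v x \<Longrightarrow> 0 \<le> v (x / y)"
  using v_finite[of y] by (simp add: v_divide ereal_diff_positive)

lemma v_p_power: "v (of_nat p ^ n) = ereal (real n)"
  by (simp add: v_power v_p)

lemma p_nonzero: "(of_nat p :: 'c) \<noteq> 0"
  using prime_p by auto

text \<open>If \<open>n\<close> had positive valuation, a Bezout relation between \<open>n\<close> and \<open>p\<close> would give
  \<open>1\<close> positive valuation.\<close>

lemma v_of_nat_coprime:
  assumes "\<not> p dvd n" shows "v (of_nat n) = 0"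
proof (rule antisym[OF _ v_of_nat_nonneg], rule ccontr)
  assume "\<not> v (of_nat n) \<le> 0"
  then have pos: "0 < v (of_nat n)" by simp
  have "coprime (int p) (int n)"
    using prime_p assms by (simp add: prime_imp_coprime)
  then obtain a b where ab: "a * int p + b * int n = 1"
    using bezout_int[of "int p" "int n"] by (auto simp: coprime_iff_gcd_eq_1)
  then have "(of_int (a * int p + b * int n) :: 'c) = 1" by simp
  then have eq: "(of_int a * of_nat p + of_int b * of_nat n :: 'c) = 1" by simp
  have "0 < v (of_int a * of_nat p)"
    using v_of_int_nonneg[of a] by (cases "v (of_int a)") (auto simp: v_mult v_p one_ereal_def)
  moreover have "0 < v (of_int b * of_nat n)"
    using pos v_of_int_nonneg[of b] by (cases "v (of_int b)"; cases "v (of_nat n)") (auto simp: v_mult)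
  ultimately have "0 < min (v (of_int a * of_nat p)) (v (of_int b * of_nat n))" by simp
  also have "\<dots> \<le> v 1" using v_ultra[of "of_int a * of_nat p" "of_int b * of_nat n"] eq by simp
  finally show False by simp
qed

lemma v_of_nat:
  assumes "n \<noteq> 0" shows "v (of_nat n) = ereal (real (multiplicity p n))"
proof -
  obtain n' where n': "n = p ^ multiplicity p n * n'" "\<not> p dvd n'"
    using multiplicity_decompose'[of n p] assms prime_p prime_elem_not_unit
    by (metis not_prime_unit)
  have "v (of_nat n) = v (of_nat p ^ multiplicity p n * of_nat n')"
    by (metis n'(1) of_nat_mult of_nat_power)
  then show ?thesis using v_of_nat_coprime[OF n'(2)] by (simp only: v_mult v_p_power) simp
qed

subsection \<open>Lifting the exponent\<close>

lemma v_power_minus_one_ge: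
  assumes "0 \<le> v q" shows "v (q - 1) \<le> v (q ^ n - 1)"
proof -
  have "0 \<le> v (\<Sum>i<n. q ^ i)"
    by (rule v_sum_ge) (use assms in \<open>simp add: v_power\<close>)
  then show ?thesis using v_mult_ge_left by (simp add: power_diff_1_eq)
qed

lemma v_nonneg_of_minus_one: "0 \<le> v (q - 1) \<Longrightarrow> 0 \<le> v q"
  using v_ultra[of "q - 1" 1] by (auto simp: min_def split: if_splits)

lemma v_unit_of_minus_one: "0 < v (q - 1) \<Longrightarrow> v q = 0"
  using v_add_eq[of 1 "q - 1"] by simp

text \<open>The cofactor of \<open>q - 1\<close> in \<open>q ^ n - 1\<close> is a geometric sum with \<open>n\<close> terms, each
  congruent to \<open>1\<close> modulo \<open>q - 1\<close>.\<close>

lemma v_power_coprime_minus_one: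
  assumes "0 < v (q - 1)" "\<not> p dvd n" shows "v (q ^ n - 1) = v (q - 1)"
proof -
  have q: "0 \<le> v q" using assms v_nonneg_of_minus_one by simp
  have "v (q - 1) \<le> v (\<Sum>i<n. q ^ i - 1)"
    by (rule v_sum_ge) (rule v_power_minus_one_ge[OF q])
  then have "v (of_nat n) < v (\<Sum>i<n. q ^ i - 1)"
    using assms v_of_nat_coprime by (metis order_less_le_trans)
  then have "v (of_nat n + (\<Sum>i<n. q ^ i - 1)) = 0"
    using v_add_eq v_of_nat_coprime[OF assms(2)] by metis
  then have "v (\<Sum>i<n. q ^ i) = 0" by (simp add: sum_subtractf)
  then show ?thesis by (simp add: power_diff_1_eq v_mult)
qed

text \<open>With \<open>x = q - 1\<close>, the geometric sum with \<open>p\<close> terms is \<open>p + x p (p - 1) / 2\<close> modulo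
  \<open>x\<^sup>2\<close>, which has valuation \<open>1\<close> for odd \<open>p\<close> as soon as \<open>x\<close> has valuation at
  least \<open>1\<close>. For \<open>p = 2\<close> the sum is \<open>2 + x\<close>; this is why the bound involves \<open>2 * p\<close>
  and not \<open>p\<close>.\<close>

lemma v_power_p_minus_one:
  assumes "v (2 * of_nat p) \<le> v (q - 1)" shows "v (q ^ p - 1) = v (q - 1) + 1"
proof -
  define x where "x = q - 1"
  have p2: "2 \<le> p" using prime_p prime_ge_2_nat by blast
  have x: "1 \<le> v x" "v (2 * of_nat p) \<le> v x"
    using assms v_of_nat_nonneg[of 2] order_trans[OF _ assms, of 1] unfolding x_def
    by (auto simp: v_mult v_p add_increasing)
  have x0: "0 \<le> v x" using x(1) order_trans zero_less_one_ereal by (metis less_imp_le)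
  have expand: "\<exists>r. 0 \<le> v r \<and> q ^ i = 1 + of_nat i * x + x ^ 2 * r" for i
  proof (induction i)
    case 0
    show ?case by (rule exI[of _ 0]) simp
  next
    case (Suc i)
    then obtain r where r: "0 \<le> v r" "q ^ i = 1 + of_nat i * x + x ^ 2 * r" by blast
    have "0 \<le> v (x * r)" using x0 r(1) by (simp add: v_mult)
    then have "0 \<le> v (of_nat i + r + x * r)"
      using v_ultra[of "of_nat i + r" "x * r"] v_ultra[of "of_nat i" r] v_of_nat_nonneg[of i] r(1)
      by (auto simp: min_def split: if_splits)
    moreover have "q ^ Suc i = 1 + of_nat (Suc i) * x + x ^ 2 * (of_nat i + r + x * r)"
    proof -
      have "q ^ Suc i = (1 + x) * q ^ i" by (simp add: x_def)
      also have "\<dots> = 1 + of_nat (Suc i) * x + x ^ 2 * (of_nat i + r + x * r)"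
        unfolding r(2) by (simp add: algebra_simps power2_eq_square)
      finally show ?thesis .
    qed
    ultimately show ?case by blast
  qed
  have large: "1 < v ((\<Sum>i<p. q ^ i) - of_nat p)"
  proof (cases "p = 2")
    case True
    have "(\<Sum>i<p. q ^ i) - of_nat p = x"
      unfolding True by (simp add: numeral_2_eq_2 x_def)
    moreover have "v (2 * of_nat p) = 2"
    proof -
      have "v 2 = 1" using v_p True by simp
      then show ?thesis using True v_mult[of 2 2] by (simp add: one_ereal_def)
    qed
    ultimately show ?thesis using x(2) less_le_trans[of 1 "2::ereal"] by simp
  next
    case False
    then have "odd p" using prime_p prime_odd_nat p2 by force
    obtain r where r: "\<And>i. 0 \<le> v (r i)" "\<And>i. q ^ i = 1 + of_nat i * x + x ^ 2 * r i"
      using expand by metis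
    obtain c where c: "p = 2 * c + 1" using \<open>odd p\<close> oddE by blast
    have "2 * (\<Sum>i<n. i) = n * (n - 1)" for n :: nat
      by (induction n) (auto simp: algebra_simps)
    then have "2 * (\<Sum>i<p. i) = 2 * (p * c)"
      using c by (metis add_diff_cancel_right' mult.left_commute)
    then have gsum: "(\<Sum>i<p. i) = p * c" by simp
    have "(\<Sum>i<p. q ^ i) - of_nat p = x * of_nat (\<Sum>i<p. i) + x ^ 2 * (\<Sum>i<p. r i)"
      unfolding r(2) by (simp add: sum.distrib sum_distrib_left mult.commute[of x])
    then have eq: "(\<Sum>i<p. q ^ i) - of_nat p = x * (of_nat p * of_nat c) + x ^ 2 * (\<Sum>i<p. r i)"
      unfolding gsum by simp
    have "0 \<le> v (\<Sum>i<p. r i)" by (rule v_sum_ge) (rule r(1))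
    then have "2 \<le> v (x ^ 2 * (\<Sum>i<p. r i))"
      using x(1) by (cases "v x"; cases "v (\<Sum>i<p. r i)") (auto simp: v_mult v_power one_ereal_def)
    moreover have "2 \<le> v (x * (of_nat p * of_nat c))"
      using x(1) v_of_nat_nonneg[of c]
      by (cases "v x"; cases "v (of_nat c)") (auto simp: v_mult v_p one_ereal_def)
    ultimately have "2 \<le> v ((\<Sum>i<p. q ^ i) - of_nat p)"
      unfolding eq by (meson min.boundedI order_trans v_ultra)
    then show ?thesis by (rule less_le_trans[rotated]) simp
  qed
  have "v (of_nat p + ((\<Sum>i<p. q ^ i) - of_nat p)) = 1"
    using v_add_eq large v_p by metis
  then show ?thesis by (simp add: power_diff_1_eq v_mult)
qed

lemma v_minus_one_pos:
  assumes "v (2 * of_nat p) \<le> v (q - 1)" shows "0 < v (q - 1)"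
proof -
  have "0 < (1 :: ereal)" by simp
  also have "1 \<le> v (2 * of_nat p)"
    using v_of_nat_nonneg[of 2] by (simp add: v_mult v_p add_increasing)
  also note assms
  finally show ?thesis .
qed

lemma v_power_minus_one:
  assumes q: "v (2 * of_nat p) \<le> v (q - 1)" and "n \<noteq> 0"
  shows "v (q ^ n - 1) = v (q - 1) + v (of_nat n)"
proof -
  \<comment> \<open>raising to the power \<open>p\<close> only increases the valuation, so the previous lemma iterates\<close>
  have p_pow: "v (q ^ (p ^ k) - 1) = v (q - 1) + ereal (real k)" for k
  proof (induction k)
    case (Suc k)
    have "v (2 * of_nat p) \<le> v (q ^ (p ^ k) - 1)"
      unfolding Suc using q by (meson add_increasing2 ereal_less_eq(5) of_nat_0_le_iff order_trans order_refl)
    then have "v ((q ^ (p ^ k)) ^ p - 1) = v (q ^ (p ^ k) - 1) + 1"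
      by (rule v_power_p_minus_one)
    then have "v (q ^ (p ^ Suc k) - 1) = v (q ^ (p ^ k) - 1) + 1"
      by (simp add: mult.commute flip: power_mult)
    then show ?case unfolding Suc by (cases "v (q - 1)") (auto simp: one_ereal_def)
  qed (simp flip: zero_ereal_def)
  obtain n' where n': "n = p ^ multiplicity p n * n'" "\<not> p dvd n'"
    using multiplicity_decompose'[of n p] assms prime_p by (metis not_prime_unit)
  let ?Q = "q ^ (p ^ multiplicity p n)"
  have "0 < v (q - 1)" using q by (rule v_minus_one_pos)
  then have "0 < v (?Q - 1)"
    unfolding p_pow by (meson add_pos_nonneg ereal_less_eq(5) of_nat_0_le_iff)
  then have "v (?Q ^ n' - 1) = v (?Q - 1)"
    using n'(2) by (rule v_power_coprime_minus_one)
  moreover have "?Q ^ n' = q ^ n" using n'(1) by (metis power_mult)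
  ultimately show ?thesis using p_pow v_of_nat[OF assms(2)] by simp
qed

end


section \<open>A Gaussian binomial theorem\<close>

text \<open>The Newton basis for interpolation at the nodes $1, q, q^2, \dots$.\<close>

definition newton_poly :: "'a::field \<Rightarrow> nat \<Rightarrow> 'a poly" where
  "newton_poly q r = (\<Prod>s<r. [:- (q ^ s), 1:])"

lemma poly_newton_poly: "poly (newton_poly q r) x = (\<Prod>s<r. x - q ^ s)"
  by (simp add: newton_poly_def poly_prod)

lemma newton_poly_Suc: "newton_poly q (Suc r) = newton_poly q r * [:- (q ^ r), 1:]"
  by (simp add: newton_poly_def)

text \<open>Passing from the node \<open>q ^ i\<close> to the node \<open>q ^ (i + 1)\<close>; the q-Pascal rule comes from
  this.\<close>

lemma newton_poly_shift:
  "poly (newton_poly q (Suc r)) (q * x) = (q * x - 1) * q ^ r * poly (newton_poly q r) x"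
proof (induction r)
  case 0
  show ?case by (simp add: newton_poly_def)
next
  case (Suc r)
  have "poly (newton_poly q (Suc (Suc r))) (q * x)
      = poly (newton_poly q (Suc r)) (q * x) * (q * (x - q ^ r))"
    by (subst newton_poly_Suc) (simp add: algebra_simps)
  also have "\<dots> = (q * x - 1) * (q * q ^ r) * (poly (newton_poly q r) x * (x - q ^ r))"
    unfolding Suc by (simp only: ac_simps)
  also have "poly (newton_poly q r) x * (x - q ^ r) = poly (newton_poly q (Suc r)) x"
    by (simp add: newton_poly_Suc algebra_simps)
  finally show ?case by simp
qed

text \<open>The Gaussian binomial coefficient. In this form it is the normalized Newton polynomial,
  evaluated at the node \<open>q ^ i\<close>, and so it is visibly a polynomial in \<open>q ^ i\<close>.\<close>

definition gauss_binomial :: "'a::field \<Rightarrow> nat \<Rightarrow> nat \<Rightarrow> 'a" where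
  "gauss_binomial q i r = poly (newton_poly q r) (q ^ i) / poly (newton_poly q r) (q ^ r)"

lemma newton_poly_eq_0: "i < r \<Longrightarrow> poly (newton_poly q r) (q ^ i) = 0"
  by (auto simp: poly_newton_poly intro!: prod_zero)

lemma newton_poly_nonzero:
  fixes q :: "'a::field"
  assumes "q \<noteq> 0" "\<And>l. 0 < l \<Longrightarrow> q ^ l \<noteq> 1"
  shows "poly (newton_poly q r) (q ^ r) \<noteq> 0"
proof -
  have "q ^ r \<noteq> q ^ s" if "s < r" for s
  proof
    assume "q ^ r = q ^ s"
    then have "q ^ s * q ^ (r - s) = q ^ s" using that by (simp flip: power_add)
    then show False using assms that by simp
  qed
  then show ?thesis by (auto simp: poly_newton_poly)
qed

lemma gauss_binomial_Suc:
  fixes q :: "'a::field"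
  assumes "q \<noteq> 0" "\<And>l. 0 < l \<Longrightarrow> q ^ l \<noteq> 1"
  shows "gauss_binomial q (Suc i) (Suc r)
           = gauss_binomial q i r + q ^ Suc r * gauss_binomial q i (Suc r)"
proof -
  let ?D = "\<lambda>r. poly (newton_poly q r) (q ^ r)" and ?N = "poly (newton_poly q r) (q ^ i)"
  have D: "?D r \<noteq> 0" "?D (Suc r) \<noteq> 0" using newton_poly_nonzero assms by blast+
  have DS: "?D (Suc r) = (q ^ Suc r - 1) * q ^ r * ?D r"
    using newton_poly_shift[of q r "q ^ r"] by simp
  have "gauss_binomial q (Suc i) (Suc r) * ?D (Suc r) = (q ^ Suc i - 1) * q ^ r * ?N"
    using newton_poly_shift[of q r "q ^ i"] D by (simp add: gauss_binomial_def)
  also have "\<dots> = ?N * ((q ^ Suc r - 1) * q ^ r) + q ^ Suc r * (?N * (q ^ i - q ^ r))"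
    by (simp add: algebra_simps)
  also have "\<dots> = (gauss_binomial q i r + q ^ Suc r * gauss_binomial q i (Suc r)) * ?D (Suc r)"
  proof -
    have "?N * ((q ^ Suc r - 1) * q ^ r) = gauss_binomial q i r * ?D (Suc r)"
      unfolding DS gauss_binomial_def using D by simp
    moreover have "?N * (q ^ i - q ^ r) = gauss_binomial q i (Suc r) * ?D (Suc r)"
    proof -
      have "gauss_binomial q i (Suc r) * ?D (Suc r) = poly (newton_poly q (Suc r)) (q ^ i)"
        using D(2) by (simp add: gauss_binomial_def)
      then show ?thesis by (simp add: newton_poly_Suc algebra_simps)
    qed
    ultimately show ?thesis by (simp add: algebra_simps)
  qed
  finally show ?thesis using D by simp
qed

text \<open>Newton's interpolation formula for \<open>X ^ i\<close>. In the induction, \<open>X\<close> times the \<open>r\<close>-th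
  Newton polynomial is the next one plus \<open>q ^ r\<close> times itself, and the q-Pascal rule collects
  the terms.\<close>

lemma monom_eq_sum_newton_poly:
  fixes q :: "'a::field"
  assumes "q \<noteq> 0" "\<And>l. 0 < l \<Longrightarrow> q ^ l \<noteq> 1"
  shows "[:0, 1:] ^ i = (\<Sum>r\<le>i. Polynomial.smult (gauss_binomial q i r) (newton_poly q r))"
proof (induction i)
  case 0
  show ?case by (simp add: gauss_binomial_def newton_poly_def)
next
  case (Suc i)
  let ?g = "gauss_binomial q" and ?n = "newton_poly q"
  have X: "[:0, 1:] * ?n r = ?n (Suc r) + Polynomial.smult (q ^ r) (?n r)" for r
    by (simp add: newton_poly_Suc algebra_simps)
  have top: "?g i (Suc i) = 0" by (simp add: gauss_binomial_def newton_poly_eq_0)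
  have zero: "?g k 0 = 1" for k by (simp add: gauss_binomial_def newton_poly_def)
  have "[:0, 1:] ^ Suc i = (\<Sum>r\<le>i. Polynomial.smult (?g i r) ([:0, 1:] * ?n r))"
    unfolding power_Suc Suc sum_distrib_left by simp
  also have "\<dots> = (\<Sum>r\<le>i. Polynomial.smult (?g i r) (?n (Suc r))) + (\<Sum>r\<le>i. Polynomial.smult (q ^ r * ?g i r) (?n r))"
    unfolding X by (simp add: smult_add_right sum.distrib mult.commute)
  also have "(\<Sum>r\<le>i. Polynomial.smult (q ^ r * ?g i r) (?n r))
      = (\<Sum>r\<le>Suc i. Polynomial.smult (q ^ r * ?g i r) (?n r))"
    by (simp add: top)
  also have "\<dots> = ?n 0 + (\<Sum>r\<le>i. Polynomial.smult (q ^ Suc r * ?g i (Suc r)) (?n (Suc r)))"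
    by (simp add: sum.atMost_Suc_shift zero del: sum.atMost_Suc)
  also have "(\<Sum>r\<le>i. Polynomial.smult (?g i r) (?n (Suc r))) + (?n 0 + (\<Sum>r\<le>i. Polynomial.smult (q ^ Suc r * ?g i (Suc r)) (?n (Suc r))))
      = ?n 0 + (\<Sum>r\<le>i. Polynomial.smult (?g (Suc i) (Suc r)) (?n (Suc r)))"
    using gauss_binomial_Suc[OF assms]
    by (simp add: smult_add_left sum.distrib del: power_Suc)
  also have "\<dots> = (\<Sum>r\<le>Suc i. Polynomial.smult (?g (Suc i) r) (?n r))"
    by (simp add: sum.atMost_Suc_shift zero del: sum.atMost_Suc)
  finally show ?case .
qed

text \<open>The Newton polynomial in the variable \<open>X - 1\<close>.\<close>

definition shifted_newton_poly :: "'a::field \<Rightarrow> nat \<Rightarrow> 'a poly" where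
  "shifted_newton_poly q r = (\<Prod>s<r. [:- (q ^ s - 1), 1:])"

text \<open>Compare the coefficients of \<open>Z ^ j\<close> in the previous formula for \<open>X = 1 + Z\<close>. The
  outcome is an explicit Newton expansion of \<open>i choose j\<close> as a function of \<open>q ^ i\<close>, which
  makes the logarithm of \<open>q ^ i\<close> to the base \<open>q\<close> superfluous.\<close>

lemma binomial_eq_sum_gauss_binomial:
  fixes q :: "'a::field"
  assumes "q \<noteq> 0" "\<And>l. 0 < l \<Longrightarrow> q ^ l \<noteq> 1"
  shows "of_nat (i choose j)
           = (\<Sum>r\<le>i. gauss_binomial q i r * Polynomial.coeff (shifted_newton_poly q r) j)"
proof -
  have n: "pcompose (newton_poly q r) [:1, 1:] = shifted_newton_poly q r" for r
    by (simp add: newton_poly_def shifted_newton_poly_def pcompose_prod pcompose_pCons)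
  have "[:1, 1:] ^ i = pcompose ([:0, 1:] ^ i) ([:1, 1:] :: 'a poly)"
    by (induction i) (simp_all add: pcompose_mult pcompose_pCons pcompose_1)
  also have "\<dots> = (\<Sum>r\<le>i. Polynomial.smult (gauss_binomial q i r) (shifted_newton_poly q r))"
  proof -
    have "[:0, 1:] ^ i = (\<Sum>r\<le>i. Polynomial.smult (gauss_binomial q i r) (newton_poly q r))"
      by (rule monom_eq_sum_newton_poly) (use assms in auto)
    then show ?thesis by (simp only: pcompose_sum pcompose_smult n)
  qed
  finally have "Polynomial.coeff ([:1, 1:] ^ i) j
      = (\<Sum>r\<le>i. gauss_binomial q i r * Polynomial.coeff (shifted_newton_poly q r) j)"
    by (simp add: coeff_sum)
  moreover have "Polynomial.coeff ([:1, 1:] ^ i :: 'a poly) j = of_nat (i choose j)"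
    by (cases "j \<le> i") (simp_all add: coeff_linear_poly_power coeff_eq_0 binomial_eq_0 degree_linear_power)
  ultimately show ?thesis by simp
qed

text \<open>The coefficient of degree \<open>j\<close> is, up to sign, an elementary symmetric polynomial of
  degree \<open>r - j\<close> in the \<open>q ^ s - 1\<close>, each of which is a multiple of \<open>q - 1\<close>.\<close>

lemma (in p_valued_field) v_coeff_shifted_newton_poly:
  assumes "0 \<le> v q" "0 \<le> v (q - 1)"
  shows "ereal (real (r - j)) * v (q - 1) \<le> v (Polynomial.coeff (shifted_newton_poly q r) j)"
proof (induction r arbitrary: j)
  case 0
  show ?case by (cases j) (simp_all add: shifted_newton_poly_def flip: zero_ereal_def)
next
  case (Suc r)
  let ?w = "v (q - 1)" and ?c = "Polynomial.coeff (shifted_newton_poly q r)"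
  have rec: "Polynomial.coeff (shifted_newton_poly q (Suc r)) j
      = - (q ^ r - 1) * ?c j + (case j of 0 \<Rightarrow> 0 | Suc j' \<Rightarrow> ?c j')"
    by (cases j) (simp_all add: shifted_newton_poly_def mult.commute[of _ "[:_, _:]"])
  have le: "ereal (real (Suc r - j)) * ?w \<le> ereal (1 + real (r - j)) * ?w"
    by (rule ereal_mult_right_mono) (use assms(2) in auto)
  have "ereal (1 + real (r - j)) * ?w = ?w + ereal (real (r - j)) * ?w"
    by (cases ?w) (auto simp: algebra_simps)
  also have "\<dots> \<le> v (q ^ r - 1) + v (?c j)"
    by (rule add_mono[OF v_power_minus_one_ge[OF assms(1)] Suc])
  also have "\<dots> = v (- (q ^ r - 1) * ?c j)"
    by (simp only: v_mult v_uminus)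
  finally have 1: "ereal (real (Suc r - j)) * ?w \<le> v (- (q ^ r - 1) * ?c j)"
    using le by simp
  have 2: "ereal (real (Suc r - j)) * ?w \<le> v (case j of 0 \<Rightarrow> 0 | Suc j' \<Rightarrow> ?c j')"
    using Suc by (cases j) auto
  show ?case unfolding rec using 1 2 v_ultra order_trans min.boundedI by metis
qed

text \<open>The normalizing factor is a unit times the product of the \<open>q ^ l - 1\<close>, \<open>0 < l \<le> r\<close>, to
  which lifting the exponent applies.\<close>

lemma (in p_valued_field) v_newton_poly:
  assumes "v (2 * of_nat p) \<le> v (q - 1)"
  shows "v (poly (newton_poly q r) (q ^ r)) = ereal (real r) * v (q - 1) + v (of_nat (fact r))"
proof (induction r)
  case 0
  show ?case by (simp add: newton_poly_def flip: zero_ereal_def)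
next
  case (Suc r)
  have "0 < v (q - 1)" using assms by (rule v_minus_one_pos)
  then have "v q = 0" by (rule v_unit_of_minus_one)
  have "v (poly (newton_poly q (Suc r)) (q ^ Suc r)) = v (q ^ Suc r - 1) + v (poly (newton_poly q r) (q ^ r))"
    using newton_poly_shift[of q r "q ^ r"] \<open>v q = 0\<close> by (simp only: power_Suc[symmetric] v_mult v_power) simp
  also have "\<dots> = (v (q - 1) + v (of_nat (Suc r))) + (ereal (real r) * v (q - 1) + v (of_nat (fact r)))"
    by (simp only: Suc v_power_minus_one[OF assms nat.distinct(2)])
  also have "\<dots> = (v (q - 1) + ereal (real r) * v (q - 1)) + v (of_nat (fact (Suc r)))"
    by (simp only: fact_Suc of_nat_mult v_mult of_nat_id) (simp only: ac_simps)
  also have "v (q - 1) + ereal (real r) * v (q - 1) = ereal (real (Suc r)) * v (q - 1)"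
    by (cases "v (q - 1)") (auto simp: algebra_simps)
  finally show ?case .
qed

context p_valued_field begin

subsection \<open>Integral elements and integral polynomials\<close>

lemma integers_subset: "x \<in> integers \<Longrightarrow> x \<in> K"
  and integersI: "x \<in> K \<Longrightarrow> 0 \<le> v x \<Longrightarrow> x \<in> integers"
  by (auto simp: integers_def)

lemma K_zero: "0 \<in> K" using K_add[OF K_one K_uminus[OF K_one]] by simp
lemma K_diff: "x \<in> K \<Longrightarrow> y \<in> K \<Longrightarrow> x - y \<in> K" using K_add K_uminus by fastforce
lemma K_divide: "x \<in> K \<Longrightarrow> y \<in> K \<Longrightarrow> x / y \<in> K" using K_mult K_inverse by (simp add: divide_inverse)
lemma K_power: "x \<in> K \<Longrightarrow> x ^ n \<in> K" by (induction n) (auto intro: K_one K_mult)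
lemma K_of_nat: "of_nat n \<in> K" by (induction n) (auto intro: K_zero K_one K_add)
lemma K_prod: "(\<And>i. i \<in> I \<Longrightarrow> f i \<in> K) \<Longrightarrow> prod f I \<in> K"
  by (induction I rule: infinite_finite_induct) (auto intro: K_one K_mult)

lemma integers_zero: "0 \<in> integers" and integers_one: "1 \<in> integers"
  by (auto intro!: integersI K_zero K_one)
lemma integers_add: "x \<in> integers \<Longrightarrow> y \<in> integers \<Longrightarrow> x + y \<in> integers"
  using v_ultra[of x y] by (auto simp: integers_def min_def intro: K_add split: if_splits)
lemma integers_mult: "x \<in> integers \<Longrightarrow> y \<in> integers \<Longrightarrow> x * y \<in> integers"
  by (auto simp: integers_def v_mult intro: K_mult)
lemma integers_uminus: "x \<in> integers \<Longrightarrow> - x \<in> integers"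
  by (auto simp: integers_def intro: K_uminus)
lemma integers_of_nat: "of_nat n \<in> integers"
  by (auto intro!: integersI K_of_nat v_of_nat_nonneg)
lemma integers_power: "x \<in> integers \<Longrightarrow> x ^ n \<in> integers"
  by (induction n) (auto intro: integers_one integers_mult)
lemma integers_prod: "(\<And>i. i \<in> I \<Longrightarrow> f i \<in> integers) \<Longrightarrow> prod f I \<in> integers"
  by (induction I rule: infinite_finite_induct) (auto intro: integers_one integers_mult)
lemma integers_sum: "(\<And>i. i \<in> I \<Longrightarrow> f i \<in> integers) \<Longrightarrow> sum f I \<in> integers"
  by (induction I rule: infinite_finite_induct) (auto intro: integers_zero integers_add)
lemma unit_powi_integer:
  assumes "x \<in> K" "v x = 0" shows "x powi n \<in> integers"
proof -
  have "x \<noteq> 0" using assms(2) by (auto simp: zero_ereal_def)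
  then show ?thesis using assms
    by (auto simp: power_int_def integers_def v_power v_inverse power_inverse[symmetric] simp del: power_inverse
      intro!: K_power K_inverse)
qed

definition int_poly :: "'c poly \<Rightarrow> bool" where
  "int_poly f \<longleftrightarrow> (\<forall>n. Polynomial.coeff f n \<in> integers)"

lemma int_poly_pCons: "int_poly (pCons a f) \<longleftrightarrow> a \<in> integers \<and> int_poly f"
  unfolding int_poly_def by (auto simp: coeff_pCons split: nat.splits)

lemma int_poly_0: "int_poly 0"
  by (simp add: int_poly_def integers_zero)

lemma int_poly_1: "int_poly 1"
  unfolding one_pCons int_poly_pCons by (simp add: int_poly_0 integers_one)

lemma int_poly_add: "int_poly f \<Longrightarrow> int_poly g \<Longrightarrow> int_poly (f + g)"
  by (simp add: int_poly_def integers_add)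

lemma int_poly_smult: "a \<in> integers \<Longrightarrow> int_poly f \<Longrightarrow> int_poly (Polynomial.smult a f)"
  by (simp add: int_poly_def integers_mult)

lemma int_poly_mult: "int_poly f \<Longrightarrow> int_poly g \<Longrightarrow> int_poly (f * g)"
  by (auto simp: int_poly_def coeff_mult intro!: integers_sum integers_mult)

lemma int_poly_prod: "(\<And>i. i \<in> I \<Longrightarrow> int_poly (f i)) \<Longrightarrow> int_poly (prod f I)"
  by (induction I rule: infinite_finite_induct) (auto intro: int_poly_1 int_poly_mult)

lemma int_poly_sum: "(\<And>i. i \<in> I \<Longrightarrow> int_poly (f i)) \<Longrightarrow> int_poly (sum f I)"
  by (induction I rule: infinite_finite_induct) (auto intro: int_poly_0 int_poly_add)

lemma int_poly_pcompose: "int_poly f \<Longrightarrow> int_poly g \<Longrightarrow> int_poly (pcompose f g)"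
proof (induction f rule: pCons_induct)
  case (pCons a f)
  then show ?case
    by (auto simp: pcompose_pCons int_poly_pCons int_poly_0 intro!: int_poly_add int_poly_mult)
qed (simp add: int_poly_0)

lemma int_poly_poly: "int_poly f \<Longrightarrow> x \<in> integers \<Longrightarrow> poly f x \<in> integers"
  by (induction f rule: pCons_induct)
    (auto simp: int_poly_pCons integers_zero intro!: integers_add integers_mult)

text \<open>The polynomial that takes the values \<open>i choose j\<close> at the nodes, times a power of \<open>p\<close>.
  With \<open>w = v (q - 1)\<close>, the Newton coefficient of degree \<open>r\<close> has valuation at least
  \<open>(r - j) w - r w - v (r!) = - j w - v (r!)\<close>. The multiple of \<open>w\<close> that is lost depends on
  \<open>j\<close> and not on the number of nodes, which is exactly what the growth condition on the
  \<open>j\<close>-th finite difference pays for: \<open>m j\<close> for the main part, and \<open>2 N + v (N!)\<close> for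
  the rest since \<open>w \<le> m + 2\<close>.\<close>

lemma binomial_interpolation:
  assumes q: "q \<in> K" "v (2 * of_nat p) \<le> v (q - 1)" "q \<noteq> 1"
    and w: "ereal (real m) \<le> v (q - 1)" "v (q - 1) \<le> ereal (real m + 2)"
    and c: "multiplicity p (fact N :: nat) + 2 * N \<le> c" and j: "j \<le> N"
  shows "\<exists>P. int_poly P \<and>
    (\<forall>i\<le>N. poly P (q powi (d + int i)) = of_nat p ^ (m * j + c) * of_nat (i choose j))"
proof -
  define D where "D r = poly (newton_poly q r) (q ^ r)" for r
  define a where "a r = Polynomial.coeff (shifted_newton_poly q r) j" for r
  define b where "b r = of_nat p ^ (m * j + c) * a r / D r" for r
  have qpos: "0 < v (q - 1)" using q(2) by (rule v_minus_one_pos)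
  then have vq: "v q = 0" by (rule v_unit_of_minus_one)
  then have qint: "q \<in> integers" and q0: "q \<noteq> 0"
    using q by (auto intro!: integersI simp: zero_ereal_def)
  obtain \<omega> where \<omega>: "v (q - 1) = ereal \<omega>"
    using v_finite[of "q - 1"] q(3) by auto
  have ql: "q ^ l \<noteq> 1" if "0 < l" for l
    using v_power_minus_one[OF q(2), of l] that \<omega> v_of_nat[of l]
    by auto
  have D0: "D r \<noteq> 0" for r unfolding D_def using newton_poly_nonzero[OF q0 ql] by blast
  have K_shift: "Polynomial.coeff (\<Prod>s<r. [:- (q ^ s - 1), 1:]) n \<in> K" for r n
  proof (induction r arbitrary: n)
    case 0
    show ?case by (auto simp: coeff_1 K_one K_zero)
  next
    case (Suc r)
    then show ?case
      by (cases n) (auto simp: mult.commute[of _ "[:_, _:]"] intro!: K_add K_mult K_diff K_uminus K_power K_one q(1))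
  qed
  have K_D: "D r \<in> K" for r
    unfolding D_def poly_newton_poly by (intro K_prod K_diff K_power q)
  have b: "b r \<in> integers" if r: "r \<le> N" for r
  proof (rule integersI)
    show "b r \<in> K" unfolding b_def a_def shifted_newton_poly_def
      by (intro K_divide K_mult K_power K_of_nat K_shift K_D)
    have "(of_nat (fact N) :: 'c) = of_nat (fact r) * of_nat (fact N div fact r)"
      using fact_dvd[OF r, where ?'a = nat] by (metis dvd_mult_div_cancel of_nat_mult)
    then have "v (of_nat (fact r)) \<le> v (of_nat (fact N))"
      using v_mult_ge_left v_of_nat_nonneg by metis
    then have mr: "real (multiplicity p (fact r :: nat)) \<le> real (multiplicity p (fact N :: nat))"
      using v_of_nat[of "fact r"] v_of_nat[of "fact N"] by simp
    have vD: "v (D r) = ereal (real r * \<omega> + real (multiplicity p (fact r :: nat)))"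
      unfolding D_def v_newton_poly[OF q(2)] using v_of_nat[of "fact r"] \<omega> by simp
    have va: "ereal (real (r - j) * \<omega>) \<le> v (a r)"
      using v_coeff_shifted_newton_poly[of q r j] vq qpos \<omega> unfolding a_def by simp
    have m: "real m \<le> \<omega>" "\<omega> \<le> real m + 2" using w \<omega> by auto
    have "(real r - real j) * \<omega> \<le> real (r - j) * \<omega>"
      using m by (intro mult_right_mono) auto
    moreover have "real j * \<omega> \<le> real j * (real m + 2)"
      using m by (intro mult_left_mono) auto
    moreover have "real j * 2 \<le> real N * 2" using j by simp
    moreover have "real (multiplicity p (fact N :: nat)) + real N * 2 \<le> real c"
      using c by linarith
    ultimately have "real r * \<omega> + real (multiplicity p (fact r :: nat)) \<le> real (m * j + c) + real (r - j) * \<omega>"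
      using mr by (simp add: algebra_simps)
    then have "v (D r) \<le> ereal (real (m * j + c)) + ereal (real (r - j) * \<omega>)"
      unfolding vD by simp
    also have "\<dots> \<le> v (of_nat p ^ (m * j + c) * a r)"
      unfolding v_mult v_p_power by (rule add_left_mono[OF va])
    finally show "0 \<le> v (b r)" unfolding b_def by (rule v_divide_nonneg[OF D0])
  qed
  \<comment> \<open>the nodes start at \<open>q ^ d\<close> instead of \<open>1\<close>, and \<open>q\<close> is a unit\<close>
  define P where "P = pcompose (\<Sum>r\<le>N. Polynomial.smult (b r) (newton_poly q r)) [:0, q powi (- d):]"
  have "int_poly (newton_poly q r)" for r
    unfolding newton_poly_def
    by (rule int_poly_prod) (simp add: int_poly_pCons int_poly_0 integers_one integers_uminus integers_power qint)
  then have "int_poly P" unfolding P_def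
    using unit_powi_integer[OF q(1) vq]
    by (intro int_poly_pcompose int_poly_sum int_poly_smult b)
      (auto simp: int_poly_pCons int_poly_0 integers_zero)
  moreover have "poly P (q powi (d + int i)) = of_nat p ^ (m * j + c) * of_nat (i choose j)"
    if i: "i \<le> N" for i
  proof -
    have "poly P (q powi (d + int i)) = (\<Sum>r\<le>N. b r * poly (newton_poly q r) (q ^ i))"
    proof -
      have "q powi (d + int i) * q powi (- d) = q ^ i"
        using q0 by (simp flip: power_int_add)
      then show ?thesis by (simp add: P_def poly_pcompose poly_sum)
    qed
    also have "\<dots> = (\<Sum>r\<le>i. b r * poly (newton_poly q r) (q ^ i))"
      by (rule sum.mono_neutral_right) (use i in \<open>auto simp: newton_poly_eq_0\<close>)
    also have "\<dots> = of_nat p ^ (m * j + c) * (\<Sum>r\<le>i. gauss_binomial q i r * a r)"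
      by (auto simp: b_def gauss_binomial_def sum_distrib_left D_def intro!: sum.cong)
    also have "(\<Sum>r\<le>i. gauss_binomial q i r * a r) = of_nat (i choose j)"
      unfolding a_def by (rule binomial_eq_sum_gauss_binomial[OF q0 ql, symmetric])
    finally show ?thesis .
  qed
  ultimately show ?thesis by blast
qed

end


section \<open>Scalars\<close>

lemma scalars_simps [simp]:
  "carrier (scalars A) = A" "x \<otimes>\<^bsub>scalars A\<^esub> y = x * y" "\<one>\<^bsub>scalars A\<^esub> = 1"
  "x \<oplus>\<^bsub>scalars A\<^esub> y = x + y" "\<zero>\<^bsub>scalars A\<^esub> = 0" "x \<odot>\<^bsub>scalars A\<^esub> y = x * y"
  by (simp_all add: scalars_def)

lemma cring_scalars:
  assumes "1 \<in> A" "\<And>x y. x \<in> A \<Longrightarrow> y \<in> A \<Longrightarrow> x + y \<in> A" "\<And>x. x \<in> A \<Longrightarrow> - x \<in> A"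
    "\<And>x y. x \<in> A \<Longrightarrow> y \<in> A \<Longrightarrow> x * y \<in> A"
  shows "cring (scalars A)"
proof (rule cringI)
  have "0 \<in> A" using assms(2)[OF assms(1) assms(3)[OF assms(1)]] by simp
  moreover have "\<exists>y\<in>A. y + x = 0" if "x \<in> A" for x
    using assms(3)[OF that] by (intro bexI[of _ "- x"]) auto
  ultimately show "abelian_group (scalars A)"
    using assms(2) by (intro abelian_groupI) (auto simp: algebra_simps)
  show "comm_monoid (scalars A)"
    using assms by (intro comm_monoidI) (auto simp: algebra_simps)
qed (auto simp: algebra_simps)

lemma (in p_valued_field) cring_K: "cring (scalars K)"
  by (rule cring_scalars) (auto intro: K_one K_add K_uminus K_mult)

section \<open>Closures in the metric of the valuation\<close>

context p_valued_field begin

lemma p_gt_1: "1 < real p"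
  using prime_p prime_gt_1_nat by (metis of_nat_1 of_nat_less_iff)

lemma padic_metric: "Metric_space UNIV (padic_dist p v)"
proof
  fix x y z :: 'c
  have p0: "0 < real p" using p_gt_1 by simp
  show "0 \<le> padic_dist p v x y" by (simp add: padic_dist_def)
  show "padic_dist p v x y = padic_dist p v y x"
    using v_minus_commute[of x y] by (simp add: padic_dist_def)
  show "padic_dist p v x y = 0 \<longleftrightarrow> x = y" using p0 by (simp add: padic_dist_def)
  show "padic_dist p v x z \<le> padic_dist p v x y + padic_dist p v y z"
  proof (cases "x = y \<or> y = z \<or> x = z")
    case False
    then have ne: "x - y \<noteq> 0" "y - z \<noteq> 0" "x - z \<noteq> 0" by auto
    let ?w = "\<lambda>x. real_of_ereal (v x)"
    have "min (v (x - y)) (v (y - z)) \<le> v (x - z)"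
      using v_ultra[of "x - y" "y - z"] by simp
    then have "?w (x - y) \<le> ?w (x - z) \<or> ?w (y - z) \<le> ?w (x - z)"
      using v_finite[OF ne(1)] v_finite[OF ne(2)] v_finite[OF ne(3)]
      by (metis ereal_less_eq(3) min_def)
    then have "real p powr - ?w (x - z) \<le> real p powr - ?w (x - y) \<or>
        real p powr - ?w (x - z) \<le> real p powr - ?w (y - z)"
      using p_gt_1 by auto
    moreover have "0 \<le> real p powr - ?w (x - y)" "0 \<le> real p powr - ?w (y - z)" by auto
    ultimately show ?thesis using False by (auto simp: padic_dist_def simp del: powr_ge_zero)
  qed (use p0 in \<open>auto simp: padic_dist_def\<close>)
qed

lemma padic_dist_less:
  assumes "x \<noteq> 0"
  shows "padic_dist p v y z < padic_dist p v x 0 \<longleftrightarrow> v x < v (y - z)"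
proof (cases "y = z")
  case True
  then show ?thesis using p_gt_1 assms v_finite[OF assms] by (auto simp: padic_dist_def)
next
  case False
  then have "y - z \<noteq> 0" by simp
  with False show ?thesis
    using p_gt_1 assms v_finite[OF assms] v_finite[OF \<open>y - z \<noteq> 0\<close>]
    by (auto simp: padic_dist_def) (metis ereal_less(2) less_ereal.simps(1))+
qed

text \<open>A complete subfield is closed and contains the rational numbers.\<close>

lemma Q_p_subset:
  assumes "Metric_space.mcomplete K (padic_dist p v)" shows "Q_p p v \<subseteq> K"
proof -
  interpret Metric_space UNIV "padic_dist p v" by (rule padic_metric)
  interpret Submetric UNIV "padic_dist p v" K by standard simp
  have int: "of_int n \<in> K" for n
    using K_of_nat[of "nat n"] K_uminus[OF K_of_nat[of "nat (- n)"]] by (cases "0 \<le> n") auto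
  then have "\<rat> \<subseteq> K"
    by (auto elim!: Rats_cases' intro!: K_divide)
  then show ?thesis
    unfolding Q_p_def padic_topology_def using mcomplete_imp_closedin[OF assms]
    by (rule closure_of_minimal)
qed

lemma v_one_units:
  assumes "x \<in> one_units p v" shows "v (2 * of_nat p) \<le> v (x - 1)"
  using assms v_mult_ge_left by (auto simp: one_units_def)

text \<open>Were \<open>v (u - 1)\<close> larger than \<open>v (2 * p)\<close>, the same would hold for the closure of the
  group generated by \<open>u\<close>, and \<open>1 + 2 * p\<close> would be missed.\<close>

lemma v_topological_generator:
  assumes G: "group G" "topspace T = carrier G"
    and f: "f \<in> iso G (scalars (one_units p v))"
      "homeomorphic_map T (subtopology (padic_topology p v) (one_units p v)) f"
    and g: "g \<in> carrier G" "T closure_of generate G {g} = carrier G"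
  shows "v (f g - 1) = v (2 * of_nat p)"
proof (rule antisym)
  interpret Metric_space UNIV "padic_dist p v" by (rule padic_metric)
  interpret G: group G by (rule G)
  have f_in: "f x \<in> one_units p v" if "x \<in> carrier G" for x
    using f(1) that by (auto simp: iso_def hom_def)
  have f_mult: "f (x \<otimes>\<^bsub>G\<^esub> y) = f x * f y" if "x \<in> carrier G" "y \<in> carrier G" for x y
    using f(1) that by (auto simp: iso_def hom_def)
  have large: "v (2 * of_nat p) \<le> v (f x - 1)" if "x \<in> carrier G" for x
    using v_one_units f_in that by blast
  then show "v (2 * of_nat p) \<le> v (f g - 1)" using g by blast
  have unit: "v (f x) = 0" if "x \<in> carrier G" for x
    using v_unit_of_minus_one v_minus_one_pos large that by blast
  have f_one: "f \<one>\<^bsub>G\<^esub> = 1"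
    using f_mult[of "\<one>\<^bsub>G\<^esub>" "\<one>\<^bsub>G\<^esub>"] unit[of "\<one>\<^bsub>G\<^esub>"] by (auto simp: zero_ereal_def)
  have gen: "x \<in> carrier G \<and> v (f g - 1) \<le> v (f x - 1)" if "x \<in> generate G {g}" for x
    using that
  proof (induction rule: generate.induct)
    case (inv h)
    then have h: "h = g" by simp
    have "f (inv\<^bsub>G\<^esub> g) * f g = 1" using f_mult[of "inv\<^bsub>G\<^esub> g" g] f_one g by simp
    then have "f (inv\<^bsub>G\<^esub> g) - 1 = - (f (inv\<^bsub>G\<^esub> g) * (f g - 1))"
      by (simp add: algebra_simps)
    then have "v (f (inv\<^bsub>G\<^esub> g) - 1) = v (f g - 1)"
      using unit[of "inv\<^bsub>G\<^esub> g"] g by (simp only: v_uminus v_mult) simp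
    then show ?case using h g by simp
  next
    case (eng h1 h2)
    have eq: "f (h1 \<otimes>\<^bsub>G\<^esub> h2) - 1 = (f h1 - 1) * f h2 + (f h2 - 1)"
      using eng f_mult by (simp add: algebra_simps)
    have "min (v (f h1 - 1)) (v (f h2 - 1)) \<le> v (f (h1 \<otimes>\<^bsub>G\<^esub> h2) - 1)"
      unfolding eq using v_ultra[of "(f h1 - 1) * f h2" "f h2 - 1"] unit[of h2] eng
      by (simp add: v_mult)
    then show ?case using eng by (meson G.m_closed min.boundedI order_trans)
  qed (use g f_one in auto)
  let ?c = "1 + 2 * of_nat p :: 'c" and ?r = "padic_dist p v (2 * of_nat p) 0"
  have "1 \<in> Q_p p v"
    unfolding Q_p_def padic_topology_def using closure_of_subset[of "\<rat>" mtopology] by auto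
  then have "\<exists>z. ?c = 1 + 2 * of_nat p * z \<and> z \<in> Q_p p v \<and> 0 \<le> v z"
    by (intro exI[of _ 1]) simp
  then have "?c \<in> one_units p v" unfolding one_units_def by blast
  moreover have "f ` carrier G = one_units p v"
    using f(1) by (simp add: iso_def bij_betw_def)
  ultimately obtain g0 where g0: "g0 \<in> carrier G" "f g0 = ?c"
    by (metis imageE)
  have "continuous_map T (subtopology (padic_topology p v) (one_units p v)) f"
    using f(2) homeomorphic_imp_continuous_map by blast
  then have cont: "continuous_map T mtopology f"
    unfolding padic_topology_def using continuous_map_in_subtopology by blast
  define W where "W = {x \<in> topspace T. f x \<in> mball ?c ?r}"
  have "openin T W"
    unfolding W_def by (rule openin_continuous_map_preimage[OF cont]) simp
  moreover have "g0 \<in> W"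
    using g0 G(2) p_gt_1 p_nonzero by (auto simp: W_def padic_dist_def)
  moreover have "g0 \<in> T closure_of generate G {g}" using g(2) g0(1) by simp
  ultimately obtain x where x: "x \<in> generate G {g}" "x \<in> W"
    by (auto simp: in_closure_of)
  then have "padic_dist p v ?c (f x) < ?r" by (auto simp: W_def)
  then have "v (2 * of_nat p) < v (?c - f x)"
    using padic_dist_less p_nonzero by (metis mult_eq_0_iff zero_neq_numeral)
  then have "v (2 * of_nat p) < v (f x - ?c)" by (metis v_minus_commute)
  then have "v (2 * of_nat p + (f x - ?c)) = v (2 * of_nat p)" by (rule v_add_eq)
  then have "v (f x - 1) = v (2 * of_nat p)" by simp
  then show "v (f g - 1) \<le> v (2 * of_nat p)" using gen[OF x(1)] by simp
qed

end

section \<open>Consequences of the setting\<close>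

lemma subfield_scalars:
  assumes "subfield K (scalars (UNIV :: 'c::field set))"
  shows "1 \<in> K" "x \<in> K \<Longrightarrow> y \<in> K \<Longrightarrow> x + y \<in> K" "x \<in> K \<Longrightarrow> - x \<in> K"
    "x \<in> K \<Longrightarrow> y \<in> K \<Longrightarrow> x * y \<in> K" "x \<in> K \<Longrightarrow> inverse x \<in> K"
proof -
  interpret U: cring "scalars (UNIV :: 'c set)" by (rule cring_scalars) auto
  interpret subfield K "scalars (UNIV :: 'c set)" by (rule assms)
  have sub: "subring K (scalars (UNIV :: 'c set))" ..
  have minus: "\<ominus>\<^bsub>scalars UNIV\<^esub> x = - x" for x :: 'c
    using U.minus_equality[of "- x" x] by simp
  show "1 \<in> K" "x \<in> K \<Longrightarrow> y \<in> K \<Longrightarrow> x + y \<in> K" "x \<in> K \<Longrightarrow> - x \<in> K"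
    "x \<in> K \<Longrightarrow> y \<in> K \<Longrightarrow> x * y \<in> K"
    using subringE[OF sub] minus by simp_all
  show "inverse x \<in> K" if "x \<in> K"
  proof (cases "x = 0")
    case False
    then have "x \<in> Units (scalars UNIV \<lparr>carrier := K\<rparr>)"
      using subfield_Units that by simp
    then obtain y where "y \<in> K" "x * y = 1" by (auto simp: Units_def)
    then show ?thesis using inverse_unique by metis
  qed (use that in simp)
qed

lemma iwasawa_valued_field:
  assumes "iwasawa_setting S" shows "p_valued_field (prm S) (val S) (fld S)"
proof -
  have "is_C_p (prm S) (val S)" and sf: "subfield (fld S) (scalars UNIV)"
    using assms by (auto simp: iwasawa_setting_def)
  then show ?thesis
    using subfield_scalars[OF sf] by unfold_locales (auto simp: is_C_p_def)
qed

lemma iwasawa_generator: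
  assumes S: "iwasawa_setting S"
  shows "chr S i (gen S i) \<in> fld S"
    and "val S (chr S i (gen S i) - 1) = val S (2 * of_nat (prm S))"
proof -
  interpret p_valued_field "prm S" "val S" "fld S" by (rule iwasawa_valued_field[OF S])
  have S': "group (grp S i)" "topspace (gtop S i) = carrier (grp S i)"
    "chr S i \<in> iso (grp S i) (scalars (one_units (prm S) (val S)))"
    "homeomorphic_map (gtop S i)
         (subtopology (padic_topology (prm S) (val S)) (one_units (prm S) (val S))) (chr S i)"
    "gen S i \<in> carrier (grp S i)"
    "gtop S i closure_of generate (grp S i) {gen S i} = carrier (grp S i)"
    "Metric_space.mcomplete (fld S) (padic_dist (prm S) (val S))"
    using S by (auto simp: iwasawa_setting_def)
  show "val S (chr S i (gen S i) - 1) = val S (2 * of_nat (prm S))"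
    by (rule v_topological_generator[OF S'(1-6)])
  have "chr S i (gen S i) \<in> one_units (prm S) (val S)"
    using S'(3,5) by (auto simp: iso_def hom_def)
  then obtain z where "z \<in> Q_p (prm S) (val S)" "chr S i (gen S i) = 1 + 2 * of_nat (prm S) * z"
    by (auto simp: one_units_def)
  moreover have "(2 :: 'a) \<in> fld S" using K_of_nat[of 2] by simp
  ultimately show "chr S i (gen S i) \<in> fld S"
    using Q_p_subset[OF S'(7)] by (metis K_add K_one K_mult K_of_nat subsetD)
qed

text \<open>The character is an injective homomorphism into a commutative group.\<close>

lemma iwasawa_comm_group:
  assumes S: "iwasawa_setting S" shows "comm_group (grp S i)"
proof -
  have G: "group (grp S i)" and f: "chr S i \<in> iso (grp S i) (scalars (one_units (prm S) (val S)))"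
    using S unfolding iwasawa_setting_def by blast+
  interpret group "grp S i" by (rule G)
  have inj: "inj_on (chr S i) (carrier (grp S i))"
    and mult: "\<And>x y. x \<in> carrier (grp S i) \<Longrightarrow> y \<in> carrier (grp S i)
      \<Longrightarrow> chr S i (x \<otimes>\<^bsub>grp S i\<^esub> y) = chr S i x * chr S i y"
    using f by (auto simp: iso_def hom_def bij_betw_def)
  show ?thesis
  proof (rule group_comm_groupI)
    fix x y assume "x \<in> carrier (grp S i)" "y \<in> carrier (grp S i)"
    then show "x \<otimes>\<^bsub>grp S i\<^esub> y = y \<otimes>\<^bsub>grp S i\<^esub> x"
      by (intro inj_onD[OF inj]) (simp_all add: mult mult.commute)
  qed
qed

lemma comm_group_Gam:
  assumes S: "iwasawa_setting S" shows "comm_group (Gam S)"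
proof -
  have comm: "comm_group (grp S i)" for i using iwasawa_comm_group[OF S] .
  then have G: "group (grp S i)" for i using comm_group.axioms(2) by blast
  interpret group "Gam S" unfolding Gam_def using G by simp
  show ?thesis
  proof (rule group_comm_groupI)
    fix x y assume "x \<in> carrier (Gam S)" "y \<in> carrier (Gam S)"
    then show "x \<otimes>\<^bsub>Gam S\<^esub> y = y \<otimes>\<^bsub>Gam S\<^esub> x"
      using comm_groupE(4)[OF comm] by (auto simp: Gam_def PiE_iff)
  qed
qed


section \<open>Tensor products\<close>

lemma tensor_relators_cases [consumes 1, case_names left right smult]:
  assumes "h \<in> tensor_relators R M N"
    and "\<And>x x' y. x \<in> carrier M \<Longrightarrow> x' \<in> carrier M \<Longrightarrow> y \<in> carrier N \<Longrightarrow>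
        h = frag_of (x \<oplus>\<^bsub>M\<^esub> x', y) - frag_of (x, y) - frag_of (x', y) \<Longrightarrow> thesis"
    and "\<And>x y y'. x \<in> carrier M \<Longrightarrow> y \<in> carrier N \<Longrightarrow> y' \<in> carrier N \<Longrightarrow>
        h = frag_of (x, y \<oplus>\<^bsub>N\<^esub> y') - frag_of (x, y) - frag_of (x, y') \<Longrightarrow> thesis"
    and "\<And>r x y. r \<in> carrier R \<Longrightarrow> x \<in> carrier M \<Longrightarrow> y \<in> carrier N \<Longrightarrow>
        h = frag_of (r \<odot>\<^bsub>M\<^esub> x, y) - frag_of (x, r \<odot>\<^bsub>N\<^esub> y) \<Longrightarrow> thesis"
  shows thesis
proof -
  from assms(1)[unfolded tensor_relators_def] show ?thesis
    by (elim UnE CollectE exE conjE) (rule assms(2-4); assumption)+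
qed
lemma tensor_relatorsI:
  shows "x \<in> carrier M \<Longrightarrow> x' \<in> carrier M \<Longrightarrow> y \<in> carrier N \<Longrightarrow>
      frag_of (x \<oplus>\<^bsub>M\<^esub> x', y) - frag_of (x, y) - frag_of (x', y) \<in> tensor_relators R M N"
    and "x \<in> carrier M \<Longrightarrow> y \<in> carrier N \<Longrightarrow> y' \<in> carrier N \<Longrightarrow>
      frag_of (x, y \<oplus>\<^bsub>N\<^esub> y') - frag_of (x, y) - frag_of (x, y') \<in> tensor_relators R M N"
    and "r \<in> carrier R \<Longrightarrow> x \<in> carrier M \<Longrightarrow> y \<in> carrier N \<Longrightarrow>
      frag_of (r \<odot>\<^bsub>M\<^esub> x, y) - frag_of (x, r \<odot>\<^bsub>N\<^esub> y) \<in> tensor_relators R M N"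
  unfolding tensor_relators_def by blast+

text \<open>Closedness under the operations places the relators in the free abelian group, so that
  they generate a subgroup of it.\<close>

locale tensor_factors =
  fixes R :: "('r, 'x) ring_scheme" and M :: "('r, 'a, 'y) module_scheme"
    and N :: "('r, 'b, 'z) module_scheme"
  assumes M_add: "\<And>x y. x \<in> carrier M \<Longrightarrow> y \<in> carrier M \<Longrightarrow> x \<oplus>\<^bsub>M\<^esub> y \<in> carrier M"
    and M_smult: "\<And>r x. r \<in> carrier R \<Longrightarrow> x \<in> carrier M \<Longrightarrow> r \<odot>\<^bsub>M\<^esub> x \<in> carrier M"
    and N_add: "\<And>x y. x \<in> carrier N \<Longrightarrow> y \<in> carrier N \<Longrightarrow> x \<oplus>\<^bsub>N\<^esub> y \<in> carrier N"
    and N_smult: "\<And>r x. r \<in> carrier R \<Longrightarrow> x \<in> carrier N \<Longrightarrow> r \<odot>\<^bsub>N\<^esub> x \<in> carrier N"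
begin

abbreviation "F \<equiv> free_Abelian_group (carrier M \<times> carrier N)"
abbreviation "null \<equiv> tensor_null R M N"
abbreviation "T \<equiv> tensor R M N"

definition cls :: "('a \<times> 'b \<Rightarrow>\<^sub>0 int) \<Rightarrow> ('a \<times> 'b \<Rightarrow>\<^sub>0 int) set" where
  "cls c = null #>\<^bsub>F\<^esub> c"

lemma F_diff: "a \<in> carrier F \<Longrightarrow> b \<in> carrier F \<Longrightarrow> a - b \<in> carrier F"
  using keys_diff[of a b] by auto

lemma relators_subset: "tensor_relators R M N \<subseteq> carrier F"
  unfolding tensor_relators_def
  by (auto simp del: carrier_free_Abelian_group_iff intro!: F_diff)
    (auto intro: M_add M_smult N_add N_smult)

lemma null_subgroup: "subgroup null F"
  unfolding tensor_null_def
  by (rule group.generate_is_subgroup[OF group_free_Abelian_group relators_subset])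

lemma null_carrier: "c \<in> null \<Longrightarrow> c \<in> carrier F"
  using null_subgroup subgroup.subset by blast

lemma null_0: "0 \<in> null"
  using subgroup.one_closed[OF null_subgroup] by simp

lemma null_add: "c \<in> null \<Longrightarrow> c' \<in> null \<Longrightarrow> c + c' \<in> null"
  using subgroup.m_closed[OF null_subgroup] by fastforce

lemma null_uminus: "c \<in> null \<Longrightarrow> - c \<in> null"
  using subgroup.m_inv_closed[OF null_subgroup, of c] null_carrier[of c] by simp

lemma null_relator: "c \<in> tensor_relators R M N \<Longrightarrow> c \<in> null"
  unfolding tensor_null_def by (rule generate.incl)

lemma null_normal: "null \<lhd> F"
  using null_subgroup abelian_free_Abelian_group comm_group.normal_iff_subgroup by blast

lemma cls_eq: "cls c = {n + c | n. n \<in> null}"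
  by (auto simp: cls_def r_coset_def)

lemma cls_eq_iff: "cls c = cls c' \<longleftrightarrow> c - c' \<in> null"
proof
  assume "cls c = cls c'"
  moreover have "c \<in> cls c" using null_0 by (force simp: cls_eq)
  ultimately have "c \<in> cls c'" by simp
  then obtain n where "n \<in> null" "c = n + c'" by (auto simp: cls_eq)
  then show "c - c' \<in> null" by simp
next
  assume d: "c - c' \<in> null"
  have sub: "cls a \<subseteq> cls b" if ab: "a - b \<in> null" for a b
  proof
    fix z assume "z \<in> cls a"
    then obtain n where "n \<in> null" "z = (n + (a - b)) + b" by (auto simp: cls_eq)
    then show "z \<in> cls b" using null_add[OF _ ab] unfolding cls_eq by blast
  qed
  show "cls c = cls c'"
    using sub[OF d] sub[of c' c] null_uminus[OF d] by simp
qed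

lemma cls_0: "cls 0 = null"
  by (auto simp: cls_eq)

lemma pure_tensor_eq: "pure_tensor R M N x y = cls (frag_of (x, y))"
  by (simp add: pure_tensor_def cls_def)

lemma carrier_T: "carrier T = cls ` carrier F"
  by (auto simp: tensor_def Let_def carrier_FactGroup cls_def)

lemma zero_T: "\<zero>\<^bsub>T\<^esub> = cls 0"
  by (simp add: tensor_def Let_def cls_0)

lemma add_T:
  assumes "c \<in> carrier F" "c' \<in> carrier F" shows "cls c \<oplus>\<^bsub>T\<^esub> cls c' = cls (c + c')"
  using normal.rcos_sum[OF null_normal assms] by (simp add: tensor_def Let_def cls_def)

lemma abelian_group_T: "abelian_group T"
proof -
  have "comm_group (F Mod null)"
    using comm_group.abelian_FactGroup[OF abelian_free_Abelian_group null_subgroup] .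
  then interpret Q: comm_group "F Mod null" .
  have eqs: "carrier T = carrier (F Mod null)" "\<zero>\<^bsub>T\<^esub> = \<one>\<^bsub>F Mod null\<^esub>" "(\<oplus>\<^bsub>T\<^esub>) = (\<otimes>\<^bsub>F Mod null\<^esub>)"
    by (simp_all add: tensor_def Let_def)
  show ?thesis
  proof (rule abelian_groupI)
    fix x assume "x \<in> carrier T"
    then show "\<exists>y\<in>carrier T. y \<oplus>\<^bsub>T\<^esub> x = \<zero>\<^bsub>T\<^esub>"
      unfolding eqs using Q.l_inv Q.inv_closed by (intro bexI[of _ "inv\<^bsub>F Mod null\<^esub> x"])
  qed (simp_all only: eqs Q.m_closed Q.m_ac Q.one_closed Q.l_one Q.r_one)
qed

sublocale T: abelian_group T by (rule abelian_group_T)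

abbreviation "pure \<equiv> pure_tensor R M N"

lemma pure_closed: "x \<in> carrier M \<Longrightarrow> y \<in> carrier N \<Longrightarrow> pure x y \<in> carrier T"
  by (auto simp: pure_tensor_eq carrier_T)

lemma pure_add_left:
  assumes "x \<in> carrier M" "x' \<in> carrier M" "y \<in> carrier N"
  shows "pure (x \<oplus>\<^bsub>M\<^esub> x') y = pure x y \<oplus>\<^bsub>T\<^esub> pure x' y"
proof -
  have "frag_of (x \<oplus>\<^bsub>M\<^esub> x', y) - frag_of (x, y) - frag_of (x', y) \<in> null"
    using assms by (intro null_relator tensor_relatorsI)
  then show ?thesis using assms by (simp add: pure_tensor_eq add_T cls_eq_iff diff_diff_eq)
qed

lemma pure_add_right:
  assumes "x \<in> carrier M" "y \<in> carrier N" "y' \<in> carrier N"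
  shows "pure x (y \<oplus>\<^bsub>N\<^esub> y') = pure x y \<oplus>\<^bsub>T\<^esub> pure x y'"
proof -
  have "frag_of (x, y \<oplus>\<^bsub>N\<^esub> y') - frag_of (x, y) - frag_of (x, y') \<in> null"
    using assms by (intro null_relator tensor_relatorsI)
  then show ?thesis using assms by (simp add: pure_tensor_eq add_T cls_eq_iff diff_diff_eq)
qed

lemma pure_smult:
  assumes "r \<in> carrier R" "x \<in> carrier M" "y \<in> carrier N"
  shows "pure (r \<odot>\<^bsub>M\<^esub> x) y = pure x (r \<odot>\<^bsub>N\<^esub> y)"
proof -
  have "frag_of (r \<odot>\<^bsub>M\<^esub> x, y) - frag_of (x, r \<odot>\<^bsub>N\<^esub> y) \<in> null"
    using assms by (intro null_relator tensor_relatorsI)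
  then show ?thesis by (simp add: pure_tensor_eq cls_eq_iff)
qed

lemma cls_diff:
  assumes "a \<in> carrier F" "b \<in> carrier F" shows "cls (a - b) = cls a \<ominus>\<^bsub>T\<^esub> cls b"
proof -
  have "cls (a - b) \<oplus>\<^bsub>T\<^esub> cls b = cls a"
    using add_T[OF F_diff[OF assms] assms(2)] by simp
  moreover have "cls (a - b) \<in> carrier T" "cls b \<in> carrier T"
    using assms F_diff by (auto simp: carrier_T simp del: carrier_free_Abelian_group_iff)
  ultimately show ?thesis
    by (metis T.add.inv_solve_right T.minus_eq T.a_closed)
qed

end

text \<open>If any two elements of \<open>N\<close> are multiples of a common one, then so are the right factors
  of two pure tensors, and the two tensors add up to a single pure one.\<close>

lemma (in tensor_factors) pure_exhaust:
  assumes M: "module R M" and N0: "\<zero>\<^bsub>N\<^esub> \<in> carrier N"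
    and cyc: "\<And>a b. a \<in> carrier N \<Longrightarrow> b \<in> carrier N \<Longrightarrow>
      \<exists>c\<in>carrier N. \<exists>r\<in>carrier R. \<exists>s\<in>carrier R. a = r \<odot>\<^bsub>N\<^esub> c \<and> b = s \<odot>\<^bsub>N\<^esub> c"
    and z: "z \<in> carrier T"
  shows "\<exists>x\<in>carrier M. \<exists>a\<in>carrier N. z = pure x a"
proof -
  interpret M: module R M by (rule M)
  have pure_zero: "pure \<zero>\<^bsub>M\<^esub> a = \<zero>\<^bsub>T\<^esub>" if "a \<in> carrier N" for a
    using pure_add_left[OF M.M.zero_closed M.M.zero_closed that] pure_closed[OF M.M.zero_closed that]
    by (metis M.M.l_zero M.M.zero_closed T.add.l_cancel_one')
  have pure_minus: "pure (x \<ominus>\<^bsub>M\<^esub> x') a = pure x a \<ominus>\<^bsub>T\<^esub> pure x' a"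
    if "x \<in> carrier M" "x' \<in> carrier M" "a \<in> carrier N" for x x' a
  proof -
    have "pure (x \<ominus>\<^bsub>M\<^esub> x') a \<oplus>\<^bsub>T\<^esub> pure x' a = pure x a"
      using pure_add_left[of "x \<ominus>\<^bsub>M\<^esub> x'" x' a] that
      by (simp add: M.M.minus_eq M.M.a_assoc M.M.l_neg)
    then show ?thesis
      using that by (metis M.M.minus_closed T.add.inv_solve_right T.minus_eq pure_closed)
  qed
  obtain c where c: "Poly_Mapping.keys c \<subseteq> carrier M \<times> carrier N" "z = cls c"
    using z by (auto simp: carrier_T)
  have "\<exists>x\<in>carrier M. \<exists>a\<in>carrier N. cls c = pure x a"
    using c(1)
  proof (induction c rule: free_Abelian_group_induct[consumes 1, case_names zero diff one])
    case zero
    show ?case using pure_zero[OF N0] N0 zero_T by force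
  next
    case (diff c c')
    then obtain x a x' a' where xa: "x \<in> carrier M" "a \<in> carrier N" "cls c = pure x a"
      "x' \<in> carrier M" "a' \<in> carrier N" "cls c' = pure x' a'" by blast
    obtain b r s where b: "b \<in> carrier N" "r \<in> carrier R" "s \<in> carrier R"
      "a = r \<odot>\<^bsub>N\<^esub> b" "a' = s \<odot>\<^bsub>N\<^esub> b" using cyc xa by blast
    have "cls (c - c') = cls c \<ominus>\<^bsub>T\<^esub> cls c'" using diff by (intro cls_diff) auto
    also have "\<dots> = pure (r \<odot>\<^bsub>M\<^esub> x) b \<ominus>\<^bsub>T\<^esub> pure (s \<odot>\<^bsub>M\<^esub> x') b"
      using xa b by (simp add: pure_smult)
    also have "\<dots> = pure (r \<odot>\<^bsub>M\<^esub> x \<ominus>\<^bsub>M\<^esub> s \<odot>\<^bsub>M\<^esub> x') b"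
      using xa b by (simp add: pure_minus)
    finally show ?case using xa b by blast
  next
    case (one xa)
    then show ?case by (auto simp: pure_tensor_eq)
  qed
  then show ?thesis using c(2) by simp
qed

definition linear_map ::
  "('r, 'x) ring_scheme \<Rightarrow> ('r, 'a, 'y) module_scheme \<Rightarrow> ('r, 'b, 'z) module_scheme \<Rightarrow> ('a \<Rightarrow> 'b) \<Rightarrow> bool"
where
  "linear_map R M N f \<longleftrightarrow> f \<in> carrier M \<rightarrow> carrier N \<and>
     (\<forall>x\<in>carrier M. \<forall>y\<in>carrier M. f (x \<oplus>\<^bsub>M\<^esub> y) = f x \<oplus>\<^bsub>N\<^esub> f y) \<and>
     (\<forall>r\<in>carrier R. \<forall>x\<in>carrier M. f (r \<odot>\<^bsub>M\<^esub> x) = r \<odot>\<^bsub>N\<^esub> f x)"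

lemma linear_mapD:
  assumes "linear_map R M N f"
  shows "x \<in> carrier M \<Longrightarrow> f x \<in> carrier N"
    "x \<in> carrier M \<Longrightarrow> y \<in> carrier M \<Longrightarrow> f (x \<oplus>\<^bsub>M\<^esub> y) = f x \<oplus>\<^bsub>N\<^esub> f y"
    "r \<in> carrier R \<Longrightarrow> x \<in> carrier M \<Longrightarrow> f (r \<odot>\<^bsub>M\<^esub> x) = r \<odot>\<^bsub>N\<^esub> f x"
  using assms by (auto simp: linear_map_def)

text \<open>Two linear maps carry relators to relators, which makes their tensor product well
  defined.\<close>

locale tensor_factors_map =
  S: tensor_factors R M' N' + T: tensor_factors R M N
  for R :: "('r, 'x) ring_scheme" and M' :: "('r, 'a1, 'y1) module_scheme"
    and N' :: "('r, 'b1, 'z1) module_scheme"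
    and M :: "('r, 'a, 'y) module_scheme" and N :: "('r, 'b, 'z) module_scheme" +
  fixes f g
  assumes f: "linear_map R M' M f" and g: "linear_map R N' N g"
begin

abbreviation "ext \<equiv> frag_extend (\<lambda>(x, y). frag_of (f x, g y))"

lemma ext_carrier:
  assumes "c \<in> carrier S.F" shows "ext c \<in> carrier T.F"
proof -
  have "Poly_Mapping.keys (case z of (x, y) \<Rightarrow> frag_of (f x, g y)) \<subseteq> carrier M \<times> carrier N"
    if "z \<in> Poly_Mapping.keys c" for z
  proof -
    obtain x y where z: "z = (x, y)" by (rule prod.exhaust)
    have "x \<in> carrier M'" "y \<in> carrier N'" using assms that z by auto
    then show ?thesis using linear_mapD(1)[OF f] linear_mapD(1)[OF g] by (simp add: z keys_frag_of)
  qed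
  then show ?thesis
    using keys_frag_extend[of "\<lambda>(x, y). frag_of (f x, g y)" c]
    unfolding carrier_free_Abelian_group_iff by (meson UN_least order_trans)
qed

lemma ext_null:
  assumes "c \<in> S.null" shows "ext c \<in> T.null"
proof -
  have rel: "ext h \<in> T.null" if "h \<in> tensor_relators R M' N'" for h
  proof -
    note D = linear_mapD[OF f] linear_mapD[OF g]
    from that show ?thesis
    proof (cases rule: tensor_relators_cases)
      case (left x x' y)
      then have "ext h = frag_of (f x \<oplus>\<^bsub>M\<^esub> f x', g y) - frag_of (f x, g y) - frag_of (f x', g y)"
        by (simp add: frag_extend_diff D)
      then show ?thesis
        by (simp only:) (intro T.null_relator tensor_relatorsI(1) left D)
    next
      case (right x y y')
      then have "ext h = frag_of (f x, g y \<oplus>\<^bsub>N\<^esub> g y') - frag_of (f x, g y) - frag_of (f x, g y')"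
        by (simp add: frag_extend_diff D)
      then show ?thesis
        by (simp only:) (intro T.null_relator tensor_relatorsI(2) right D)
    next
      case (smult r x y)
      then have "ext h = frag_of (r \<odot>\<^bsub>M\<^esub> f x, g y) - frag_of (f x, r \<odot>\<^bsub>N\<^esub> g y)"
        by (simp add: frag_extend_diff D)
      then show ?thesis
        by (simp only:) (intro T.null_relator tensor_relatorsI(3) smult D)
    qed
  qed
  show ?thesis
    using assms unfolding tensor_null_def[of R M' N']
  proof (induction rule: generate.induct)
    case one
    show ?case using T.null_0 by simp
  next
    case (incl h)
    then show ?case by (rule rel)
  next
    case (inv h)
    have "inv\<^bsub>S.F\<^esub> h = - h" using inv S.relators_subset by auto
    then show ?case using T.null_uminus[OF rel[OF inv]] by (simp add: frag_extend_minus)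
  next
    case (eng h1 h2)
    then show ?case using T.null_add by (simp add: frag_extend_add)
  qed
qed

lemma tensor_map_cls: "tensor_map R M N f g (S.cls c) = T.cls (ext c)"
proof -
  have "tensor_map R M N f g (S.cls c) = {n + ext (n' + c) | n n'. n \<in> T.null \<and> n' \<in> S.null}"
    by (auto simp: tensor_map_def set_mult_def S.cls_eq)
  also have "\<dots> = T.cls (ext c)"
  proof
    show "{n + ext (n' + c) | n n'. n \<in> T.null \<and> n' \<in> S.null} \<subseteq> T.cls (ext c)"
      using T.null_add[OF _ ext_null]
      by (auto simp: T.cls_eq frag_extend_add simp flip: add.assoc)
    show "T.cls (ext c) \<subseteq> {n + ext (n' + c) | n n'. n \<in> T.null \<and> n' \<in> S.null}"
      using S.null_0 by (auto simp: T.cls_eq) (metis add_0)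
  qed
  finally show ?thesis .
qed

lemma tensor_map_pure: "tensor_map R M N f g (S.pure x y) = T.pure (f x) (g y)"
  by (simp add: S.pure_tensor_eq T.pure_tensor_eq tensor_map_cls)

lemma tensor_map_closed: "z \<in> carrier S.T \<Longrightarrow> tensor_map R M N f g z \<in> carrier T.T"
  unfolding S.carrier_T T.carrier_T
  by (elim imageE) (simp only: tensor_map_cls, intro imageI ext_carrier)

lemma tensor_map_add:
  assumes "z \<in> carrier S.T" "z' \<in> carrier S.T"
  shows "tensor_map R M N f g (z \<oplus>\<^bsub>S.T\<^esub> z') = tensor_map R M N f g z \<oplus>\<^bsub>T.T\<^esub> tensor_map R M N f g z'"
proof -
  obtain c where "z = S.cls c" "c \<in> carrier S.F"
    using assms(1) unfolding S.carrier_T by (rule imageE)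
  moreover obtain c' where "z' = S.cls c'" "c' \<in> carrier S.F"
    using assms(2) unfolding S.carrier_T by (rule imageE)
  ultimately have c: "z = S.cls c" "z' = S.cls c'" "c \<in> carrier S.F" "c' \<in> carrier S.F"
    by blast+
  show ?thesis
    unfolding c(1,2) S.add_T[OF c(3,4)] tensor_map_cls T.add_T[OF ext_carrier[OF c(3)] ext_carrier[OF c(4)]]
    by (simp only: frag_extend_add)
qed

end

section \<open>Extension of scalars to the field\<close>

locale scalar_extension = p_valued_field p v K + M: module "scalars integers" M
  for p :: nat and v :: "'c::field_char_0 \<Rightarrow> ereal" and K :: "'c set"
    and M :: "('c, 'a, 'y) module_scheme"

context p_valued_field begin

text \<open>Of two elements, the one of smaller valuation divides the other.\<close>

lemma K_locally_cyclic:
  assumes "a \<in> K" "b \<in> K"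
  shows "\<exists>c\<in>{a, b}. \<exists>r\<in>integers. \<exists>s\<in>integers. a = r * c \<and> b = s * c"
proof -
  have *: "\<exists>r\<in>integers. y = r * x" if "x \<in> K" "y \<in> K" "v x \<le> v y" for x y
  proof (cases "x = 0")
    case True
    then show ?thesis using that integers_zero by (auto simp: v_infinity_iff)
  next
    case False
    then have "y / x \<in> integers" using that by (intro integersI K_divide v_divide_nonneg) auto
    then show ?thesis using False by (intro bexI[of _ "y / x"]) auto
  qed
  show ?thesis
  proof (cases "v a \<le> v b")
    case True
    then show ?thesis using *[OF assms] integers_one by force
  next
    case False
    then show ?thesis using *[OF assms(2,1)] integers_one by force
  qed
qed

text \<open>The additive subgroups of \<open>K\<close> that are stable under the ring of integers, such as the
  field itself and the lattices $p^{-n}\mathcal{O}$.\<close>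

definition fractional :: "'c set \<Rightarrow> bool" where
  "fractional A \<longleftrightarrow> A \<subseteq> K \<and> 0 \<in> A \<and> (\<forall>a\<in>A. \<forall>b\<in>A. a + b \<in> A) \<and> (\<forall>r\<in>integers. \<forall>a\<in>A. r * a \<in> A)"

lemma fractional_K: "fractional K"
  by (auto simp: fractional_def K_zero K_add K_mult integers_subset)

lemma fractional_lattice: "fractional {x \<in> K. - ereal (real n) \<le> v x}"
  unfolding fractional_def
proof (intro conjI ballI)
  fix a b assume "a \<in> {x \<in> K. - ereal (real n) \<le> v x}" "b \<in> {x \<in> K. - ereal (real n) \<le> v x}"
  then show "a + b \<in> {x \<in> K. - ereal (real n) \<le> v x}"
    using order_trans[OF _ v_ultra[of a b]] by (auto intro: K_add)
next
  fix r a assume "r \<in> integers" "a \<in> {x \<in> K. - ereal (real n) \<le> v x}"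
  then show "r * a \<in> {x \<in> K. - ereal (real n) \<le> v x}"
    using v_mult_ge_left[of r a] by (auto simp: integers_def mult.commute[of r] intro: K_mult order_trans)
qed (auto simp: K_zero)

end

context scalar_extension begin

abbreviation "TK \<equiv> tensor (scalars integers) M (scalars K)"
abbreviation pt where "pt \<equiv> pure_tensor (scalars integers) M (scalars K)"

lemma tensor_factors_fractional: "fractional A \<Longrightarrow> tensor_factors (scalars integers) M (scalars A)"
  by unfold_locales (auto simp: fractional_def)

lemma pure_exhaust_fractional:
  assumes A: "fractional A" and z: "z \<in> carrier (tensor (scalars integers) M (scalars A))"
  shows "\<exists>x\<in>carrier M. \<exists>a\<in>A. z = pure_tensor (scalars integers) M (scalars A) x a"
proof -
  have "\<exists>c\<in>A. \<exists>r\<in>integers. \<exists>s\<in>integers. a = r * c \<and> b = s * c" if "a \<in> A" "b \<in> A" for a b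
  proof -
    have "a \<in> K" "b \<in> K" using that A by (auto simp: fractional_def)
    then have "\<exists>c\<in>{a, b}. \<exists>r\<in>integers. \<exists>s\<in>integers. a = r * c \<and> b = s * c"
      by (rule K_locally_cyclic)
    then show ?thesis using that by blast
  qed
  moreover have "0 \<in> A" using A by (simp add: fractional_def)
  ultimately have "\<exists>x\<in>carrier M. \<exists>a\<in>carrier (scalars A). z = pure_tensor (scalars integers) M (scalars A) x a"
    by (intro tensor_factors.pure_exhaust[OF tensor_factors_fractional[OF A] M.module_axioms _ _ z])
      (simp_all only: scalars_simps)
  then show ?thesis by simp
qed

sublocale T: tensor_factors "scalars integers" M "scalars K"
  by (rule tensor_factors_fractional[OF fractional_K])

lemma pt_closed: "x \<in> carrier M \<Longrightarrow> a \<in> K \<Longrightarrow> pt x a \<in> carrier TK"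
  using T.pure_closed by simp

lemma pt_add: "x \<in> carrier M \<Longrightarrow> y \<in> carrier M \<Longrightarrow> a \<in> K \<Longrightarrow> pt (x \<oplus>\<^bsub>M\<^esub> y) a = pt x a \<oplus>\<^bsub>TK\<^esub> pt y a"
  using T.pure_add_left by simp

lemma pt_add_right: "x \<in> carrier M \<Longrightarrow> a \<in> K \<Longrightarrow> b \<in> K \<Longrightarrow> pt x (a + b) = pt x a \<oplus>\<^bsub>TK\<^esub> pt x b"
  using T.pure_add_right[of x a b] by simp

lemma pt_smult: "r \<in> integers \<Longrightarrow> x \<in> carrier M \<Longrightarrow> a \<in> K \<Longrightarrow> pt (r \<odot>\<^bsub>M\<^esub> x) a = pt x (r * a)"
  using T.pure_smult[of r x a] by simp

lemma pt_exhaust: "z \<in> carrier TK \<Longrightarrow> \<exists>x\<in>carrier M. \<exists>a\<in>K. z = pt x a"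
  by (rule pure_exhaust_fractional[OF fractional_K])

lemma smult_map:
  assumes "r \<in> K"
  shows "tensor_factors_map (scalars integers) M (scalars K) M (scalars K) id (\<lambda>y. r \<odot>\<^bsub>scalars K\<^esub> y)"
  by unfold_locales (use assms in \<open>auto simp: linear_map_def algebra_simps K_mult\<close>)

lemma TK_smult_eq: "r \<odot>\<^bsub>TK\<^esub> z = tensor_map (scalars integers) M (scalars K) id (\<lambda>y. r \<odot>\<^bsub>scalars K\<^esub> y) z"
  by (simp add: tensor_def Let_def)

lemma smult_pt: "r \<in> K \<Longrightarrow> r \<odot>\<^bsub>TK\<^esub> pt x a = pt x (r * a)"
  unfolding TK_smult_eq by (simp only: tensor_factors_map.tensor_map_pure[OF smult_map]) simp

lemma module_TK: "module (scalars K) TK"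
proof (rule moduleI)
  show "cring (scalars K)" by (rule cring_K)
  show "abelian_group TK" by (rule T.abelian_group_T)
next
  fix a z assume "a \<in> carrier (scalars K)" "z \<in> carrier TK"
  then show "a \<odot>\<^bsub>TK\<^esub> z \<in> carrier TK"
    unfolding TK_smult_eq by (intro tensor_factors_map.tensor_map_closed[OF smult_map]) auto
next
  fix a b z assume "a \<in> carrier (scalars K)" "b \<in> carrier (scalars K)" and z: "z \<in> carrier TK"
  moreover obtain x c where "x \<in> carrier M" "c \<in> K" "z = pt x c" using pt_exhaust[OF z] by blast
  ultimately show "(a \<oplus>\<^bsub>scalars K\<^esub> b) \<odot>\<^bsub>TK\<^esub> z = a \<odot>\<^bsub>TK\<^esub> z \<oplus>\<^bsub>TK\<^esub> b \<odot>\<^bsub>TK\<^esub> z"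
    "(a \<otimes>\<^bsub>scalars K\<^esub> b) \<odot>\<^bsub>TK\<^esub> z = a \<odot>\<^bsub>TK\<^esub> (b \<odot>\<^bsub>TK\<^esub> z)"
    by (simp_all add: smult_pt K_add K_mult pt_add_right distrib_right mult.assoc)
next
  fix a z z' assume "a \<in> carrier (scalars K)" "z \<in> carrier TK" "z' \<in> carrier TK"
  then show "a \<odot>\<^bsub>TK\<^esub> (z \<oplus>\<^bsub>TK\<^esub> z') = a \<odot>\<^bsub>TK\<^esub> z \<oplus>\<^bsub>TK\<^esub> a \<odot>\<^bsub>TK\<^esub> z'"
    unfolding TK_smult_eq by (intro tensor_factors_map.tensor_map_add[OF smult_map]) auto
next
  fix z assume "z \<in> carrier TK"
  then obtain x a where "x \<in> carrier M" "a \<in> K" "z = pt x a" using pt_exhaust by blast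
  then show "\<one>\<^bsub>scalars K\<^esub> \<odot>\<^bsub>TK\<^esub> z = z" by (simp add: smult_pt K_one)
qed

sublocale TK: module "scalars K" TK by (rule module_TK)

lemma pt_finsum:
  assumes "finite I" "\<And>i. i \<in> I \<Longrightarrow> x i \<in> carrier M" "a \<in> K"
  shows "pt (finsum M x I) a = (\<Oplus>\<^bsub>TK\<^esub>i\<in>I. pt (x i) a)"
  using assms
proof (induction I rule: finite_induct)
  case empty
  have "pt \<zero>\<^bsub>M\<^esub> a = pt (0 \<odot>\<^bsub>M\<^esub> \<zero>\<^bsub>M\<^esub>) a"
    using M.smult_r_null[of 0] integers_zero by simp
  also have "\<dots> = pt \<zero>\<^bsub>M\<^esub> (0 * (0 * a))"
    using empty by (subst pt_smult) (auto simp: integers_zero)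
  also have "\<dots> = 0 \<odot>\<^bsub>TK\<^esub> pt \<zero>\<^bsub>M\<^esub> (0 * a)"
    by (rule smult_pt[symmetric]) (rule K_zero)
  also have "\<dots> = \<zero>\<^bsub>TK\<^esub>"
    using TK.smult_l_null[of "pt \<zero>\<^bsub>M\<^esub> (0 * a)"] by (simp add: pt_closed K_zero)
  finally show ?case by simp
next
  case (insert i I)
  then have "finsum M x (insert i I) = x i \<oplus>\<^bsub>M\<^esub> finsum M x I"
    "(\<Oplus>\<^bsub>TK\<^esub>i\<in>insert i I. pt (x i) a) = pt (x i) a \<oplus>\<^bsub>TK\<^esub> (\<Oplus>\<^bsub>TK\<^esub>i\<in>I. pt (x i) a)"
    by (auto intro!: M.finsum_insert T.T.finsum_insert simp: pt_closed)
  moreover have "finsum M x I \<in> carrier M" using insert by (intro M.finsum_closed) auto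
  ultimately show ?case using insert by (simp add: pt_add)
qed

lemma common_denominator:
  assumes "finite I" "\<And>i. i \<in> I \<Longrightarrow> z i \<in> carrier TK"
  shows "\<exists>a\<in>K. \<exists>x. \<forall>i\<in>I. x i \<in> carrier M \<and> z i = pt (x i) a"
  using assms
proof (induction I rule: finite_induct)
  case empty
  show ?case using K_one by blast
next
  case (insert i I)
  from insert have "\<exists>a\<in>K. \<exists>x. \<forall>j\<in>I. x j \<in> carrier M \<and> z j = pt (x j) a" by simp
  then obtain a x where ax: "a \<in> K" "\<forall>j\<in>I. x j \<in> carrier M \<and> z j = pt (x j) a" by blast
  obtain y b where yb: "y \<in> carrier M" "b \<in> K" "z i = pt y b"
    using pt_exhaust[OF insert.prems[of i]] by blast
  obtain c r s where c: "c \<in> K" "r \<in> integers" "s \<in> integers" "a = r * c" "b = s * c"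
    using K_locally_cyclic[OF ax(1) yb(2)] ax(1) yb(2) by blast
  let ?x = "\<lambda>j. if j = i then s \<odot>\<^bsub>M\<^esub> y else r \<odot>\<^bsub>M\<^esub> x j"
  have "?x j \<in> carrier M \<and> z j = pt (?x j) c" if "j \<in> insert i I" for j
    using that ax(2) yb c by (cases "j = i") (auto simp: pt_smult)
  then show ?case by (intro bexI[OF _ c(1)] exI[of _ ?x] ballI)
qed

lemma lattice_elem:
  assumes "z \<in> tensor_map (scalars integers) M (scalars K) id id `
       carrier (tensor (scalars integers) M (scalars {x \<in> K. - ereal (real n) \<le> v x}))"
  shows "\<exists>y\<in>carrier M. z = pt y (inverse (of_nat p ^ n))"
proof -
  let ?A = "{x \<in> K. - ereal (real n) \<le> v x}"
  interpret A: tensor_factors_map "scalars integers" M "scalars ?A" M "scalars K" id id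
    using tensor_factors_fractional[OF fractional_lattice[of n]]
    by (auto intro!: tensor_factors_map.intro T.tensor_factors_axioms tensor_factors_map_axioms.intro
        simp: linear_map_def)
  obtain z' where z': "z' \<in> carrier (tensor (scalars integers) M (scalars ?A))"
    "z = tensor_map (scalars integers) M (scalars K) id id z'"
    using assms by (rule imageE)
  obtain x a where xa: "x \<in> carrier M" "a \<in> ?A" "z' = A.S.pure x a"
    using pure_exhaust_fractional[OF fractional_lattice z'(1)] by blast
  have z: "z = pt x a" unfolding z'(2) xa(3) A.tensor_map_pure by simp
  have "0 \<le> v (a * of_nat p ^ n)"
    using xa(2) unfolding v_mult v_p_power by (cases "v a") auto
  then have int: "a * of_nat p ^ n \<in> integers"
    using xa(2) by (auto intro!: integersI K_mult K_power K_of_nat)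
  have "pt ((a * of_nat p ^ n) \<odot>\<^bsub>M\<^esub> x) (inverse (of_nat p ^ n))
      = pt x (a * of_nat p ^ n * inverse (of_nat p ^ n))"
    by (rule pt_smult[OF int xa(1)]) (intro K_inverse K_power K_of_nat)
  also have "a * of_nat p ^ n * inverse (of_nat p ^ n) = a"
    using p_nonzero by simp
  finally have "z = pt ((a * of_nat p ^ n) \<odot>\<^bsub>M\<^esub> x) (inverse (of_nat p ^ n))"
    unfolding z ..
  moreover have "(a * of_nat p ^ n) \<odot>\<^bsub>M\<^esub> x \<in> carrier M"
    using int xa by (intro M.smult_closed) simp_all
  ultimately show ?thesis by (rule bexI)
qed

end

locale scalar_extension_map =
  A: scalar_extension p v K M + B: scalar_extension p v K N
  for p :: nat and v :: "'c::field_char_0 \<Rightarrow> ereal" and K :: "'c set"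
    and M :: "('c, 'a, 'y) module_scheme" and N :: "('c, 'b, 'z) module_scheme" +
  fixes f
  assumes f: "linear_map (scalars A.integers) M N f"
begin

sublocale tensor_factors_map "scalars A.integers" M "scalars K" N "scalars K" f id
  by unfold_locales (use f in \<open>auto simp: linear_map_def\<close>)

abbreviation map_K where "map_K \<equiv> tensor_map (scalars A.integers) N (scalars K) f id"

lemma map_K_pt: "map_K (A.pt x a) = B.pt (f x) a"
  using tensor_map_pure by simp

lemma map_K_smult:
  assumes "r \<in> K" "z \<in> carrier A.TK" shows "map_K (r \<odot>\<^bsub>A.TK\<^esub> z) = r \<odot>\<^bsub>B.TK\<^esub> map_K z"
proof -
  obtain x a where "z = A.pt x a" using A.pt_exhaust[OF assms(2)] by blast
  then show ?thesis using assms by (simp add: A.smult_pt B.smult_pt map_K_pt)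
qed

end


section \<open>Group algebras\<close>

text \<open>A finitely supported function is determined by the integrals of test functions against
  it. Convolution turns into an iterated integral of \<open>\<psi> (y z)\<close>, so that the ring axioms
  of the group algebra reduce to the group axioms inside the argument of \<open>\<psi>\<close>.\<close>

definition integrate :: "('g \<Rightarrow> 'c::field) \<Rightarrow> ('g \<Rightarrow> 'c) \<Rightarrow> 'c" where
  "integrate f \<psi> = (\<Sum>x | f x \<noteq> 0. f x * \<psi> x)"

lemma integrate_superset:
  assumes "finite S" "{x. f x \<noteq> 0} \<subseteq> S" shows "integrate f \<psi> = (\<Sum>x\<in>S. f x * \<psi> x)"
  unfolding integrate_def by (rule sum.mono_neutral_left) (use assms in auto)

lemma integrate_indicator:
  assumes "finite {x. f x \<noteq> 0}" shows "integrate f (\<lambda>x. if x = y then 1 else 0) = f y"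
proof -
  have "integrate f (\<lambda>x. if x = y then 1 else 0) = (\<Sum>x | f x \<noteq> 0. if x = y then f x else 0)"
    unfolding integrate_def by (rule sum.cong) auto
  then show ?thesis using assms by (simp add: sum.delta)
qed

lemma integrate_cong:
  "(\<And>x. f x \<noteq> 0 \<Longrightarrow> \<psi> x = \<psi>' x) \<Longrightarrow> integrate f \<psi> = integrate f \<psi>'"
  unfolding integrate_def by (rule sum.cong) auto

lemma integrate_determines:
  assumes "finite {x. f x \<noteq> 0}" "finite {x. g x \<noteq> 0}" "\<And>\<psi>. integrate f \<psi> = integrate g \<psi>"
  shows "f = g"
  using integrate_indicator[OF assms(1)] integrate_indicator[OF assms(2)] assms(3) by (metis ext)

lemma finite_support_add:
  fixes f g :: "'g \<Rightarrow> 'c::field"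
  assumes "finite {x. f x \<noteq> 0}" "finite {x. g x \<noteq> 0}" shows "finite {x. f x + g x \<noteq> 0}"
  by (rule finite_subset[OF _ finite_UnI[OF assms]]) auto

lemma finite_support_smult:
  fixes f :: "'g \<Rightarrow> 'c::field"
  assumes "finite {x. f x \<noteq> 0}" shows "finite {x. a * f x \<noteq> 0}"
  by (rule finite_subset[OF _ assms]) auto

lemma integrate_add:
  assumes "finite {x. f x \<noteq> 0}" "finite {x. g x \<noteq> 0}"
  shows "integrate (\<lambda>x. f x + g x) \<psi> = integrate f \<psi> + integrate g \<psi>"
proof -
  let ?S = "{x. f x \<noteq> 0} \<union> {x. g x \<noteq> 0}"
  have S: "finite ?S" using assms by simp
  have "integrate (\<lambda>x. f x + g x) \<psi> = (\<Sum>x\<in>?S. (f x + g x) * \<psi> x)"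
    by (rule integrate_superset[OF S]) auto
  also have "\<dots> = (\<Sum>x\<in>?S. f x * \<psi> x) + (\<Sum>x\<in>?S. g x * \<psi> x)"
    by (simp add: distrib_right sum.distrib)
  also have "\<dots> = integrate f \<psi> + integrate g \<psi>"
    using integrate_superset[OF S, of f] integrate_superset[OF S, of g] by simp
  finally show ?thesis .
qed

lemma integrate_smult: "integrate (\<lambda>x. a * f x) \<psi> = a * integrate f \<psi>"
proof (cases "a = 0")
  case False
  then show ?thesis by (simp add: integrate_def sum_distrib_left mult.assoc)
qed (simp add: integrate_def)

lemma integrate_swap:
  "integrate f (\<lambda>x. integrate g (\<lambda>y. \<phi> x y)) = integrate g (\<lambda>y. integrate f (\<lambda>x. \<phi> x y))"
  unfolding integrate_def sum_distrib_left
  by (subst sum.swap) (simp add: mult.left_commute)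

lemma integrate_delta: "integrate (\<lambda>x. if x = a then 1 else 0) \<psi> = \<psi> a"
  by (simp add: integrate_def)

text \<open>Transition maps between group algebras are push-forwards, and so is the product, along the
  multiplication of the group.\<close>

lemma integrate_pushforward:
  assumes fin: "finite {x. f x \<noteq> 0}"
    and g: "\<And>y. g y = integrate f (\<lambda>x. if h x = y then 1 else 0)"
  shows "finite {y. g y \<noteq> 0}" "integrate g \<psi> = integrate f (\<lambda>x. \<psi> (h x))"
proof -
  let ?S = "h ` {x. f x \<noteq> 0}"
  have zero: "g y = 0" if "y \<notin> ?S" for y
    unfolding g integrate_def by (rule sum.neutral) (use that in auto)
  then have sub: "{y. g y \<noteq> 0} \<subseteq> ?S" by blast
  then show "finite {y. g y \<noteq> 0}" using fin finite_surj by blast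
  have "integrate g \<psi> = (\<Sum>y\<in>?S. g y * \<psi> y)"
    by (rule integrate_superset) (use fin sub in auto)
  also have "\<dots> = (\<Sum>y\<in>?S. \<Sum>x | f x \<noteq> 0. if h x = y then f x * \<psi> y else 0)"
    unfolding g integrate_def sum_distrib_right by (intro sum.cong) auto
  also have "\<dots> = (\<Sum>x | f x \<noteq> 0. \<Sum>y\<in>?S. if h x = y then f x * \<psi> y else 0)"
    by (rule sum.swap)
  also have "\<dots> = integrate f (\<lambda>x. \<psi> (h x))"
    unfolding integrate_def using fin by (intro sum.cong) auto
  finally show "integrate g \<psi> = integrate f (\<lambda>x. \<psi> (h x))" .
qed

lemma integrate_group_algebra_map:
  assumes "finite {x. f x \<noteq> 0}"
  shows "finite {y. group_algebra_map h f y \<noteq> 0}"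
    "integrate (group_algebra_map h f) \<psi> = integrate f (\<lambda>x. \<psi> (h x))"
proof -
  have "group_algebra_map h f y = integrate f (\<lambda>x. if h x = y then 1 else 0)" for y
  proof -
    have "integrate f (\<lambda>x. if h x = y then 1 else 0) = (\<Sum>x\<in>{x \<in> {x. f x \<noteq> 0}. h x = y}. f x)"
      unfolding integrate_def using assms by (subst sum.inter_filter) (auto intro!: sum.cong)
    also have "{x \<in> {x. f x \<noteq> 0}. h x = y} = {x. f x \<noteq> 0 \<and> h x = y}" by auto
    finally show ?thesis by (simp add: group_algebra_map_def)
  qed
  from integrate_pushforward[OF assms this]
  show "finite {y. group_algebra_map h f y \<noteq> 0}"
    "integrate (group_algebra_map h f) \<psi> = integrate f (\<lambda>x. \<psi> (h x))" by blast+
qed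

lemma group_algebra_simps [simp]:
  "\<one>\<^bsub>group_algebra A G\<^esub> = (\<lambda>x. if x = \<one>\<^bsub>G\<^esub> then 1 else 0)"
  "\<zero>\<^bsub>group_algebra A G\<^esub> = (\<lambda>x. 0)"
  "f \<oplus>\<^bsub>group_algebra A G\<^esub> g = (\<lambda>x. f x + g x)"
  "a \<odot>\<^bsub>group_algebra A G\<^esub> f = (\<lambda>x. a * f x)"
  by (simp_all add: group_algebra_def)

lemma group_algebra_carrier:
  "f \<in> carrier (group_algebra A G) \<longleftrightarrow>
     (\<forall>x\<in>carrier G. f x \<in> A) \<and> (\<forall>x. x \<notin> carrier G \<longrightarrow> f x = 0) \<and> finite {x. f x \<noteq> 0}"
  by (simp add: group_algebra_def)

lemma group_algebra_finite: "f \<in> carrier (group_algebra A G) \<Longrightarrow> finite {x. f x \<noteq> 0}"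
  and group_algebra_support: "f \<in> carrier (group_algebra A G) \<Longrightarrow> f x \<noteq> 0 \<Longrightarrow> x \<in> carrier G"
  by (auto simp: group_algebra_carrier)

lemma group_algebra_mult:
  fixes f g :: "'g \<Rightarrow> 'c::field"
  assumes G: "group G" and f: "f \<in> carrier (group_algebra A G)" and g: "g \<in> carrier (group_algebra A G)"
  shows "(f \<otimes>\<^bsub>group_algebra A G\<^esub> g) x
    = integrate f (\<lambda>y. integrate g (\<lambda>z. if y \<otimes>\<^bsub>G\<^esub> z = x then 1 else 0))"
proof -
  interpret group G by (rule G)
  note supp = group_algebra_support[OF f] group_algebra_support[OF g]
  show ?thesis
  proof (cases "x \<in> carrier G")
    case True
    have "(f \<otimes>\<^bsub>group_algebra A G\<^esub> g) x = integrate f (\<lambda>y. g (inv\<^bsub>G\<^esub> y \<otimes>\<^bsub>G\<^esub> x))"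
      unfolding integrate_def group_algebra_def using True supp(1) by (auto intro!: sum.cong)
    also have "\<dots> = integrate f (\<lambda>y. integrate g (\<lambda>z. if y \<otimes>\<^bsub>G\<^esub> z = x then 1 else 0))"
    proof (rule integrate_cong)
      fix y assume "f y \<noteq> 0"
      then have y: "y \<in> carrier G" by (rule supp(1))
      have "g (inv\<^bsub>G\<^esub> y \<otimes>\<^bsub>G\<^esub> x) = integrate g (\<lambda>z. if z = inv\<^bsub>G\<^esub> y \<otimes>\<^bsub>G\<^esub> x then 1 else 0)"
        by (rule integrate_indicator[OF group_algebra_finite[OF g], symmetric])
      also have "\<dots> = integrate g (\<lambda>z. if y \<otimes>\<^bsub>G\<^esub> z = x then 1 else 0)"
      proof (rule integrate_cong)
        fix z assume "g z \<noteq> 0"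
        then have "z \<in> carrier G" by (rule supp(2))
        then have "(z = inv\<^bsub>G\<^esub> y \<otimes>\<^bsub>G\<^esub> x) = (y \<otimes>\<^bsub>G\<^esub> z = x)"
          using y True inv_solve_left[of z y x] by auto
        then show "(if z = inv\<^bsub>G\<^esub> y \<otimes>\<^bsub>G\<^esub> x then 1 else 0) = (if y \<otimes>\<^bsub>G\<^esub> z = x then 1 else (0::'c))"
          by simp
      qed
      finally show "g (inv\<^bsub>G\<^esub> y \<otimes>\<^bsub>G\<^esub> x) = integrate g (\<lambda>z. if y \<otimes>\<^bsub>G\<^esub> z = x then 1 else 0)" .
    qed
    finally show ?thesis .
  next
    case False
    have "integrate g (\<lambda>z. if y \<otimes>\<^bsub>G\<^esub> z = x then 1 else 0) = 0" if "f y \<noteq> 0" for y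
      unfolding integrate_def using supp(1)[OF that] supp(2) False by (intro sum.neutral) auto
    then have "integrate f (\<lambda>y. integrate g (\<lambda>z. if y \<otimes>\<^bsub>G\<^esub> z = x then 1 else 0)) = 0"
      unfolding integrate_def[of f] by (intro sum.neutral) auto
    then show ?thesis using False by (simp add: group_algebra_def)
  qed
qed

lemma integrate_group_algebra_mult:
  assumes G: "group G" and f: "f \<in> carrier (group_algebra A G)" and g: "g \<in> carrier (group_algebra A G)"
  shows "finite {x. (f \<otimes>\<^bsub>group_algebra A G\<^esub> g) x \<noteq> 0}"
    "integrate (f \<otimes>\<^bsub>group_algebra A G\<^esub> g) \<psi> = integrate f (\<lambda>y. integrate g (\<lambda>z. \<psi> (y \<otimes>\<^bsub>G\<^esub> z)))"
proof -
  let ?F = "\<lambda>(y, z). f y * g z" and ?m = "\<lambda>(y, z). y \<otimes>\<^bsub>G\<^esub> z"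
  have eq: "{yz. ?F yz \<noteq> 0} = {y. f y \<noteq> 0} \<times> {z. g z \<noteq> 0}" by auto
  then have fin: "finite {yz. ?F yz \<noteq> 0}"
    using group_algebra_finite[OF f] group_algebra_finite[OF g] by simp
  have int: "integrate ?F \<Psi> = integrate f (\<lambda>y. integrate g (\<lambda>z. \<Psi> (y, z)))" for \<Psi>
    unfolding integrate_def[of ?F] eq
    by (simp add: integrate_def sum.cartesian_product sum_distrib_left mult.assoc split_beta)
  have m: "(f \<otimes>\<^bsub>group_algebra A G\<^esub> g) x = integrate ?F (\<lambda>yz. if ?m yz = x then 1 else 0)" for x
    by (simp add: group_algebra_mult[OF assms] int)
  from integrate_pushforward[OF fin m]
  show "finite {x. (f \<otimes>\<^bsub>group_algebra A G\<^esub> g) x \<noteq> 0}"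
    "integrate (f \<otimes>\<^bsub>group_algebra A G\<^esub> g) \<psi> = integrate f (\<lambda>y. integrate g (\<lambda>z. \<psi> (y \<otimes>\<^bsub>G\<^esub> z)))"
    by (simp_all add: int)
qed

locale scalar_subring =
  fixes A :: "'c::field set"
  assumes A_one: "1 \<in> A" and A_add: "x \<in> A \<Longrightarrow> y \<in> A \<Longrightarrow> x + y \<in> A"
    and A_uminus: "x \<in> A \<Longrightarrow> - x \<in> A" and A_mult: "x \<in> A \<Longrightarrow> y \<in> A \<Longrightarrow> x * y \<in> A"
begin

lemma A_zero: "0 \<in> A" using A_add[OF A_one A_uminus[OF A_one]] by simp

lemma A_sum: "(\<And>i. i \<in> I \<Longrightarrow> h i \<in> A) \<Longrightarrow> sum h I \<in> A"
  by (induction I rule: infinite_finite_induct) (auto intro: A_zero A_add)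

lemma cring_A: "cring (scalars A)"
  by (rule cring_scalars) (auto intro: A_one A_add A_uminus A_mult)

lemma A_value: "f \<in> carrier (group_algebra A G) \<Longrightarrow> f x \<in> A"
  by (cases "x \<in> carrier G") (auto simp: group_algebra_carrier A_zero)

lemma group_algebra_mult_closed:
  assumes G: "group G" and f: "f \<in> carrier (group_algebra A G)" and g: "g \<in> carrier (group_algebra A G)"
  shows "f \<otimes>\<^bsub>group_algebra A G\<^esub> g \<in> carrier (group_algebra A G)"
  unfolding group_algebra_carrier
proof (intro conjI ballI allI impI)
  fix x assume "x \<in> carrier G"
  then have "(f \<otimes>\<^bsub>group_algebra A G\<^esub> g) x
      = (\<Sum>y\<in>{y \<in> carrier G. f y \<noteq> 0}. f y * g (inv\<^bsub>G\<^esub> y \<otimes>\<^bsub>G\<^esub> x))"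
    by (simp add: group_algebra_def)
  then show "(f \<otimes>\<^bsub>group_algebra A G\<^esub> g) x \<in> A"
    using A_value[OF f] A_value[OF g] by (auto intro!: A_sum A_mult)
qed (use integrate_group_algebra_mult[OF assms] in \<open>auto simp: group_algebra_def\<close>)

lemma algebra_group_algebra:
  assumes "comm_group G" shows "algebra (scalars A) (group_algebra A G)"
proof -
  interpret G: comm_group G by (rule assms)
  let ?L = "group_algebra A G"
  note int = integrate_group_algebra_mult[OF G.is_group]
  note fin = group_algebra_finite and mc = group_algebra_mult_closed[OF G.is_group]
  have ext: "f = g" if "finite {x. f x \<noteq> 0}" "finite {x. g x \<noteq> 0}" "\<And>\<psi>. integrate f \<psi> = integrate g \<psi>"
    for f g :: "'a \<Rightarrow> 'c" using integrate_determines that by blast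
  have add_closed: "f \<oplus>\<^bsub>?L\<^esub> g \<in> carrier ?L" if "f \<in> carrier ?L" "g \<in> carrier ?L" for f g
    using that finite_support_add[of f g] by (auto simp: group_algebra_carrier intro: A_add)
  have smult_closed: "a \<odot>\<^bsub>?L\<^esub> f \<in> carrier ?L" if "a \<in> A" "f \<in> carrier ?L" for a f
    using that finite_support_smult[of f a] by (auto simp: group_algebra_carrier intro: A_mult)
  have one_closed: "\<one>\<^bsub>?L\<^esub> \<in> carrier ?L"
    by (auto simp: group_algebra_carrier A_one A_zero)
  have comm: "f \<otimes>\<^bsub>?L\<^esub> g = g \<otimes>\<^bsub>?L\<^esub> f" if f: "f \<in> carrier ?L" and g: "g \<in> carrier ?L" for f g
  proof (rule ext[OF int(1)[OF f g] int(1)[OF g f]])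
    fix \<psi>
    have "integrate (f \<otimes>\<^bsub>?L\<^esub> g) \<psi> = integrate g (\<lambda>z. integrate f (\<lambda>y. \<psi> (y \<otimes>\<^bsub>G\<^esub> z)))"
      unfolding int(2)[OF f g] by (rule integrate_swap)
    also have "\<dots> = integrate (g \<otimes>\<^bsub>?L\<^esub> f) \<psi>"
      unfolding int(2)[OF g f]
      by (intro integrate_cong arg_cong[where f = \<psi>] G.m_comm group_algebra_support[OF f] group_algebra_support[OF g])
    finally show "integrate (f \<otimes>\<^bsub>?L\<^esub> g) \<psi> = integrate (g \<otimes>\<^bsub>?L\<^esub> f) \<psi>" .
  qed
  have assoc: "(f \<otimes>\<^bsub>?L\<^esub> g) \<otimes>\<^bsub>?L\<^esub> h = f \<otimes>\<^bsub>?L\<^esub> (g \<otimes>\<^bsub>?L\<^esub> h)"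
    if f: "f \<in> carrier ?L" and g: "g \<in> carrier ?L" and h: "h \<in> carrier ?L" for f g h
  proof (rule ext[OF int(1)[OF mc[OF f g] h] int(1)[OF f mc[OF g h]]])
    fix \<psi>
    show "integrate ((f \<otimes>\<^bsub>?L\<^esub> g) \<otimes>\<^bsub>?L\<^esub> h) \<psi> = integrate (f \<otimes>\<^bsub>?L\<^esub> (g \<otimes>\<^bsub>?L\<^esub> h)) \<psi>"
      unfolding int(2)[OF mc[OF f g] h] int(2)[OF f g] int(2)[OF f mc[OF g h]] int(2)[OF g h]
      by (intro integrate_cong arg_cong[where f = \<psi>] G.m_assoc group_algebra_support[OF f]
          group_algebra_support[OF g] group_algebra_support[OF h])
  qed
  have one: "\<one>\<^bsub>?L\<^esub> \<otimes>\<^bsub>?L\<^esub> f = f" if f: "f \<in> carrier ?L" for f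
  proof (rule ext[OF int(1)[OF one_closed f] fin[OF f]])
    fix \<psi>
    show "integrate (\<one>\<^bsub>?L\<^esub> \<otimes>\<^bsub>?L\<^esub> f) \<psi> = integrate f \<psi>"
      unfolding int(2)[OF one_closed f] unfolding group_algebra_simps integrate_delta
      by (intro integrate_cong arg_cong[where f = \<psi>] G.l_one group_algebra_support[OF f])
  qed
  have distr: "(f \<oplus>\<^bsub>?L\<^esub> g) \<otimes>\<^bsub>?L\<^esub> h = f \<otimes>\<^bsub>?L\<^esub> h \<oplus>\<^bsub>?L\<^esub> g \<otimes>\<^bsub>?L\<^esub> h"
    if f: "f \<in> carrier ?L" and g: "g \<in> carrier ?L" and h: "h \<in> carrier ?L" for f g h
  proof (rule ext[OF int(1)[OF add_closed[OF f g] h] fin[OF add_closed[OF mc[OF f h] mc[OF g h]]]])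
    fix \<psi>
    show "integrate ((f \<oplus>\<^bsub>?L\<^esub> g) \<otimes>\<^bsub>?L\<^esub> h) \<psi> = integrate (f \<otimes>\<^bsub>?L\<^esub> h \<oplus>\<^bsub>?L\<^esub> g \<otimes>\<^bsub>?L\<^esub> h) \<psi>"
      unfolding int(2)[OF add_closed[OF f g] h]
      unfolding group_algebra_simps integrate_add[OF fin[OF f] fin[OF g]]
        integrate_add[OF fin[OF mc[OF f h]] fin[OF mc[OF g h]]] int(2)[OF f h] int(2)[OF g h] ..
  qed
  have smult_mult: "(a \<odot>\<^bsub>?L\<^esub> f) \<otimes>\<^bsub>?L\<^esub> g = a \<odot>\<^bsub>?L\<^esub> (f \<otimes>\<^bsub>?L\<^esub> g)"
    if a: "a \<in> A" and f: "f \<in> carrier ?L" and g: "g \<in> carrier ?L" for a f g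
  proof (rule ext[OF int(1)[OF smult_closed[OF a f] g] fin[OF smult_closed[OF a mc[OF f g]]]])
    fix \<psi>
    show "integrate ((a \<odot>\<^bsub>?L\<^esub> f) \<otimes>\<^bsub>?L\<^esub> g) \<psi> = integrate (a \<odot>\<^bsub>?L\<^esub> (f \<otimes>\<^bsub>?L\<^esub> g)) \<psi>"
      unfolding int(2)[OF smult_closed[OF a f] g]
      unfolding group_algebra_simps integrate_smult int(2)[OF f g] ..
  qed
  have ab: "abelian_group ?L"
  proof (rule abelian_groupI)
    fix f assume "f \<in> carrier ?L"
    then show "\<exists>g\<in>carrier ?L. g \<oplus>\<^bsub>?L\<^esub> f = \<zero>\<^bsub>?L\<^esub>"
      using smult_closed[OF A_uminus[OF A_one]] by (intro bexI[of _ "- 1 \<odot>\<^bsub>?L\<^esub> f"]) auto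
  qed (use add_closed in \<open>auto simp: group_algebra_carrier A_zero algebra_simps\<close>)
  have cr: "cring ?L"
  proof (rule cringI[OF ab])
    show "comm_monoid ?L"
      by (rule comm_monoidI) (auto intro: mc one_closed assoc comm one simp del: group_algebra_simps)
  qed (rule distr)
  show ?thesis
    by (rule algebraI[OF cring_A cr])
      (use smult_closed smult_mult in \<open>auto simp: algebra_simps\<close>)
qed

lemma group_algebra_map_closed:
  assumes h: "h \<in> carrier G \<rightarrow> carrier H" and f: "f \<in> carrier (group_algebra A G)"
  shows "group_algebra_map h f \<in> carrier (group_algebra A H)"
  unfolding group_algebra_carrier
proof (intro conjI ballI allI impI)
  show "finite {y. group_algebra_map h f y \<noteq> 0}"
    using integrate_group_algebra_map(1) group_algebra_finite[OF f] .
  show "group_algebra_map h f y \<in> A" for y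
    unfolding group_algebra_map_def by (rule A_sum) (rule A_value[OF f])
  fix y assume "y \<notin> carrier H"
  then have "{x. f x \<noteq> 0 \<and> h x = y} = {}" using h group_algebra_support[OF f] by auto
  then show "group_algebra_map h f y = 0" unfolding group_algebra_map_def by (simp only: sum.empty)
qed

lemma group_algebra_map_hom:
  assumes G: "group G" and H: "group H" and h: "h \<in> hom G H"
    and f: "f \<in> carrier (group_algebra A G)" and g: "g \<in> carrier (group_algebra A G)"
  shows "group_algebra_map h (f \<oplus>\<^bsub>group_algebra A G\<^esub> g)
      = group_algebra_map h f \<oplus>\<^bsub>group_algebra A H\<^esub> group_algebra_map h g"
    and "group_algebra_map h (f \<otimes>\<^bsub>group_algebra A G\<^esub> g)
      = group_algebra_map h f \<otimes>\<^bsub>group_algebra A H\<^esub> group_algebra_map h g"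
    and "group_algebra_map h (a \<odot>\<^bsub>group_algebra A G\<^esub> f) = a \<odot>\<^bsub>group_algebra A H\<^esub> group_algebra_map h f"
proof -
  have hc: "h \<in> carrier G \<rightarrow> carrier H" using h by (auto simp: hom_def)
  note fin = group_algebra_finite[OF f] group_algebra_finite[OF g]
  note mcl = group_algebra_map_closed[OF hc f] group_algebra_map_closed[OF hc g]
  note map = integrate_group_algebra_map
  show "group_algebra_map h (f \<oplus>\<^bsub>group_algebra A G\<^esub> g)
      = group_algebra_map h f \<oplus>\<^bsub>group_algebra A H\<^esub> group_algebra_map h g"
    unfolding group_algebra_simps
  proof (rule integrate_determines)
    fix \<psi>
    show "integrate (group_algebra_map h (\<lambda>x. f x + g x)) \<psi>
        = integrate (\<lambda>x. group_algebra_map h f x + group_algebra_map h g x) \<psi>"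
      by (simp only: map(2)[OF finite_support_add[OF fin]] integrate_add[OF fin]
          integrate_add[OF map(1)[OF fin(1)] map(1)[OF fin(2)]] map(2)[OF fin(1)] map(2)[OF fin(2)])
  qed (intro map(1) finite_support_add fin)+
  show "group_algebra_map h (a \<odot>\<^bsub>group_algebra A G\<^esub> f) = a \<odot>\<^bsub>group_algebra A H\<^esub> group_algebra_map h f"
    unfolding group_algebra_simps
  proof (rule integrate_determines)
    fix \<psi>
    show "integrate (group_algebra_map h (\<lambda>x. a * f x)) \<psi> = integrate (\<lambda>x. a * group_algebra_map h f x) \<psi>"
      by (simp only: map(2)[OF finite_support_smult[OF fin(1)]] integrate_smult map(2)[OF fin(1)])
  qed (intro map(1) finite_support_smult fin)+
  show "group_algebra_map h (f \<otimes>\<^bsub>group_algebra A G\<^esub> g)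
      = group_algebra_map h f \<otimes>\<^bsub>group_algebra A H\<^esub> group_algebra_map h g"
  proof (rule integrate_determines)
    fix \<psi>
    have "integrate (group_algebra_map h (f \<otimes>\<^bsub>group_algebra A G\<^esub> g)) \<psi>
        = integrate f (\<lambda>y. integrate g (\<lambda>z. \<psi> (h (y \<otimes>\<^bsub>G\<^esub> z))))"
      by (simp only: map(2)[OF integrate_group_algebra_mult(1)[OF G f g]] integrate_group_algebra_mult(2)[OF G f g])
    also have "\<dots> = integrate f (\<lambda>y. integrate g (\<lambda>z. \<psi> (h y \<otimes>\<^bsub>H\<^esub> h z)))"
      by (intro integrate_cong arg_cong[where f = \<psi>] hom_mult[OF h] group_algebra_support[OF f]
          group_algebra_support[OF g])
    also have "\<dots> = integrate (group_algebra_map h f \<otimes>\<^bsub>group_algebra A H\<^esub> group_algebra_map h g) \<psi>"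
      by (simp only: integrate_group_algebra_mult(2)[OF H mcl] map(2)[OF fin(1)] map(2)[OF fin(2)])
    finally show "integrate (group_algebra_map h (f \<otimes>\<^bsub>group_algebra A G\<^esub> g)) \<psi>
      = integrate (group_algebra_map h f \<otimes>\<^bsub>group_algebra A H\<^esub> group_algebra_map h g) \<psi>" .
  next
    show "finite {x. group_algebra_map h (f \<otimes>\<^bsub>group_algebra A G\<^esub> g) x \<noteq> 0}"
      by (rule map(1)[OF integrate_group_algebra_mult(1)[OF G f g]])
    show "finite {x. (group_algebra_map h f \<otimes>\<^bsub>group_algebra A H\<^esub> group_algebra_map h g) x \<noteq> 0}"
      by (rule integrate_group_algebra_mult(1)[OF H mcl])
  qed
qed

lemma group_algebra_map_delta:
  "group_algebra_map h (\<lambda>x. if x = a then 1 else 0) = (\<lambda>y. if y = h a then 1 else (0::'c))"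
proof (rule integrate_determines)
  have fin: "finite {x. (if x = a then 1 else 0) \<noteq> (0::'c)}" for a :: 'x by simp
  show "finite {y. group_algebra_map h (\<lambda>x. if x = a then 1 else 0) y \<noteq> (0::'c)}"
    by (rule integrate_group_algebra_map(1)[OF fin])
  show "finite {y. (if y = h a then 1 else 0) \<noteq> (0::'c)}" by simp
  show "integrate (group_algebra_map h (\<lambda>x. if x = a then 1 else 0)) \<psi>
      = integrate (\<lambda>y. if y = h a then 1 else (0::'c)) \<psi>" for \<psi>
    by (simp only: integrate_group_algebra_map(2)[OF fin] integrate_delta)
qed

end


section \<open>Completed group algebras\<close>

lemma (in group) coset_projection:
  assumes U: "U \<lhd> G" and V: "V \<lhd> G" and UV: "U \<subseteq> V"
  shows "g \<in> carrier G \<Longrightarrow> V <#> (U #> g) = V #> g"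
    and "(\<lambda>C. V <#> C) \<in> hom (G Mod U) (G Mod V)"
proof -
  have sub: "subgroup U G" "subgroup V G" using U V normal_imp_subgroup by blast+
  have VU: "V <#> U = V"
  proof
    show "V <#> U \<subseteq> V" using UV subgroup.m_closed[OF sub(2)] by (auto simp: set_mult_def)
    show "V \<subseteq> V <#> U"
    proof
      fix x assume x: "x \<in> V"
      then have "x = x \<otimes> \<one>" using subgroup.mem_carrier[OF sub(2)] by simp
      then show "x \<in> V <#> U"
        unfolding set_mult_def using x subgroup.one_closed[OF sub(1)] by blast
    qed
  qed
  show *: "V <#> (U #> g) = V #> g" if "g \<in> carrier G" for g
    using setmult_rcos_assoc[of V U g] subgroup.subset[OF sub(1)] subgroup.subset[OF sub(2)] that VU
    by simp
  show "(\<lambda>C. V <#> C) \<in> hom (G Mod U) (G Mod V)"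
  proof (rule homI)
    fix C assume "C \<in> carrier (G Mod U)"
    then obtain g where "g \<in> carrier G" "C = U #> g" by (auto simp: carrier_FactGroup)
    then show "V <#> C \<in> carrier (G Mod V)" using * by (auto simp: carrier_FactGroup)
  next
    fix C C' assume "C \<in> carrier (G Mod U)" "C' \<in> carrier (G Mod U)"
    then obtain g g' where g: "g \<in> carrier G" "C = U #> g" "g' \<in> carrier G" "C' = U #> g'"
      by (auto simp: carrier_FactGroup)
    then show "V <#> (C \<otimes>\<^bsub>G Mod U\<^esub> C') = (V <#> C) \<otimes>\<^bsub>G Mod V\<^esub> (V <#> C')"
      using * normal.rcos_sum[OF U] normal.rcos_sum[OF V] by simp
  qed
qed

context scalar_subring begin

lemma completed_group_algebra_carrier:
  "l \<in> carrier (completed_group_algebra A G T) \<longleftrightarrow>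
     l \<in> extensional (open_normal G T) \<and>
     (\<forall>U\<in>open_normal G T. l U \<in> carrier (group_algebra A (G Mod U))) \<and>
     (\<forall>U\<in>open_normal G T. \<forall>V\<in>open_normal G T. U \<subseteq> V \<longrightarrow>
          group_algebra_map (\<lambda>C. V <#>\<^bsub>G\<^esub> C) (l U) = l V)"
  by (auto simp: completed_group_algebra_def PiE_def)

lemma completed_group_algebra_ops:
  "l \<otimes>\<^bsub>completed_group_algebra A G T\<^esub> l' = (\<lambda>U\<in>open_normal G T. l U \<otimes>\<^bsub>group_algebra A (G Mod U)\<^esub> l' U)"
  "\<one>\<^bsub>completed_group_algebra A G T\<^esub> = (\<lambda>U\<in>open_normal G T. \<one>\<^bsub>group_algebra A (G Mod U)\<^esub>)"
  "\<zero>\<^bsub>completed_group_algebra A G T\<^esub> = (\<lambda>U\<in>open_normal G T. \<zero>\<^bsub>group_algebra A (G Mod U)\<^esub>)"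
  "l \<oplus>\<^bsub>completed_group_algebra A G T\<^esub> l' = (\<lambda>U\<in>open_normal G T. l U \<oplus>\<^bsub>group_algebra A (G Mod U)\<^esub> l' U)"
  "a \<odot>\<^bsub>completed_group_algebra A G T\<^esub> l = (\<lambda>U\<in>open_normal G T. a \<odot>\<^bsub>group_algebra A (G Mod U)\<^esub> l U)"
  by (simp_all add: completed_group_algebra_def)

lemma group_like_closed:
  assumes "comm_group G" "g \<in> carrier G"
  shows "group_like G T g \<in> carrier (completed_group_algebra A G T)"
proof -
  interpret G: comm_group G by (rule assms(1))
  show ?thesis
    unfolding completed_group_algebra_carrier
  proof (intro conjI ballI impI)
    fix U assume "U \<in> open_normal G T"
    then show "group_like G T g U \<in> carrier (group_algebra A (G Mod U))"
      using assms(2) by (auto simp: group_like_def group_algebra_carrier A_one A_zero carrier_FactGroup)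
  next
    fix U V assume UV: "U \<in> open_normal G T" "V \<in> open_normal G T" "U \<subseteq> V"
    then show "group_algebra_map (\<lambda>C. V <#>\<^bsub>G\<^esub> C) (group_like G T g U :: 'a set \<Rightarrow> 'c) = group_like G T g V"
      using G.coset_projection(1)[of U V, OF _ _ UV(3) assms(2)]
      by (simp add: group_like_def open_normal_def) (simp only: group_algebra_map_delta)
  qed (simp add: group_like_def)
qed

text \<open>All operations are componentwise; the transition maps respect them, so compatible
  families are closed under them.\<close>

lemma algebra_completed_group_algebra:
  assumes "comm_group G" shows "algebra (scalars A) (completed_group_algebra A G T)"
proof -
  interpret G: comm_group G by (rule assms)
  let ?N = "open_normal G T" and ?L = "completed_group_algebra A G T"
  let ?A = "\<lambda>U. group_algebra A (G Mod U)"
  note ops = completed_group_algebra_ops and carr = completed_group_algebra_carrier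
  have norm: "U \<lhd> G" if "U \<in> ?N" for U using that by (simp add: open_normal_def)
  have grp: "group (G Mod U)" if "U \<in> ?N" for U
    using normal.factorgroup_is_group[OF norm[OF that]] .
  have alg: "algebra (scalars A) (?A U)" if "U \<in> ?N" for U
    using algebra_group_algebra[OF G.abelian_FactGroup[OF normal_imp_subgroup[OF norm[OF that]]]] .
  have hom: "(\<lambda>C. V <#>\<^bsub>G\<^esub> C) \<in> hom (G Mod U) (G Mod V)" if "U \<in> ?N" "V \<in> ?N" "U \<subseteq> V" for U V
    using G.coset_projection(2)[OF norm[OF that(1)] norm[OF that(2)] that(3)] .
  have comp: "l U \<in> carrier (?A U)" if "l \<in> carrier ?L" "U \<in> ?N" for l U
    using that carr by blast
  have proj: "group_algebra_map (\<lambda>C. V <#>\<^bsub>G\<^esub> C) (l U) = l V"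
    if "l \<in> carrier ?L" "U \<in> ?N" "V \<in> ?N" "U \<subseteq> V" for l U V
    using that carr by blast
  have ext: "l = l'" if "l \<in> extensional ?N" "l' \<in> extensional ?N" "\<And>U. U \<in> ?N \<Longrightarrow> l U = l' U" for l l'
    using that by (rule extensionalityI)
  have ext_carr: "l \<in> extensional ?N" if "l \<in> carrier ?L" for l
    using that carr by blast
  have add_closed: "l \<oplus>\<^bsub>?L\<^esub> l' \<in> carrier ?L" if l: "l \<in> carrier ?L" "l' \<in> carrier ?L" for l l'
    unfolding carr ops
  proof (intro conjI ballI impI)
    fix U assume U: "U \<in> ?N"
    interpret algebra "scalars A" "?A U" by (rule alg[OF U])
    show "(\<lambda>U\<in>?N. l U \<oplus>\<^bsub>?A U\<^esub> l' U) U \<in> carrier (?A U)"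
      using M.a_closed[OF comp[OF l(1) U] comp[OF l(2) U]] U by simp
  next
    fix U V assume UV: "U \<in> ?N" "V \<in> ?N" "U \<subseteq> V"
    show "group_algebra_map (\<lambda>C. V <#>\<^bsub>G\<^esub> C) ((\<lambda>U\<in>?N. l U \<oplus>\<^bsub>?A U\<^esub> l' U) U)
        = (\<lambda>U\<in>?N. l U \<oplus>\<^bsub>?A U\<^esub> l' U) V"
      using group_algebra_map_hom(1)[OF grp[OF UV(1)] grp[OF UV(2)] hom[OF UV] comp[OF l(1) UV(1)] comp[OF l(2) UV(1)]]
        UV proj[OF l(1) UV] proj[OF l(2) UV] by (simp del: group_algebra_simps)
  qed simp
  have mult_closed: "l \<otimes>\<^bsub>?L\<^esub> l' \<in> carrier ?L" if l: "l \<in> carrier ?L" "l' \<in> carrier ?L" for l l'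
    unfolding carr ops
  proof (intro conjI ballI impI)
    fix U assume U: "U \<in> ?N"
    show "(\<lambda>U\<in>?N. l U \<otimes>\<^bsub>?A U\<^esub> l' U) U \<in> carrier (?A U)"
      using group_algebra_mult_closed[OF grp[OF U] comp[OF l(1) U] comp[OF l(2) U]] U by simp
  next
    fix U V assume UV: "U \<in> ?N" "V \<in> ?N" "U \<subseteq> V"
    show "group_algebra_map (\<lambda>C. V <#>\<^bsub>G\<^esub> C) ((\<lambda>U\<in>?N. l U \<otimes>\<^bsub>?A U\<^esub> l' U) U)
        = (\<lambda>U\<in>?N. l U \<otimes>\<^bsub>?A U\<^esub> l' U) V"
      using group_algebra_map_hom(2)[OF grp[OF UV(1)] grp[OF UV(2)] hom[OF UV] comp[OF l(1) UV(1)] comp[OF l(2) UV(1)]]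
        UV proj[OF l(1) UV] proj[OF l(2) UV] by simp
  qed simp
  have smult_closed: "a \<odot>\<^bsub>?L\<^esub> l \<in> carrier ?L" if l: "l \<in> carrier ?L" and a: "a \<in> A" for a l
    unfolding carr ops
  proof (intro conjI ballI impI)
    fix U assume U: "U \<in> ?N"
    interpret algebra "scalars A" "?A U" by (rule alg[OF U])
    show "(\<lambda>U\<in>?N. a \<odot>\<^bsub>?A U\<^esub> l U) U \<in> carrier (?A U)"
      using smult_closed[OF _ comp[OF l U], of a] U a by (simp del: group_algebra_simps)
  next
    fix U V assume UV: "U \<in> ?N" "V \<in> ?N" "U \<subseteq> V"
    show "group_algebra_map (\<lambda>C. V <#>\<^bsub>G\<^esub> C) ((\<lambda>U\<in>?N. a \<odot>\<^bsub>?A U\<^esub> l U) U)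
        = (\<lambda>U\<in>?N. a \<odot>\<^bsub>?A U\<^esub> l U) V"
      using group_algebra_map_hom(3)[OF grp[OF UV(1)] grp[OF UV(2)] hom[OF UV] comp[OF l UV(1)] comp[OF l UV(1)]]
        UV proj[OF l UV] by (simp del: group_algebra_simps)
  qed simp
  have one_closed: "\<one>\<^bsub>?L\<^esub> \<in> carrier ?L"
  proof -
    have "\<one>\<^bsub>?L\<^esub> = group_like G T \<one>\<^bsub>G\<^esub>"
    proof (rule ext)
      fix U assume U: "U \<in> ?N"
      then have "U #>\<^bsub>G\<^esub> \<one>\<^bsub>G\<^esub> = U"
        using G.coset_mult_one normal_imp_subgroup[OF norm] subgroup.subset by blast
      then show "\<one>\<^bsub>?L\<^esub> U = group_like G T \<one>\<^bsub>G\<^esub> U"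
        using U by (simp add: ops group_like_def one_FactGroup)
    qed (simp_all add: ops group_like_def)
    then show ?thesis using group_like_closed[OF assms] by simp
  qed
  have zero: "\<zero>\<^bsub>?L\<^esub> = 0 \<odot>\<^bsub>?L\<^esub> \<one>\<^bsub>?L\<^esub>" by (simp add: ops restrict_def fun_eq_iff)
  have zero_closed: "\<zero>\<^bsub>?L\<^esub> \<in> carrier ?L"
    unfolding zero by (rule smult_closed[OF one_closed A_zero])
  have ab: "abelian_group ?L"
  proof (rule abelian_groupI)
    fix l assume l: "l \<in> carrier ?L"
    have "(-1) \<odot>\<^bsub>?L\<^esub> l \<oplus>\<^bsub>?L\<^esub> l = \<zero>\<^bsub>?L\<^esub>" by (rule ext) (auto simp: ops)
    then show "\<exists>l'\<in>carrier ?L. l' \<oplus>\<^bsub>?L\<^esub> l = \<zero>\<^bsub>?L\<^esub>"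
      using smult_closed[OF l A_uminus[OF A_one]] by blast
    show "\<zero>\<^bsub>?L\<^esub> \<oplus>\<^bsub>?L\<^esub> l = l" by (rule ext) (use ext_carr[OF l] in \<open>auto simp: ops\<close>)
  next
    fix l l' l'' assume "l \<in> carrier ?L" "l' \<in> carrier ?L" "l'' \<in> carrier ?L"
    show "(l \<oplus>\<^bsub>?L\<^esub> l') \<oplus>\<^bsub>?L\<^esub> l'' = l \<oplus>\<^bsub>?L\<^esub> (l' \<oplus>\<^bsub>?L\<^esub> l'')"
      by (rule ext) (auto simp: ops algebra_simps)
  next
    fix l l' assume "l \<in> carrier ?L" "l' \<in> carrier ?L"
    show "l \<oplus>\<^bsub>?L\<^esub> l' = l' \<oplus>\<^bsub>?L\<^esub> l" by (rule ext) (auto simp: ops algebra_simps)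
  qed (intro add_closed zero_closed; assumption)+
  have cr: "cring ?L"
  proof (rule cringI[OF ab])
    show "comm_monoid ?L"
    proof (rule comm_monoidI)
      fix l l' l'' assume l: "l \<in> carrier ?L" "l' \<in> carrier ?L" "l'' \<in> carrier ?L"
      show "(l \<otimes>\<^bsub>?L\<^esub> l') \<otimes>\<^bsub>?L\<^esub> l'' = l \<otimes>\<^bsub>?L\<^esub> (l' \<otimes>\<^bsub>?L\<^esub> l'')"
      proof (rule ext)
        fix U assume U: "U \<in> ?N"
        interpret algebra "scalars A" "?A U" by (rule alg[OF U])
        show "((l \<otimes>\<^bsub>?L\<^esub> l') \<otimes>\<^bsub>?L\<^esub> l'') U = (l \<otimes>\<^bsub>?L\<^esub> (l' \<otimes>\<^bsub>?L\<^esub> l'')) U"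
          using U m_assoc comp[OF l(1) U] comp[OF l(2) U] comp[OF l(3) U] by (simp add: ops)
      qed (simp_all add: ops)
    next
      fix l assume l: "l \<in> carrier ?L"
      show "\<one>\<^bsub>?L\<^esub> \<otimes>\<^bsub>?L\<^esub> l = l"
      proof (rule ext)
        fix U assume U: "U \<in> ?N"
        interpret algebra "scalars A" "?A U" by (rule alg[OF U])
        show "(\<one>\<^bsub>?L\<^esub> \<otimes>\<^bsub>?L\<^esub> l) U = l U"
          using U l_one[OF comp[OF l U]] by (simp add: ops del: group_algebra_simps)
      qed (use ext_carr[OF l] in \<open>simp_all add: ops\<close>)
    next
      fix l l' assume l: "l \<in> carrier ?L" "l' \<in> carrier ?L"
      show "l \<otimes>\<^bsub>?L\<^esub> l' = l' \<otimes>\<^bsub>?L\<^esub> l"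
      proof (rule ext)
        fix U assume U: "U \<in> ?N"
        interpret algebra "scalars A" "?A U" by (rule alg[OF U])
        show "(l \<otimes>\<^bsub>?L\<^esub> l') U = (l' \<otimes>\<^bsub>?L\<^esub> l) U"
          using U m_comm comp[OF l(1) U] comp[OF l(2) U] by (simp add: ops)
      qed (simp_all add: ops)
    qed (intro mult_closed one_closed; assumption)+
  next
    fix l l' l'' assume l: "l \<in> carrier ?L" "l' \<in> carrier ?L" "l'' \<in> carrier ?L"
    show "(l \<oplus>\<^bsub>?L\<^esub> l') \<otimes>\<^bsub>?L\<^esub> l'' = l \<otimes>\<^bsub>?L\<^esub> l'' \<oplus>\<^bsub>?L\<^esub> l' \<otimes>\<^bsub>?L\<^esub> l''"
    proof (rule ext)
      fix U assume U: "U \<in> ?N"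
      interpret algebra "scalars A" "?A U" by (rule alg[OF U])
      show "((l \<oplus>\<^bsub>?L\<^esub> l') \<otimes>\<^bsub>?L\<^esub> l'') U = (l \<otimes>\<^bsub>?L\<^esub> l'' \<oplus>\<^bsub>?L\<^esub> l' \<otimes>\<^bsub>?L\<^esub> l'') U"
        using U l_distr comp[OF l(1) U] comp[OF l(2) U] comp[OF l(3) U]
        by (simp add: ops del: group_algebra_simps)
    qed (simp_all add: ops)
  qed
  show ?thesis
  proof (rule algebraI[OF cring_A cr])
    fix a l l' assume a: "a \<in> carrier (scalars A)" and l: "l \<in> carrier ?L" "l' \<in> carrier ?L"
    show "(a \<odot>\<^bsub>?L\<^esub> l) \<otimes>\<^bsub>?L\<^esub> l' = a \<odot>\<^bsub>?L\<^esub> (l \<otimes>\<^bsub>?L\<^esub> l')"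
    proof (rule ext)
      fix U assume U: "U \<in> ?N"
      interpret algebra "scalars A" "?A U" by (rule alg[OF U])
      show "((a \<odot>\<^bsub>?L\<^esub> l) \<otimes>\<^bsub>?L\<^esub> l') U = (a \<odot>\<^bsub>?L\<^esub> (l \<otimes>\<^bsub>?L\<^esub> l')) U"
        using U smult_assoc2[OF a comp[OF l(1) U] comp[OF l(2) U]]
        by (simp add: ops del: group_algebra_simps)
    qed (simp_all add: ops)
    show "a \<odot>\<^bsub>?L\<^esub> (l \<oplus>\<^bsub>?L\<^esub> l') = a \<odot>\<^bsub>?L\<^esub> l \<oplus>\<^bsub>?L\<^esub> a \<odot>\<^bsub>?L\<^esub> l'"
      by (rule ext) (auto simp: ops algebra_simps)
  next
    fix a b l assume "l \<in> carrier ?L"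
    then have "l \<in> extensional ?N" by (rule ext_carr)
    show "(a \<oplus>\<^bsub>scalars A\<^esub> b) \<odot>\<^bsub>?L\<^esub> l = a \<odot>\<^bsub>?L\<^esub> l \<oplus>\<^bsub>?L\<^esub> b \<odot>\<^bsub>?L\<^esub> l"
      "(a \<otimes>\<^bsub>scalars A\<^esub> b) \<odot>\<^bsub>?L\<^esub> l = a \<odot>\<^bsub>?L\<^esub> (b \<odot>\<^bsub>?L\<^esub> l)"
      by (rule ext; auto simp: ops algebra_simps)+
    show "\<one>\<^bsub>scalars A\<^esub> \<odot>\<^bsub>?L\<^esub> l = l"
      by (rule ext) (use \<open>l \<in> extensional ?N\<close> in \<open>auto simp: ops\<close>)
  qed (use smult_closed in auto)
qed

end

section \<open>Quotient algebras\<close>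

locale algebra_ideal = algebra R A + I: ideal I A
  for R :: "('r, 'x) ring_scheme" and A :: "('r, 'a, 'y) module_scheme" (structure) and I :: "'a set"
begin

abbreviation proj where "proj x \<equiv> I +> x"
abbreviation Q where "Q \<equiv> quot_algebra A I"

lemma ideal_smult: "r \<in> carrier R \<Longrightarrow> x \<in> I \<Longrightarrow> r \<odot> x \<in> I"
  using smult_assoc2[of r "\<one>" x] I.I_l_closed[of x "r \<odot> \<one>"] I.a_Hcarr[of x] by simp

lemma quot_carrier: "carrier Q = proj ` carrier A"
  by (auto simp: quot_algebra_def FactRing_def A_RCOSETS_def')

lemma quot_add: "x \<in> carrier A \<Longrightarrow> y \<in> carrier A \<Longrightarrow> proj x \<oplus>\<^bsub>Q\<^esub> proj y = proj (x \<oplus> y)"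
  by (simp add: quot_algebra_def FactRing_def I.a_rcos_sum)

lemma quot_zero: "\<zero>\<^bsub>Q\<^esub> = proj \<zero>"
  using I.a_rcos_const[OF I.zero_closed] by (simp add: quot_algebra_def FactRing_def)

lemma proj_eq_iff:
  assumes "x \<in> carrier A" "y \<in> carrier A" shows "proj x = proj y \<longleftrightarrow> x \<ominus> y \<in> I"
  using quotient_eq_iff_same_a_r_cos[OF I.is_ideal assms] by blast

lemma quot_smult:
  assumes r: "r \<in> carrier R" and x: "x \<in> carrier A" shows "r \<odot>\<^bsub>Q\<^esub> proj x = proj (r \<odot> x)"
proof -
  have *: "h \<oplus> r \<odot> (h' \<oplus> x) = (h \<oplus> r \<odot> h') \<oplus> r \<odot> x"
    if "h \<in> I" "h' \<in> I" for h h'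
    using I.a_Hcarr[OF that(1)] I.a_Hcarr[OF that(2)] r x by (simp add: smult_r_distr M.a_assoc)
  have "r \<odot>\<^bsub>Q\<^esub> proj x = {h \<oplus> r \<odot> (h' \<oplus> x) | h h'. h \<in> I \<and> h' \<in> I}"
    by (auto simp: quot_algebra_def set_add_def' a_r_coset_def')
  also have "\<dots> = {(h \<oplus> r \<odot> h') \<oplus> r \<odot> x | h h'. h \<in> I \<and> h' \<in> I}"
    by (rule Collect_cong) (metis *)
  also have "\<dots> = proj (r \<odot> x)"
  proof
    show "{(h \<oplus> r \<odot> h') \<oplus> r \<odot> x | h h'. h \<in> I \<and> h' \<in> I} \<subseteq> proj (r \<odot> x)"
      using I.a_closed ideal_smult[OF r] by (auto simp: a_r_coset_def')
    show "proj (r \<odot> x) \<subseteq> {(h \<oplus> r \<odot> h') \<oplus> r \<odot> x | h h'. h \<in> I \<and> h' \<in> I}"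
    proof
      fix z assume "z \<in> proj (r \<odot> x)"
      then obtain h where h: "h \<in> I" "z = h \<oplus> r \<odot> x" by (auto simp: a_r_coset_def')
      then have "z = (h \<oplus> r \<odot> \<zero>) \<oplus> r \<odot> x"
        using I.a_Hcarr r by simp
      then show "z \<in> {(h \<oplus> r \<odot> h') \<oplus> r \<odot> x | h h'. h \<in> I \<and> h' \<in> I}"
        using h I.zero_closed by blast
    qed
  qed
  finally show ?thesis .
qed

lemma module_quot: "module R Q"
proof (rule moduleI[OF R_cring])
  have pc: "proj x \<in> carrier Q" if "x \<in> carrier A" for x using that by (simp add: quot_carrier)
  have ex: "\<exists>x\<in>carrier A. X = proj x" if "X \<in> carrier Q" for X using that by (auto simp: quot_carrier)
  show "abelian_group Q"
  proof (rule abelian_groupI)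
    fix X assume "X \<in> carrier Q"
    then obtain x where x: "x \<in> carrier A" "X = proj x" using ex by blast
    then show "\<zero>\<^bsub>Q\<^esub> \<oplus>\<^bsub>Q\<^esub> X = X" by (simp add: quot_zero quot_add)
    show "\<exists>Y\<in>carrier Q. Y \<oplus>\<^bsub>Q\<^esub> X = \<zero>\<^bsub>Q\<^esub>"
      using x pc by (intro bexI[of _ "proj (\<ominus> x)"]) (auto simp: quot_zero quot_add M.l_neg)
  next
    fix X Y assume "X \<in> carrier Q" "Y \<in> carrier Q"
    then obtain x y where x: "x \<in> carrier A" "X = proj x" "y \<in> carrier A" "Y = proj y" using ex by blast
    then show "X \<oplus>\<^bsub>Q\<^esub> Y = Y \<oplus>\<^bsub>Q\<^esub> X" "X \<oplus>\<^bsub>Q\<^esub> Y \<in> carrier Q"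
      using pc by (simp_all add: quot_add M.a_comm)
  next
    fix X Y Z assume "X \<in> carrier Q" "Y \<in> carrier Q" "Z \<in> carrier Q"
    then obtain x y z where "x \<in> carrier A" "X = proj x" "y \<in> carrier A" "Y = proj y" "z \<in> carrier A" "Z = proj z"
      using ex by meson
    then show "(X \<oplus>\<^bsub>Q\<^esub> Y) \<oplus>\<^bsub>Q\<^esub> Z = X \<oplus>\<^bsub>Q\<^esub> (Y \<oplus>\<^bsub>Q\<^esub> Z)" by (simp add: quot_add M.a_assoc)
  qed (simp add: quot_zero pc)
  fix a X Y assume a: "a \<in> carrier R" and "X \<in> carrier Q" "Y \<in> carrier Q"
  then obtain x y where x: "x \<in> carrier A" "X = proj x" "y \<in> carrier A" "Y = proj y" using ex by meson
  show "a \<odot>\<^bsub>Q\<^esub> (X \<oplus>\<^bsub>Q\<^esub> Y) = a \<odot>\<^bsub>Q\<^esub> X \<oplus>\<^bsub>Q\<^esub> a \<odot>\<^bsub>Q\<^esub> Y"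
    using x a by (simp add: quot_add quot_smult smult_r_distr)
next
  fix a b X assume a: "a \<in> carrier R" "b \<in> carrier R" and "X \<in> carrier Q"
  then obtain x where x: "x \<in> carrier A" "X = proj x" by (auto simp: quot_carrier)
  show "(a \<oplus>\<^bsub>R\<^esub> b) \<odot>\<^bsub>Q\<^esub> X = a \<odot>\<^bsub>Q\<^esub> X \<oplus>\<^bsub>Q\<^esub> b \<odot>\<^bsub>Q\<^esub> X"
    "(a \<otimes>\<^bsub>R\<^esub> b) \<odot>\<^bsub>Q\<^esub> X = a \<odot>\<^bsub>Q\<^esub> (b \<odot>\<^bsub>Q\<^esub> X)"
    using x a by (simp_all add: quot_add quot_smult smult_l_distr smult_assoc1)
next
  fix a X assume a: "a \<in> carrier R" and "X \<in> carrier Q"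
  then obtain x where x: "x \<in> carrier A" "X = proj x" by (auto simp: quot_carrier)
  show "a \<odot>\<^bsub>Q\<^esub> X \<in> carrier Q"
    using x a by (auto simp: quot_smult quot_carrier)
next
  fix X assume "X \<in> carrier Q"
  then obtain x where x: "x \<in> carrier A" "X = proj x" by (auto simp: quot_carrier)
  show "\<one>\<^bsub>R\<^esub> \<odot>\<^bsub>Q\<^esub> X = X"
    using x by (simp add: quot_smult)
qed

lemma linear_proj: "linear_map R A Q proj"
  by (auto simp: linear_map_def quot_carrier quot_add quot_smult)

text \<open>For \<open>g = 1\<close> the map is the reduction to a smaller quotient. For other \<open>g\<close> it leads back
  from a smaller quotient to a larger one.\<close>

lemma quotient_multiplication:
  assumes J: "ideal J A" and g: "g \<in> carrier A" and IJ: "\<And>x. x \<in> I \<Longrightarrow> g \<otimes> x \<in> J"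
  shows "\<exists>\<phi>. linear_map R Q (quot_algebra A J) \<phi> \<and> (\<forall>x\<in>carrier A. \<phi> (proj x) = J +> (g \<otimes> x))"
proof -
  interpret J: algebra_ideal R A J
    using J algebra_axioms by (simp add: algebra_ideal_def)
  define \<phi> where "\<phi> X = J.proj (g \<otimes> (SOME x. x \<in> carrier A \<and> X = proj x))" for X
  have \<phi>: "\<phi> (proj x) = J.proj (g \<otimes> x)" if x: "x \<in> carrier A" for x
  proof -
    define y where "y = (SOME y. y \<in> carrier A \<and> proj x = proj y)"
    have y: "y \<in> carrier A" "proj x = proj y"
      using someI[of "\<lambda>y. y \<in> carrier A \<and> proj x = proj y" x] x unfolding y_def by auto
    then have "g \<otimes> (x \<ominus> y) \<in> J" using proj_eq_iff x IJ by blast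
    moreover have "g \<otimes> (x \<ominus> y) = g \<otimes> x \<ominus> g \<otimes> y"
      using x y g by (simp add: M.minus_eq r_distr r_minus)
    ultimately have "J.proj (g \<otimes> x) = J.proj (g \<otimes> y)" using J.proj_eq_iff x y g by simp
    then show ?thesis unfolding \<phi>_def y_def by simp
  qed
  moreover have "linear_map R Q (quot_algebra A J) \<phi>"
    unfolding linear_map_def
  proof (intro conjI ballI funcsetI)
    fix X assume "X \<in> carrier Q"
    then obtain x where x: "x \<in> carrier A" "X = proj x" by (auto simp: quot_carrier)
    then show "\<phi> X \<in> carrier J.Q" using g by (auto simp: \<phi> J.quot_carrier)
    fix r assume r: "r \<in> carrier R"
    have "g \<otimes> (r \<odot> x) = r \<odot> (g \<otimes> x)"
      using smult_assoc2[of r x g] r x g by (simp add: m_comm)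
    then show "\<phi> (r \<odot>\<^bsub>Q\<^esub> X) = r \<odot>\<^bsub>J.Q\<^esub> \<phi> X"
      using x g r by (simp add: \<phi> quot_smult J.quot_smult)
  next
    fix X Y assume "X \<in> carrier Q" "Y \<in> carrier Q"
    then obtain x y where x: "x \<in> carrier A" "X = proj x" "y \<in> carrier A" "Y = proj y" by (auto simp: quot_carrier)
    then show "\<phi> (X \<oplus>\<^bsub>Q\<^esub> Y) = \<phi> X \<oplus>\<^bsub>J.Q\<^esub> \<phi> Y"
      using g by (simp add: \<phi> quot_add J.quot_add r_distr)
  qed
  ultimately show ?thesis by blast
qed

lemma set_add_coset:
  assumes J: "ideal J A" and IJ: "I \<subseteq> J" and x: "x \<in> carrier A"
  shows "J <+>\<^bsub>A\<^esub> proj x = J +> x"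
proof -
  interpret J: ideal J A by (rule J)
  show ?thesis
  proof
    show "J <+>\<^bsub>A\<^esub> proj x \<subseteq> J +> x"
    proof
      fix z assume "z \<in> J <+>\<^bsub>A\<^esub> proj x"
      then obtain a b where ab: "a \<in> J" "b \<in> I" "z = a \<oplus> (b \<oplus> x)"
        by (auto simp: set_add_def' a_r_coset_def')
      then have "z = (a \<oplus> b) \<oplus> x" "a \<oplus> b \<in> J"
        using x J.a_Hcarr I.a_Hcarr IJ J.a_closed by (auto simp: M.a_assoc)
      then show "z \<in> J +> x" by (auto simp: a_r_coset_def')
    qed
    show "J +> x \<subseteq> J <+>\<^bsub>A\<^esub> proj x"
      using I.a_rcos_self[OF x] by (auto simp: set_add_def' a_r_coset_def'[of _ J])
  qed
qed

end


section \<open>Rings and modules\<close>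

lemma (in abelian_monoid) finsum_singleton_support:
  assumes "finite I" "i \<in> I" "x \<in> carrier G"
  shows "(\<Oplus>j\<in>I. if j = i then x else \<zero>) = x"
  using add.finprod_singleton[of i I "\<lambda>_. x"] assms by (simp add: eq_commute[of i])

lemma (in cring) finprod_finsum_distrib:
  assumes "finite I" "\<And>t. t \<in> I \<Longrightarrow> finite (J t)" "\<And>t j. t \<in> I \<Longrightarrow> j \<in> J t \<Longrightarrow> f t j \<in> carrier R"
  shows "(\<Otimes>t\<in>I. \<Oplus>j\<in>J t. f t j) = (\<Oplus>\<phi>\<in>Pi\<^sub>E I J. \<Otimes>t\<in>I. f t (\<phi> t))"
  using assms
proof (induction I rule: finite_induct)
  case empty
  show ?case by (simp add: PiE_empty_domain)
next
  case (insert t I)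
  have f: "f t j \<in> carrier R" if "j \<in> J t" for j using insert that by auto
  have fI: "f s (\<phi> s) \<in> carrier R" if "\<phi> \<in> Pi\<^sub>E I J" "s \<in> I" for \<phi> s
    using insert.prems(2)[of s "\<phi> s"] that by auto
  have finP: "finite (Pi\<^sub>E I J)" using insert by (auto intro: finite_PiE)
  have finJ: "finite (J t)" using insert by auto
  let ?P = "\<lambda>\<phi>. \<Otimes>s\<in>I. f s (\<phi> s)"
  have P: "?P \<phi> \<in> carrier R" if "\<phi> \<in> Pi\<^sub>E I J" for \<phi> using fI[OF that] by auto
  let ?upd = "\<lambda>j \<phi>. \<phi>(t := j)"
  have inj: "inj_on (?upd j) (Pi\<^sub>E I J)" for j
  proof (rule inj_onI)
    fix \<phi> \<phi>' assume "\<phi> \<in> Pi\<^sub>E I J" "\<phi>' \<in> Pi\<^sub>E I J" "\<phi>(t := j) = \<phi>'(t := j)"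
    then show "\<phi> = \<phi>'"
      using insert.hyps(2) by (metis PiE_arb fun_upd_triv fun_upd_upd)
  qed
  have upd: "(\<Otimes>s\<in>insert t I. f s ((\<phi>(t := j)) s)) = f t j \<otimes> ?P \<phi>"
    if "j \<in> J t" "\<phi> \<in> Pi\<^sub>E I J" for j \<phi>
  proof -
    have "(\<Otimes>s\<in>I. f s ((\<phi>(t := j)) s)) = ?P \<phi>"
      by (rule finprod_cong') (use insert.hyps(2) fI[OF that(2)] in auto)
    moreover have "(\<Otimes>s\<in>insert t I. f s ((\<phi>(t := j)) s)) = f t ((\<phi>(t := j)) t) \<otimes> (\<Otimes>s\<in>I. f s ((\<phi>(t := j)) s))"
      by (rule finprod_insert) (use insert.hyps fI[OF that(2)] f[OF that(1)] in auto)
    ultimately show ?thesis by simp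
  qed
  have part: "Pi\<^sub>E (insert t I) J = (\<Union>j\<in>J t. ?upd j ` Pi\<^sub>E I J)"
    by (auto simp: PiE_insert_eq)
  have disj: "?upd j ` Pi\<^sub>E I J \<inter> ?upd j' ` Pi\<^sub>E I J = {}" if "j \<noteq> j'" for j j'
    using that by (auto dest: fun_cong[of _ _ t])
  have "(\<Oplus>\<phi>\<in>Pi\<^sub>E (insert t I) J. \<Otimes>s\<in>insert t I. f s (\<phi> s))
      = (\<Oplus>j\<in>J t. \<Oplus>\<phi>\<in>?upd j ` Pi\<^sub>E I J. \<Otimes>s\<in>insert t I. f s (\<phi> s))"
    unfolding part
    by (rule add.finprod_UN_disjoint)
      (use finJ finP disj in \<open>auto simp: upd f P pairwise_def disjnt_def simp del: fun_upd_apply\<close>)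
  also have "\<dots> = (\<Oplus>j\<in>J t. \<Oplus>\<phi>\<in>Pi\<^sub>E I J. f t j \<otimes> ?P \<phi>)"
  proof (rule finsum_cong')
    fix j assume j: "j \<in> J t"
    have "(\<Oplus>\<phi>\<in>?upd j ` Pi\<^sub>E I J. \<Otimes>s\<in>insert t I. f s (\<phi> s))
        = (\<Oplus>\<phi>\<in>Pi\<^sub>E I J. \<Otimes>s\<in>insert t I. f s ((\<phi>(t := j)) s))"
      by (rule finsum_reindex) (use inj upd f P j in auto)
    also have "\<dots> = (\<Oplus>\<phi>\<in>Pi\<^sub>E I J. f t j \<otimes> ?P \<phi>)"
      by (rule finsum_cong') (use upd f P j in auto)
    finally show "(\<Oplus>\<phi>\<in>?upd j ` Pi\<^sub>E I J. \<Otimes>s\<in>insert t I. f s (\<phi> s))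
        = (\<Oplus>\<phi>\<in>Pi\<^sub>E I J. f t j \<otimes> ?P \<phi>)" .
  qed (use f P in \<open>auto intro!: finsum_closed\<close>)
  also have "\<dots> = (\<Oplus>j\<in>J t. f t j \<otimes> (\<Oplus>\<phi>\<in>Pi\<^sub>E I J. ?P \<phi>))"
    by (rule finsum_cong') (use finP f P in \<open>auto simp: finsum_rdistr Pi_def\<close>)
  also have "\<dots> = (\<Oplus>j\<in>J t. f t j) \<otimes> (\<Oplus>\<phi>\<in>Pi\<^sub>E I J. ?P \<phi>)"
    by (rule finsum_ldistr[symmetric]) (use finJ f P in \<open>auto intro!: finsum_closed\<close>)
  also have "\<dots> = (\<Oplus>j\<in>J t. f t j) \<otimes> (\<Otimes>s\<in>I. \<Oplus>j\<in>J s. f s j)"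
    using insert by simp
  also have "\<dots> = (\<Otimes>s\<in>insert t I. \<Oplus>j\<in>J s. f s j)"
    by (rule finprod_insert[symmetric]) (use insert f in \<open>auto intro!: finsum_closed\<close>)
  finally show ?case by simp
qed

text \<open>Used to test on generators that multiplication by \<open>g\<close> carries one ideal into another.\<close>

lemma (in cring) colon_ideal:
  assumes J: "ideal J R" and g: "g \<in> carrier R"
  shows "ideal {x \<in> carrier R. g \<otimes> x \<in> J} R"
proof -
  interpret J: ideal J R by (rule J)
  show ?thesis
  proof (rule idealI[OF ring_axioms])
    show "subgroup {x \<in> carrier R. g \<otimes> x \<in> J} (add_monoid R)"
    proof (rule add.subgroupI)
      show "{x \<in> carrier R. g \<otimes> x \<in> J} \<noteq> {}" using J.zero_closed g by (auto intro!: exI[of _ \<zero>])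
    next
      fix x assume x: "x \<in> {x \<in> carrier R. g \<otimes> x \<in> J}"
      then show "\<ominus> x \<in> {x \<in> carrier R. g \<otimes> x \<in> J}"
        using g by (simp add: r_minus J.a_inv_closed)
    next
      fix x y assume "x \<in> {x \<in> carrier R. g \<otimes> x \<in> J}" "y \<in> {x \<in> carrier R. g \<otimes> x \<in> J}"
      then show "x \<oplus> y \<in> {x \<in> carrier R. g \<otimes> x \<in> J}"
        using g by (simp add: r_distr J.a_closed)
    qed auto
  next
    fix a x assume a: "a \<in> {x \<in> carrier R. g \<otimes> x \<in> J}" and x: "x \<in> carrier R"
    then have "x \<otimes> (g \<otimes> a) \<in> J" "x \<otimes> (g \<otimes> a) = g \<otimes> (x \<otimes> a)"
      using J.I_l_closed[of "g \<otimes> a" x] g m_lcomm[of x g a] by simp_all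
    then show "x \<otimes> a \<in> {x \<in> carrier R. g \<otimes> x \<in> J}" "a \<otimes> x \<in> {x \<in> carrier R. g \<otimes> x \<in> J}"
      using a x by (simp_all add: m_comm)
  qed
qed

lemma (in cring) finprod_cong_mod_ideal:
  assumes J: "ideal J R" and fin: "finite I"
    and x: "\<And>t. t \<in> I \<Longrightarrow> x t \<in> carrier R" "\<And>t. t \<in> I \<Longrightarrow> y t \<in> carrier R"
    and xy: "\<And>t. t \<in> I \<Longrightarrow> x t \<ominus> y t \<in> J"
  shows "(\<Otimes>t\<in>I. x t) \<ominus> (\<Otimes>t\<in>I. y t) \<in> J"
  using fin x xy
proof (induction I rule: finite_induct)
  case empty
  then show ?case using additive_subgroup.zero_closed[OF ideal.axioms(1)[OF J]] by (simp add: minus_eq r_neg)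
next
  case (insert t I)
  interpret J: ideal J R by (rule J)
  let ?X = "\<Otimes>t\<in>I. x t" and ?Y = "\<Otimes>t\<in>I. y t"
  have c: "?X \<in> carrier R" "?Y \<in> carrier R" "x t \<in> carrier R" "y t \<in> carrier R"
    using insert by auto
  have "x t \<otimes> ?X \<ominus> y t \<otimes> ?Y = (x t \<ominus> y t) \<otimes> ?X \<oplus> y t \<otimes> (?X \<ominus> ?Y)"
    using c by algebra
  also have "\<dots> \<in> J"
    using insert c J.I_r_closed[of "x t \<ominus> y t" ?X] J.I_l_closed[of "?X \<ominus> ?Y" "y t"] by (intro J.a_closed) auto
  finally have "x t \<otimes> ?X \<ominus> y t \<otimes> ?Y \<in> J" .
  moreover have "(\<Otimes>s\<in>insert t I. x s) = x t \<otimes> ?X" "(\<Otimes>s\<in>insert t I. y s) = y t \<otimes> ?Y"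
    using insert by (auto intro!: finprod_insert)
  ultimately show ?case by simp
qed

lemma matrix_combination:
  fixes A :: "'c::field set" and M (structure) and a :: "'j \<Rightarrow> 'c"
  assumes M: "module (scalars A) M" and "finite I" "finite J"
    and x: "\<And>i. i \<in> I \<Longrightarrow> x i \<in> carrier M" and a: "\<And>j. j \<in> J \<Longrightarrow> a j \<in> A"
    and b: "\<And>i j. i \<in> I \<Longrightarrow> j \<in> J \<Longrightarrow> b j i \<in> A"
  shows "(\<Oplus>j\<in>J. a j \<odot> (\<Oplus>i\<in>I. b j i \<odot> x i))
    = (\<Oplus>i\<in>I. (\<Sum>j\<in>J. a j * b j i) \<odot> x i)"
  using assms(3) a b
proof (induction J rule: finite_induct)
  interpret module "scalars A" M by (rule M)
  have A: "0 \<in> A" "\<And>r s. r \<in> A \<Longrightarrow> s \<in> A \<Longrightarrow> r * s \<in> A" "\<And>r s. r \<in> A \<Longrightarrow> s \<in> A \<Longrightarrow> r + s \<in> A"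
    using R.zero_closed R.m_closed R.a_closed by auto
  {
    case empty
    have "(\<Oplus>i\<in>I. 0 \<odot> x i) = (\<Oplus>i\<in>I. \<zero>)"
      by (rule M.finsum_cong') (use smult_l_null x in auto)
    then show ?case by simp
  next
    case (insert j J)
    have sum_closed: "(\<And>j. j \<in> J' \<Longrightarrow> h j \<in> A) \<Longrightarrow> sum h J' \<in> A" for h :: "'j \<Rightarrow> 'c" and J'
      by (induction J' rule: infinite_finite_induct) (auto intro: A)
    have S: "(\<Sum>j\<in>J. a j * b j i) \<in> A" if "i \<in> I" for i
      by (rule sum_closed) (use insert that A in auto)
    have "(\<Oplus>j\<in>insert j J. a j \<odot> (\<Oplus>i\<in>I. b j i \<odot> x i))
        = a j \<odot> (\<Oplus>i\<in>I. b j i \<odot> x i) \<oplus> (\<Oplus>j\<in>J. a j \<odot> (\<Oplus>i\<in>I. b j i \<odot> x i))"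
      by (rule M.finsum_insert) (use insert x in \<open>auto intro!: smult_closed M.finsum_closed\<close>)
    also have "a j \<odot> (\<Oplus>i\<in>I. b j i \<odot> x i) = (\<Oplus>i\<in>I. a j \<odot> (b j i \<odot> x i))"
      by (rule finsum_smult_ldistr) (use insert x \<open>finite I\<close> in auto)
    also have "\<dots> = (\<Oplus>i\<in>I. (a j * b j i) \<odot> x i)"
      by (rule M.finsum_cong') (use insert x smult_assoc1 A in auto)
    also have "(\<Oplus>j\<in>J. a j \<odot> (\<Oplus>i\<in>I. b j i \<odot> x i)) = (\<Oplus>i\<in>I. (\<Sum>j\<in>J. a j * b j i) \<odot> x i)"
      using insert by simp
    also have "(\<Oplus>i\<in>I. (a j * b j i) \<odot> x i) \<oplus> \<dots>
        = (\<Oplus>i\<in>I. (a j * b j i) \<odot> x i \<oplus> (\<Sum>j\<in>J. a j * b j i) \<odot> x i)"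
      by (rule M.finsum_addf[symmetric]) (use insert x S A in \<open>auto intro!: smult_closed\<close>)
    also have "\<dots> = (\<Oplus>i\<in>I. (\<Sum>j\<in>insert j J. a j * b j i) \<odot> x i)"
    proof (rule M.finsum_cong')
      fix i assume i: "i \<in> I"
      show "(a j * b j i) \<odot> x i \<oplus> (\<Sum>j\<in>J. a j * b j i) \<odot> x i
          = (\<Sum>j\<in>insert j J. a j * b j i) \<odot> x i"
        using smult_l_distr[of "a j * b j i" "\<Sum>j\<in>J. a j * b j i" "x i"] insert S[OF i] x[OF i] i A by simp
    next
      show "(\<lambda>i. (\<Sum>j\<in>insert j J. a j * b j i) \<odot> x i) \<in> I \<rightarrow> carrier M"
        using insert S x A by (auto intro!: smult_closed)
    qed simp
    finally show ?case .
  }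
qed

section \<open>Evaluation of integral polynomials\<close>

context p_valued_field begin

text \<open>Lagrange interpolation of the constant 1, with denominators cleared.\<close>

lemma lagrange_one:
  assumes J: "finite J" "J \<noteq> {}" and inj: "inj_on y J" and y: "\<And>j. j \<in> J \<Longrightarrow> y j \<in> integers"
  shows "\<exists>\<beta> b. \<beta> \<in> integers \<and> \<beta> \<noteq> 0 \<and> (\<forall>j\<in>J. b j \<in> integers) \<and>
    (\<Sum>j\<in>J. Polynomial.smult (b j) (\<Prod>i\<in>J - {j}. [:- y i, 1:])) = [:\<beta>:]"
proof -
  define D where "D j = (\<Prod>i\<in>J - {j}. y j - y i)" for j
  define \<beta> where "\<beta> = (\<Prod>j\<in>J. D j)"
  define b where "b j = (\<Prod>k\<in>J - {j}. D k)" for j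
  have "y j - y i \<in> integers" if "i \<in> J" "j \<in> J" for i j
    using integers_add[OF y[OF that(2)] integers_uminus[OF y[OF that(1)]]] by simp
  then have D: "D j \<in> integers" if "j \<in> J" for j
    unfolding D_def using that by (intro integers_prod) auto
  have D0: "D j \<noteq> 0" if "j \<in> J" for j
    unfolding D_def using that inj J by (auto simp: inj_on_def)
  let ?f = "\<Sum>j\<in>J. Polynomial.smult (b j) (\<Prod>i\<in>J - {j}. [:- y i, 1:])"
  have "?f = [:\<beta>:]"
  proof (rule poly_eqI_degree[of "y ` J"])
    fix x assume "x \<in> y ` J"
    then obtain k where k: "k \<in> J" "x = y k" by blast
    have "poly ?f x = (\<Sum>j\<in>J. b j * (\<Prod>i\<in>J - {j}. y k - y i))"
      by (simp add: poly_sum poly_prod k)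
    also have "\<dots> = (\<Sum>j\<in>J. if j = k then b k * D k else 0)"
    proof (rule sum.cong[OF refl])
      fix j assume "j \<in> J"
      show "b j * (\<Prod>i\<in>J - {j}. y k - y i) = (if j = k then b k * D k else 0)"
        using k J by (auto simp: D_def intro!: prod_zero)
    qed
    also have "\<dots> = b k * D k" using k J by simp
    also have "\<dots> = \<beta>" unfolding b_def \<beta>_def using k J by (simp add: prod.remove mult.commute)
    finally show "poly ?f x = poly [:\<beta>:] x" by simp
  next
    have "Polynomial.degree (Polynomial.smult (b j) (\<Prod>i\<in>J - {j}. [:- y i, 1:])) \<le> card J - 1" if "j \<in> J" for j
    proof -
      have "Polynomial.degree (\<Prod>i\<in>J - {j}. [:- y i, 1:]) \<le> (\<Sum>i\<in>J - {j}. Polynomial.degree [:- y i, 1:])"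
        using degree_prod_sum_le[of "J - {j}" "\<lambda>i. [:- y i, 1:]"] J by (simp add: comp_def)
      also have "\<dots> = card J - 1" using that J by simp
      finally show ?thesis using degree_smult_le order_trans by blast
    qed
    then have "Polynomial.degree ?f \<le> card J - 1" using J by (intro degree_sum_le) auto
    moreover have "0 < card J" using J by (simp add: card_gt_0_iff)
    moreover have "card (y ` J) = card J" using inj by (rule card_image)
    ultimately show "Polynomial.degree ?f < card (y ` J)" "Polynomial.degree [:\<beta>:] < card (y ` J)" by auto
  qed
  moreover have "\<beta> \<noteq> 0" unfolding \<beta>_def using D0 J by simp
  moreover have "\<beta> \<in> integers" unfolding \<beta>_def by (rule integers_prod) (rule D)
  moreover have "\<forall>j\<in>J. b j \<in> integers" unfolding b_def by (auto intro!: integers_prod D)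
  ultimately show ?thesis by blast
qed

end

locale integral_algebra = p_valued_field p v K + L: algebra "scalars integers" L
  for p :: nat and v :: "'c::field_char_0 \<Rightarrow> ereal" and K :: "'c set"
    and L :: "('c, 'b, 'y) module_scheme" (structure)
begin

text \<open>Evaluation at an element of the algebra, by Horner's scheme. On integral polynomials it is
  a ring homomorphism, which transports polynomial identities over the field into the
  algebra.\<close>

definition ev :: "'b \<Rightarrow> 'c poly \<Rightarrow> 'b" where
  "ev Y f = fold_coeffs (\<lambda>a x. a \<odot> \<one> \<oplus> Y \<otimes> x) f \<zero>"

lemma smult_zero_left [simp]: "x \<in> carrier L \<Longrightarrow> 0 \<odot> x = \<zero>"
  using L.smult_l_null by simp

lemma smult_one_left [simp]: "x \<in> carrier L \<Longrightarrow> 1 \<odot> x = x"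
  using L.smult_one by simp

lemma sm_add: "a \<in> integers \<Longrightarrow> b \<in> integers \<Longrightarrow> x \<in> carrier L \<Longrightarrow> (a + b) \<odot> x = a \<odot> x \<oplus> b \<odot> x"
  using L.smult_l_distr[of a b x] by simp

lemma sm_mult: "a \<in> integers \<Longrightarrow> b \<in> integers \<Longrightarrow> x \<in> carrier L \<Longrightarrow> (a * b) \<odot> x = a \<odot> (b \<odot> x)"
  using L.smult_assoc1[of a b x] by simp

lemma sm_times: "a \<in> integers \<Longrightarrow> x \<in> carrier L \<Longrightarrow> y \<in> carrier L \<Longrightarrow> (a \<odot> x) \<otimes> y = a \<odot> (x \<otimes> y)"
  using L.smult_assoc2[of a x y] by simp

lemma sm_uminus: "a \<in> integers \<Longrightarrow> x \<in> carrier L \<Longrightarrow> (- a) \<odot> x = \<ominus> (a \<odot> x)"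
  using sm_add[of "- a" a x] integers_uminus[of a] by (intro L.minus_equality[symmetric]) auto

lemma sm_one_mult: "a \<in> integers \<Longrightarrow> x \<in> carrier L \<Longrightarrow> (a \<odot> \<one>) \<otimes> x = a \<odot> x"
  by (simp add: sm_times)

lemma ev_0 [simp]: "ev Y 0 = \<zero>"
  by (simp add: ev_def)

lemma ev_pCons:
  assumes "Y \<in> carrier L" shows "ev Y (pCons a f) = a \<odot> \<one> \<oplus> Y \<otimes> ev Y f"
proof (cases "a = 0 \<and> f = 0")
  case True
  then show ?thesis using assms by simp
next
  case False
  then have "fold_coeffs (\<lambda>a x. a \<odot> \<one> \<oplus> Y \<otimes> x) (pCons a f)
      = (\<lambda>x. a \<odot> \<one> \<oplus> Y \<otimes> x) \<circ> fold_coeffs (\<lambda>a x. a \<odot> \<one> \<oplus> Y \<otimes> x) f"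
    by (auto simp: fold_coeffs_pCons_coeff_not_0_eq fold_coeffs_pCons_not_0_0_eq)
  then show ?thesis by (simp add: ev_def)
qed

lemma ev_closed: "Y \<in> carrier L \<Longrightarrow> int_poly f \<Longrightarrow> ev Y f \<in> carrier L"
  by (induction f rule: pCons_induct) (auto simp: ev_pCons int_poly_pCons)

lemma ev_const: "Y \<in> carrier L \<Longrightarrow> a \<in> integers \<Longrightarrow> ev Y [:a:] = a \<odot> \<one>"
  by (simp add: ev_pCons)

lemma ev_linear:
  assumes "Y \<in> carrier L" "y \<in> integers" shows "ev Y [:- y, 1:] = Y \<ominus> y \<odot> \<one>"
  using assms by (simp add: ev_pCons sm_uminus integers_one integers_uminus L.M.minus_eq L.M.a_comm)

lemma ev_add:
  assumes Y: "Y \<in> carrier L" shows "int_poly f \<Longrightarrow> int_poly g \<Longrightarrow> ev Y (f + g) = ev Y f \<oplus> ev Y g"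
proof (induction f g rule: poly_induct2)
  case (pCons a f b g)
  then have c: "ev Y f \<in> carrier L" "ev Y g \<in> carrier L" "a \<odot> \<one> \<in> carrier L" "b \<odot> \<one> \<in> carrier L"
    using Y by (auto simp: int_poly_pCons ev_closed)
  have "ev Y (pCons a f + pCons b g) = (a \<odot> \<one> \<oplus> b \<odot> \<one>) \<oplus> Y \<otimes> (ev Y f \<oplus> ev Y g)"
    using pCons Y by (simp add: ev_pCons int_poly_pCons sm_add)
  also have "\<dots> = (a \<odot> \<one> \<oplus> Y \<otimes> ev Y f) \<oplus> (b \<odot> \<one> \<oplus> Y \<otimes> ev Y g)"
    using c Y by (simp add: L.r_distr L.M.a_ac)
  finally show ?case using Y by (simp add: ev_pCons)
qed simp

lemma ev_smult:
  assumes Y: "Y \<in> carrier L" and a: "a \<in> integers"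
  shows "int_poly f \<Longrightarrow> ev Y (Polynomial.smult a f) = a \<odot> ev Y f"
proof (induction f rule: pCons_induct)
  case 0
  then show ?case using L.smult_r_null a by simp
next
  case (pCons b f)
  then have c: "b \<in> integers" "ev Y f \<in> carrier L" using Y by (auto simp: int_poly_pCons ev_closed)
  have "a \<odot> (b \<odot> \<one> \<oplus> Y \<otimes> ev Y f) = a \<odot> (b \<odot> \<one>) \<oplus> a \<odot> (Y \<otimes> ev Y f)"
    using L.smult_r_distr[of a] a c Y by simp
  also have "a \<odot> (Y \<otimes> ev Y f) = Y \<otimes> (a \<odot> ev Y f)"
    using sm_times[of a "ev Y f" Y] a c Y by (simp add: L.m_comm)
  finally show ?case using pCons Y a c by (simp add: ev_pCons int_poly_pCons sm_mult)
qed

lemma ev_mult: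
  assumes Y: "Y \<in> carrier L"
  shows "int_poly f \<Longrightarrow> int_poly g \<Longrightarrow> ev Y (f * g) = ev Y f \<otimes> ev Y g"
proof (induction f rule: pCons_induct)
  case 0
  then show ?case using Y by (simp add: ev_closed)
next
  case (pCons a f)
  then have a: "a \<in> integers" and f: "int_poly f" and g: "int_poly g" by (auto simp: int_poly_pCons)
  have c: "ev Y f \<in> carrier L" "ev Y g \<in> carrier L" "a \<odot> \<one> \<in> carrier L"
    using Y f g a by (auto simp: ev_closed)
  have "pCons a f * g = Polynomial.smult a g + pCons 0 (f * g)" by simp
  then have "ev Y (pCons a f * g) = a \<odot> ev Y g \<oplus> Y \<otimes> (ev Y f \<otimes> ev Y g)"
    using Y a f g pCons.IH[OF f g] int_poly_mult[OF f g]
    by (simp add: ev_add ev_smult int_poly_smult int_poly_pCons integers_zero ev_pCons c)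
  also have "\<dots> = (a \<odot> \<one> \<oplus> Y \<otimes> ev Y f) \<otimes> ev Y g"
    using Y c a by (simp add: L.l_distr sm_one_mult L.m_assoc)
  finally show ?case using Y by (simp add: ev_pCons)
qed

lemma ev_prod:
  assumes Y: "Y \<in> carrier L" and "finite I" "\<And>i. i \<in> I \<Longrightarrow> int_poly (f i)"
  shows "ev Y (prod f I) = (\<Otimes>i\<in>I. ev Y (f i))"
  using assms(2,3)
proof (induction I rule: finite_induct)
  case empty
  show ?case unfolding prod.empty one_pCons using Y by (simp add: ev_const integers_one del: one_pCons)
next
  case (insert i I)
  then have "(\<Otimes>j\<in>insert i I. ev Y (f j)) = ev Y (f i) \<otimes> (\<Otimes>j\<in>I. ev Y (f j))"
    using Y by (intro L.finprod_insert) (auto simp: ev_closed)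
  then show ?case using insert Y by (simp add: ev_mult int_poly_prod)
qed

lemma ev_sum:
  assumes Y: "Y \<in> carrier L" and "finite I" "\<And>i. i \<in> I \<Longrightarrow> int_poly (f i)"
  shows "ev Y (sum f I) = (\<Oplus>i\<in>I. ev Y (f i))"
  using assms(2,3)
proof (induction I rule: finite_induct)
  case (insert i I)
  then have "(\<Oplus>j\<in>insert i I. ev Y (f j)) = ev Y (f i) \<oplus> (\<Oplus>j\<in>I. ev Y (f j))"
    using Y by (intro L.M.finsum_insert) (auto simp: ev_closed)
  then show ?case using insert Y by (simp add: ev_add int_poly_sum)
qed simp

lemma int_poly_linear: "a \<in> integers \<Longrightarrow> int_poly [:- a, 1:]"
  by (simp add: int_poly_pCons int_poly_0 integers_one integers_uminus)

text \<open>This makes the ideals of the tower decrease with the level.\<close>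

lemma power_minus_dvd:
  assumes Y: "Y \<in> carrier L" and y: "y \<in> integers"
  shows "\<exists>q\<in>carrier L. Y [^] n \<ominus> y ^ n \<odot> \<one> = (Y \<ominus> y \<odot> \<one>) \<otimes> q"
proof (induction n)
  case 0
  show ?case using Y y by (intro bexI[of _ \<zero>]) (auto simp: L.M.minus_eq L.M.r_neg)
next
  case (Suc n)
  then obtain q where q: "q \<in> carrier L" "Y [^] n \<ominus> y ^ n \<odot> \<one> = (Y \<ominus> y \<odot> \<one>) \<otimes> q" by blast
  let ?a = "y ^ n \<odot> \<one>" and ?b = "y \<odot> \<one>" and ?P = "Y [^] n"
  have ab: "?a \<in> carrier L" "?b \<in> carrier L" "?P \<in> carrier L" using Y y by (auto simp: integers_power)
  have prod: "y ^ Suc n \<odot> \<one> = ?b \<otimes> ?a"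
    using y by (simp add: sm_mult sm_one_mult integers_power)
  have "Y [^] Suc n \<ominus> y ^ Suc n \<odot> \<one> = ?P \<otimes> Y \<ominus> ?b \<otimes> ?a"
    unfolding prod using Y by simp
  also have "\<dots> = (Y \<ominus> ?b) \<otimes> ?P \<oplus> ?b \<otimes> (?P \<ominus> ?a)"
    using ab Y by algebra
  also have "\<dots> = (Y \<ominus> ?b) \<otimes> (?P \<oplus> ?b \<otimes> q)"
    unfolding q(2) using ab Y q(1) by algebra
  finally show ?case using ab q(1) by blast
qed

text \<open>Induction along Horner's scheme, each step of which replaces one \<open>Y\<close> by \<open>y\<close>.\<close>

lemma ev_cong_mod_ideal:
  assumes J: "ideal J L" and Y: "Y \<in> carrier L" and y: "y \<in> integers" "Y \<ominus> y \<odot> \<one> \<in> J"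
  shows "int_poly f \<Longrightarrow> ev Y f \<ominus> poly f y \<odot> \<one> \<in> J"
proof (induction f rule: pCons_induct)
  case 0
  then show ?case using additive_subgroup.zero_closed[OF ideal.axioms(1)[OF J]]
    by (simp add: L.M.minus_eq L.M.r_neg)
next
  case (pCons a f)
  interpret J: ideal J L by (rule J)
  have a: "a \<in> integers" and f: "int_poly f" using pCons by (auto simp: int_poly_pCons)
  let ?e = "ev Y f" and ?c = "poly f y \<odot> \<one>" and ?b = "y \<odot> \<one>" and ?a = "a \<odot> \<one>"
  have c: "?e \<in> carrier L" "?c \<in> carrier L" "?b \<in> carrier L" "?a \<in> carrier L"
    using Y y a f int_poly_poly by (auto simp: ev_closed)
  have "poly (pCons a f) y \<odot> \<one> = ?a \<oplus> ?b \<otimes> ?c"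
    using a y f int_poly_poly[OF f y(1)] by (simp add: sm_add sm_mult sm_one_mult integers_mult)
  then have "ev Y (pCons a f) \<ominus> poly (pCons a f) y \<odot> \<one> = (?a \<oplus> Y \<otimes> ?e) \<ominus> (?a \<oplus> ?b \<otimes> ?c)"
    using Y by (simp only: ev_pCons)
  also have "\<dots> = Y \<otimes> (?e \<ominus> ?c) \<oplus> (Y \<ominus> ?b) \<otimes> ?c"
    using c Y by algebra
  also have "\<dots> \<in> J"
    using pCons.IH[OF f] y c Y by (intro J.a_closed J.I_l_closed J.I_r_closed)
  finally show ?case .
qed

lemma finprod_scalars:
  assumes "finite I" "\<And>t. t \<in> I \<Longrightarrow> r t \<in> integers"
  shows "(\<Otimes>t\<in>I. r t \<odot> \<one>) = (\<Prod>t\<in>I. r t) \<odot> \<one>"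
  using assms
proof (induction I rule: finite_induct)
  case (insert t I)
  then have "(\<Otimes>s\<in>insert t I. r s \<odot> \<one>) = (r t \<odot> \<one>) \<otimes> (\<Otimes>s\<in>I. r s \<odot> \<one>)"
    by (intro L.finprod_insert) auto
  then show ?case using insert by (simp add: sm_one_mult sm_mult integers_prod)
qed simp

end


section \<open>The Iwasawa algebra and its quotients\<close>

locale iwasawa =
  fixes S :: "('c::field_char_0, 'g, 'k::finite) iwasawa_data"
  assumes setting: "iwasawa_setting S"
begin

sublocale p_valued_field "prm S" "val S" "fld S"
  by (rule iwasawa_valued_field[OF setting])

lemma O_K_eq: "O_K S = integers"
  by (simp add: O_K_def integers_def)

sublocale scalar_subring integers
  by unfold_locales (auto intro: integers_one integers_add integers_uminus integers_mult)

sublocale A: integral_algebra "prm S" "val S" "fld S" "Lam S"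
proof -
  have "algebra (scalars integers) (Lam S)"
    unfolding Lam_def O_K_eq by (rule algebra_completed_group_algebra[OF comm_group_Gam[OF setting]])
  then show "integral_algebra (prm S) (val S) (fld S) (Lam S)"
    by (intro integral_algebra.intro p_valued_field_axioms)
qed

sublocale LK: scalar_extension "prm S" "val S" "fld S" "Lam S"
  by (intro scalar_extension.intro p_valued_field_axioms A.L.module)

definition u :: "'k \<Rightarrow> 'c" where "u t = chr S t (gen S t)"

text \<open>In the quotient at the point \<open>i\<close> and the level \<open>m\<close>, the element \<open>Y t (m t)\<close> becomes
  the scalar \<open>node t (m t) (i t)\<close>.\<close>

definition node :: "'k \<Rightarrow> nat \<Rightarrow> int \<Rightarrow> 'c" where
  "node t m j = u t powi (j * int (prm S ^ m))"

definition Y :: "'k \<Rightarrow> nat \<Rightarrow> ('c, 'g, 'k) iwasawa_elem" where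
  "Y t m = gam S t [^]\<^bsub>Lam S\<^esub> (prm S ^ m)"

definition factor :: "'k \<Rightarrow> nat \<Rightarrow> int \<Rightarrow> ('c, 'g, 'k) iwasawa_elem" where
  "factor t m j = Y t m \<ominus>\<^bsub>Lam S\<^esub> node t m j \<odot>\<^bsub>Lam S\<^esub> \<one>\<^bsub>Lam S\<^esub>"

lemma u_K: "u t \<in> fld S" and v_u_minus_one: "val S (u t - 1) = val S (2 * of_nat (prm S))"
  unfolding u_def using iwasawa_generator[OF setting] by blast+

lemma v_u: "val S (u t) = 0"
  using v_u_minus_one by (intro v_unit_of_minus_one v_minus_one_pos) simp

lemma u_nonzero: "u t \<noteq> 0"
  using v_u[of t] by (auto simp: zero_ereal_def)

lemma u_power_minus_one:
  "l \<noteq> 0 \<Longrightarrow> val S (u t ^ l - 1) = val S (2 * of_nat (prm S)) + val S (of_nat l)"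
  using v_power_minus_one[of "u t" l] v_u_minus_one[of t] by simp

lemma u_power_neq_one: "l \<noteq> 0 \<Longrightarrow> u t ^ l \<noteq> 1"
proof
  assume l: "l \<noteq> 0" "u t ^ l = 1"
  then have "val S (2 * of_nat (prm S) * of_nat l) = \<infinity>"
    using u_power_minus_one[OF l(1), of t] by (simp add: v_mult)
  then show False using l(1) p_nonzero by (simp only: v_infinity_iff) simp
qed

lemma node_integer: "node t m j \<in> integers"
  unfolding node_def by (rule unit_powi_integer[OF u_K v_u])

text \<open>A power of \<open>u t\<close> with a positive exponent differs from \<open>1\<close>, because the valuation of the
  difference is finite.\<close>

lemma node_inj: "node t m i = node t m j \<Longrightarrow> i = j"
proof (rule ccontr)
  have *: "node t m i \<noteq> node t m j" if "i < j" for i j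
  proof
    assume eq: "node t m i = node t m j"
    have "j * int (prm S ^ m) = i * int (prm S ^ m) + int (nat (j - i) * prm S ^ m)"
      using that by (simp add: algebra_simps)
    then have "node t m j = node t m i * u t ^ (nat (j - i) * prm S ^ m)"
      unfolding node_def using u_nonzero[of t] by (metis power_int_add power_int_of_nat)
    then have "u t ^ (nat (j - i) * prm S ^ m) = 1"
      using eq u_nonzero[of t] by (simp add: node_def)
    moreover have "nat (j - i) * prm S ^ m \<noteq> 0" using that prime_p by auto
    ultimately show False using u_power_neq_one by blast
  qed
  assume "node t m i = node t m j" "i \<noteq> j"
  then show False using *[of i j] *[of j i] by (metis linorder_neqE)
qed

lemma gam_closed: "gam S t \<in> carrier (Lam S)"
proof -
  have g: "gen S j \<in> carrier (grp S j)" "group (grp S j)" for j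
    using setting by (auto simp: iwasawa_setting_def)
  then have "(\<lambda>j. if j = t then gen S t else \<one>\<^bsub>grp S j\<^esub>) \<in> carrier (Gam S)"
    using group.is_monoid monoid.one_closed by (fastforce simp: Gam_def)
  then show ?thesis
    unfolding gam_def Lam_def O_K_eq by (rule group_like_closed[OF comm_group_Gam[OF setting]])
qed

lemma Y_closed: "Y t m \<in> carrier (Lam S)"
  unfolding Y_def by (intro A.L.nat_pow_closed gam_closed)

lemma factor_ev: "factor t m j = A.ev (Y t m) [:- node t m j, 1:]"
  unfolding factor_def by (rule A.ev_linear[OF Y_closed node_integer, symmetric])

lemma factor_closed: "factor t m j \<in> carrier (Lam S)"
  unfolding factor_ev by (intro A.ev_closed Y_closed A.int_poly_linear node_integer)

lemma Omega_eq: "Omega S t a b m = (\<Otimes>\<^bsub>Lam S\<^esub>j\<in>{a..b}. factor t m j)"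
  by (simp add: Omega_def factor_def node_def u_def Y_def)

lemma Omega_ev: "Omega S t a b m = A.ev (Y t m) (\<Prod>j\<in>{a..b}. [:- node t m j, 1:])"
  unfolding Omega_eq factor_ev
  by (rule A.ev_prod[symmetric]) (auto intro: Y_closed A.int_poly_linear node_integer)

lemma Omega_closed: "Omega S t a b m \<in> carrier (Lam S)"
  unfolding Omega_eq by (intro A.L.finprod_closed) (auto intro: factor_closed)

lemma Omega_self: "Omega S t i i m = factor t m i"
  unfolding Omega_ev factor_ev by simp

lemma Omega_split:
  assumes "j \<in> {a..b}"
  shows "\<exists>q\<in>carrier (Lam S). Omega S t a b m = factor t m j \<otimes>\<^bsub>Lam S\<^esub> q"
proof
  show "Omega S t a b m = factor t m j \<otimes>\<^bsub>Lam S\<^esub> (\<Otimes>\<^bsub>Lam S\<^esub>j\<in>{a..b} - {j}. factor t m j)"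
    unfolding Omega_eq using assms A.L.finprod_insert[of "{a..b} - {j}" j "factor t m"]
    by (simp add: factor_closed insert_absorb insert_Diff)
  show "(\<Otimes>\<^bsub>Lam S\<^esub>j\<in>{a..b} - {j}. factor t m j) \<in> carrier (Lam S)"
    by (intro A.L.finprod_closed) (auto intro: factor_closed)
qed

lemma factor_dvd:
  assumes "m \<le> m'" shows "\<exists>q\<in>carrier (Lam S). factor t m' j = factor t m j \<otimes>\<^bsub>Lam S\<^esub> q"
proof -
  have pm: "prm S ^ m' = prm S ^ m * prm S ^ (m' - m)"
    using assms by (simp flip: power_add)
  have "Y t m' = Y t m [^]\<^bsub>Lam S\<^esub> (prm S ^ (m' - m))"
    unfolding Y_def pm by (rule A.L.nat_pow_pow[OF gam_closed, symmetric])
  moreover have "node t m' j = node t m j ^ (prm S ^ (m' - m))"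
  proof -
    have "j * int (prm S ^ m') = j * int (prm S ^ m) * int (prm S ^ (m' - m))"
      unfolding pm by simp
    then show ?thesis unfolding node_def by (metis power_int_mult power_int_of_nat)
  qed
  ultimately show ?thesis
    unfolding factor_def using A.power_minus_dvd[OF Y_closed node_integer] by metis
qed

lemma Omega_dvd:
  assumes "m \<le> m'" shows "\<exists>q\<in>carrier (Lam S). Omega S t a b m' = Omega S t a b m \<otimes>\<^bsub>Lam S\<^esub> q"
proof -
  obtain q where q: "\<And>j. q j \<in> carrier (Lam S)" "\<And>j. factor t m' j = factor t m j \<otimes>\<^bsub>Lam S\<^esub> q j"
    using factor_dvd[OF assms] by metis
  have "Omega S t a b m' = Omega S t a b m \<otimes>\<^bsub>Lam S\<^esub> (\<Otimes>\<^bsub>Lam S\<^esub>j\<in>{a..b}. q j)"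
    unfolding Omega_eq q(2) by (rule A.L.finprod_multf) (auto intro: factor_closed q)
  then show ?thesis using q by (auto intro!: A.L.finprod_closed)
qed

lemma Omega_ideal_ideal: "ideal (Omega_ideal S d e m) (Lam S)"
  unfolding Omega_ideal_def by (rule A.L.genideal_ideal) (auto intro: Omega_closed)

lemma Omega_in_ideal: "Omega S t (d t) (e t) (m t) \<in> Omega_ideal S d e m"
  unfolding Omega_ideal_def by (rule subsetD[OF A.L.genideal_self]) (auto intro: Omega_closed)

lemma Omega_ideal_subset:
  assumes "ideal J (Lam S)" "\<And>t. Omega S t (d t) (e t) (m t) \<in> J"
  shows "Omega_ideal S d e m \<subseteq> J"
  unfolding Omega_ideal_def by (rule A.L.genideal_minimal[OF assms(1)]) (use assms(2) in auto)

lemma Omega_ideal_point: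
  assumes "i \<in> {d..e}" shows "Omega_ideal S d e m \<subseteq> Omega_ideal S i i m"
proof (rule Omega_ideal_subset[OF Omega_ideal_ideal])
  fix t
  have "i t \<in> {d t..e t}" using assms by (simp add: le_fun_def)
  then obtain q where "q \<in> carrier (Lam S)" "Omega S t (d t) (e t) (m t) = factor t (m t) (i t) \<otimes>\<^bsub>Lam S\<^esub> q"
    using Omega_split by blast
  moreover have "factor t (m t) (i t) \<in> Omega_ideal S i i m"
    using Omega_in_ideal[of t i i m] by (simp add: Omega_self)
  ultimately show "Omega S t (d t) (e t) (m t) \<in> Omega_ideal S i i m"
    using ideal.I_r_closed[OF Omega_ideal_ideal] by metis
qed

lemma Omega_ideal_antimono:
  assumes "m \<le> m'" shows "Omega_ideal S d e m' \<subseteq> Omega_ideal S d e m"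
proof (rule Omega_ideal_subset[OF Omega_ideal_ideal])
  fix t
  have "m t \<le> m' t" using assms by (simp add: le_fun_def)
  then obtain q where "q \<in> carrier (Lam S)"
    "Omega S t (d t) (e t) (m' t) = Omega S t (d t) (e t) (m t) \<otimes>\<^bsub>Lam S\<^esub> q"
    using Omega_dvd by blast
  then show "Omega S t (d t) (e t) (m' t) \<in> Omega_ideal S d e m"
    using ideal.I_r_closed[OF Omega_ideal_ideal Omega_in_ideal] by metis
qed

sublocale E: algebra_ideal "scalars integers" "Lam S" "Omega_ideal S d e m" for d e m
  by (intro algebra_ideal.intro A.L.algebra_axioms Omega_ideal_ideal)

lemma module_Lam_quot: "module (scalars integers) (Lam_quot S d e m)"
  unfolding Lam_quot_def by (rule E.module_quot)

sublocale Q: scalar_extension "prm S" "val S" "fld S" "Lam_quot S d e m" for d e m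
  by (intro scalar_extension.intro p_valued_field_axioms module_Lam_quot)

text \<open>The class of \<open>x\<close> tensored with \<open>a\<close>. Every element of the quotient over the field has this
  form.\<close>

definition pq where
  "pq d e m x a = pure_tensor (scalars integers) (Lam_quot S d e m) (scalars (fld S))
     (Omega_ideal S d e m +>\<^bsub>Lam S\<^esub> x) a"

lemma quot_K_eq: "quot_K S d e m = tensor (scalars integers) (Lam_quot S d e m) (scalars (fld S))"
  by (simp add: quot_K_def O_K_eq)

lemma Lam_K_eq: "Lam_K S = tensor (scalars integers) (Lam S) (scalars (fld S))"
  by (simp add: Lam_K_def O_K_eq)

lemma coset_closed: "x \<in> carrier (Lam S) \<Longrightarrow> Omega_ideal S d e m +>\<^bsub>Lam S\<^esub> x \<in> carrier (Lam_quot S d e m)"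
  by (simp add: Lam_quot_def E.quot_carrier)

lemma module_quot_K: "module (scalars (fld S)) (quot_K S d e m)"
  unfolding quot_K_eq by (rule Q.module_TK)

lemma pq_closed: "x \<in> carrier (Lam S) \<Longrightarrow> a \<in> fld S \<Longrightarrow> pq d e m x a \<in> carrier (quot_K S d e m)"
  unfolding pq_def quot_K_eq by (intro Q.pt_closed coset_closed)

lemma pq_add:
  assumes "x \<in> carrier (Lam S)" "y \<in> carrier (Lam S)" "a \<in> fld S"
  shows "pq d e m (x \<oplus>\<^bsub>Lam S\<^esub> y) a = pq d e m x a \<oplus>\<^bsub>quot_K S d e m\<^esub> pq d e m y a"
  using Q.pt_add[OF coset_closed[OF assms(1)] coset_closed[OF assms(2)] assms(3)]
  unfolding pq_def quot_K_eq Lam_quot_def E.quot_add[OF assms(1,2)] .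

lemma pq_smult:
  assumes "r \<in> integers" "x \<in> carrier (Lam S)" "a \<in> fld S"
  shows "pq d e m (r \<odot>\<^bsub>Lam S\<^esub> x) a = pq d e m x (r * a)"
  using Q.pt_smult[OF assms(1) coset_closed[OF assms(2)] assms(3)] E.quot_smult[of r x] assms
  unfolding pq_def Lam_quot_def by simp

lemma smult_pq: "r \<in> fld S \<Longrightarrow> r \<odot>\<^bsub>quot_K S d e m\<^esub> pq d e m x a = pq d e m x (r * a)"
  unfolding pq_def quot_K_eq by (rule Q.smult_pt)

lemma pq_cong:
  assumes "x \<in> carrier (Lam S)" "y \<in> carrier (Lam S)" "x \<ominus>\<^bsub>Lam S\<^esub> y \<in> Omega_ideal S d e m"
  shows "pq d e m x a = pq d e m y a"
proof -
  have "Omega_ideal S d e m +>\<^bsub>Lam S\<^esub> x = Omega_ideal S d e m +>\<^bsub>Lam S\<^esub> y"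
    using E.proj_eq_iff[OF assms(1,2)] assms(3) by blast
  then show ?thesis unfolding pq_def by (rule arg_cong)
qed

lemma quot_K_common:
  assumes "z \<in> carrier (quot_K S d e m)" "z' \<in> carrier (quot_K S d e m)"
  shows "\<exists>a\<in>fld S. \<exists>x\<in>carrier (Lam S). \<exists>y\<in>carrier (Lam S). z = pq d e m x a \<and> z' = pq d e m y a"
proof -
  have "\<exists>a\<in>fld S. \<exists>X. \<forall>i\<in>{True, False}. X i \<in> carrier (Lam_quot S d e m) \<and>
      (if i then z else z') = pure_tensor (scalars integers) (Lam_quot S d e m) (scalars (fld S)) (X i) a"
    by (rule Q.common_denominator) (use assms in \<open>simp_all add: quot_K_eq\<close>)
  then obtain a X where a: "a \<in> fld S" and X: "\<forall>i\<in>{True, False}. X i \<in> carrier (Lam_quot S d e m) \<and>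
      (if i then z else z') = pure_tensor (scalars integers) (Lam_quot S d e m) (scalars (fld S)) (X i) a"
    by blast
  obtain x y where "x \<in> carrier (Lam S)" "X True = Omega_ideal S d e m +>\<^bsub>Lam S\<^esub> x"
    "y \<in> carrier (Lam S)" "X False = Omega_ideal S d e m +>\<^bsub>Lam S\<^esub> y"
    using X unfolding Lam_quot_def E.quot_carrier by auto
  moreover have "z = pure_tensor (scalars integers) (Lam_quot S d e m) (scalars (fld S)) (X True) a"
    "z' = pure_tensor (scalars integers) (Lam_quot S d e m) (scalars (fld S)) (X False) a"
    using X by simp_all
  ultimately show ?thesis using a unfolding pq_def by metis
qed

lemma pq_finsum:
  assumes "finite I" "\<And>i. i \<in> I \<Longrightarrow> x i \<in> carrier (Lam S)" "a \<in> fld S"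
  shows "pq d e m (finsum (Lam S) x I) a = (\<Oplus>\<^bsub>quot_K S d e m\<^esub>i\<in>I. pq d e m (x i) a)"
  using assms
proof (induction I rule: finite_induct)
  case empty
  interpret module "scalars (fld S)" "quot_K S d e m" by (rule module_quot_K)
  have "pq d e m (0 \<odot>\<^bsub>Lam S\<^esub> \<zero>\<^bsub>Lam S\<^esub>) a = 0 \<odot>\<^bsub>quot_K S d e m\<^esub> pq d e m \<zero>\<^bsub>Lam S\<^esub> a"
    using empty by (simp only: smult_pq pq_smult integers_zero K_zero A.L.zero_closed)
  also have "\<dots> = \<zero>\<^bsub>quot_K S d e m\<^esub>"
    using smult_l_null[OF pq_closed[OF A.L.zero_closed empty(2)]] by simp
  finally show ?case by simp
next
  case (insert i I)
  interpret module "scalars (fld S)" "quot_K S d e m" by (rule module_quot_K)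
  have "finsum (Lam S) x (insert i I) = x i \<oplus>\<^bsub>Lam S\<^esub> finsum (Lam S) x I"
    "(\<Oplus>\<^bsub>quot_K S d e m\<^esub>i\<in>insert i I. pq d e m (x i) a)
      = pq d e m (x i) a \<oplus>\<^bsub>quot_K S d e m\<^esub> (\<Oplus>\<^bsub>quot_K S d e m\<^esub>i\<in>I. pq d e m (x i) a)"
    using insert by (auto intro!: A.L.M.finsum_insert M.finsum_insert simp: pq_closed)
  moreover have "finsum (Lam S) x I \<in> carrier (Lam S)" using insert by (intro A.L.M.finsum_closed) auto
  ultimately show ?case using insert by (simp add: pq_add)
qed

lemma red_linear:
  assumes sub: "Omega_ideal S d e m' \<subseteq> Omega_ideal S d' e' m"
  shows "linear_map (scalars integers) (Lam_quot S d e m') (Lam_quot S d' e' m)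
    (\<lambda>X. Omega_ideal S d' e' m <+>\<^bsub>Lam S\<^esub> X)"
    and "x \<in> carrier (Lam S) \<Longrightarrow> Omega_ideal S d' e' m <+>\<^bsub>Lam S\<^esub> (Omega_ideal S d e m' +>\<^bsub>Lam S\<^esub> x)
      = Omega_ideal S d' e' m +>\<^bsub>Lam S\<^esub> x"
proof -
  note coset = E.set_add_coset[OF Omega_ideal_ideal sub]
  show "x \<in> carrier (Lam S) \<Longrightarrow> Omega_ideal S d' e' m <+>\<^bsub>Lam S\<^esub> (Omega_ideal S d e m' +>\<^bsub>Lam S\<^esub> x)
      = Omega_ideal S d' e' m +>\<^bsub>Lam S\<^esub> x" by (rule coset)
  have IJ: "\<one>\<^bsub>Lam S\<^esub> \<otimes>\<^bsub>Lam S\<^esub> x \<in> Omega_ideal S d' e' m" if "x \<in> Omega_ideal S d e m'" for x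
  proof -
    have "x \<in> carrier (Lam S)" using that by (rule E.I.a_Hcarr)
    then show ?thesis using that sub by auto
  qed
  have "\<exists>\<phi>. linear_map (scalars integers) (Lam_quot S d e m') (Lam_quot S d' e' m) \<phi> \<and>
    (\<forall>x\<in>carrier (Lam S). \<phi> (Omega_ideal S d e m' +>\<^bsub>Lam S\<^esub> x) = Omega_ideal S d' e' m +>\<^bsub>Lam S\<^esub> (\<one>\<^bsub>Lam S\<^esub> \<otimes>\<^bsub>Lam S\<^esub> x))"
    unfolding Lam_quot_def by (rule E.quotient_multiplication[OF Omega_ideal_ideal A.L.one_closed IJ])
  then obtain \<phi> where \<phi>: "linear_map (scalars integers) (Lam_quot S d e m') (Lam_quot S d' e' m) \<phi>"
    "\<forall>x\<in>carrier (Lam S). \<phi> (Omega_ideal S d e m' +>\<^bsub>Lam S\<^esub> x) = Omega_ideal S d' e' m +>\<^bsub>Lam S\<^esub> (\<one>\<^bsub>Lam S\<^esub> \<otimes>\<^bsub>Lam S\<^esub> x)"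
    by blast
  have eq: "Omega_ideal S d' e' m <+>\<^bsub>Lam S\<^esub> X = \<phi> X" if X: "X \<in> carrier (Lam_quot S d e m')" for X
  proof -
    obtain x where x: "x \<in> carrier (Lam S)" "X = Omega_ideal S d e m' +>\<^bsub>Lam S\<^esub> x"
      using X unfolding Lam_quot_def E.quot_carrier by blast
    then show ?thesis using \<phi>(2) coset[OF x(1)] by simp
  qed
  show "linear_map (scalars integers) (Lam_quot S d e m') (Lam_quot S d' e' m)
    (\<lambda>X. Omega_ideal S d' e' m <+>\<^bsub>Lam S\<^esub> X)"
    unfolding linear_map_def
  proof (intro conjI ballI funcsetI)
    fix X assume X: "X \<in> carrier (Lam_quot S d e m')"
    show "Omega_ideal S d' e' m <+>\<^bsub>Lam S\<^esub> X \<in> carrier (Lam_quot S d' e' m)"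
      unfolding eq[OF X] by (rule linear_mapD(1)[OF \<phi>(1) X])
    show "Omega_ideal S d' e' m <+>\<^bsub>Lam S\<^esub> (X \<oplus>\<^bsub>Lam_quot S d e m'\<^esub> X')
        = (Omega_ideal S d' e' m <+>\<^bsub>Lam S\<^esub> X) \<oplus>\<^bsub>Lam_quot S d' e' m\<^esub> (Omega_ideal S d' e' m <+>\<^bsub>Lam S\<^esub> X')"
      if X': "X' \<in> carrier (Lam_quot S d e m')" for X'
      unfolding eq[OF X] eq[OF X'] eq[OF Q.M.M.a_closed[OF X X']] by (rule linear_mapD(2)[OF \<phi>(1) X X'])
    show "Omega_ideal S d' e' m <+>\<^bsub>Lam S\<^esub> (r \<odot>\<^bsub>Lam_quot S d e m'\<^esub> X)
        = r \<odot>\<^bsub>Lam_quot S d' e' m\<^esub> (Omega_ideal S d' e' m <+>\<^bsub>Lam S\<^esub> X)"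
      if r: "r \<in> carrier (scalars integers)" for r
      unfolding eq[OF X] eq[OF Q.M.smult_closed[OF r X]] by (rule linear_mapD(3)[OF \<phi>(1) r X])
  qed
qed

lemma red_K_map:
  assumes "Omega_ideal S d e m' \<subseteq> Omega_ideal S d' e' m"
  shows "x \<in> carrier (Lam S) \<Longrightarrow> red_K S d' e' m (pq d e m' x a) = pq d' e' m x a"
    and "z \<in> carrier (quot_K S d e m') \<Longrightarrow> red_K S d' e' m z \<in> carrier (quot_K S d' e' m)"
    and "r \<in> fld S \<Longrightarrow> z \<in> carrier (quot_K S d e m') \<Longrightarrow>
      red_K S d' e' m (r \<odot>\<^bsub>quot_K S d e m'\<^esub> z) = r \<odot>\<^bsub>quot_K S d' e' m\<^esub> red_K S d' e' m z"
proof -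
  interpret F: scalar_extension_map "prm S" "val S" "fld S" "Lam_quot S d e m'" "Lam_quot S d' e' m"
    "\<lambda>X. Omega_ideal S d' e' m <+>\<^bsub>Lam S\<^esub> X"
    by (intro scalar_extension_map.intro scalar_extension_map_axioms.intro Q.scalar_extension_axioms
        red_linear[OF assms])
  show "x \<in> carrier (Lam S) \<Longrightarrow> red_K S d' e' m (pq d e m' x a) = pq d' e' m x a"
    unfolding red_K_def pq_def O_K_eq F.map_K_pt red_linear(2)[OF assms] by (simp add: red_linear(2)[OF assms])
  show "z \<in> carrier (quot_K S d e m') \<Longrightarrow> red_K S d' e' m z \<in> carrier (quot_K S d' e' m)"
    unfolding red_K_def quot_K_eq O_K_eq by (rule F.tensor_map_closed)
  show "r \<in> fld S \<Longrightarrow> z \<in> carrier (quot_K S d e m') \<Longrightarrow>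
      red_K S d' e' m (r \<odot>\<^bsub>quot_K S d e m'\<^esub> z) = r \<odot>\<^bsub>quot_K S d' e' m\<^esub> red_K S d' e' m z"
    unfolding red_K_def quot_K_eq O_K_eq by (rule F.map_K_smult)
qed

lemma proj_K_map:
  shows "proj_K S d e m (LK.pt x a) = pq d e m x a"
proof -
  have "linear_map (scalars integers) (Lam S) (Lam_quot S d e m) (\<lambda>x. Omega_ideal S d e m +>\<^bsub>Lam S\<^esub> x)"
    using E.linear_proj unfolding Lam_quot_def .
  then interpret F: scalar_extension_map "prm S" "val S" "fld S" "Lam S" "Lam_quot S d e m"
    "\<lambda>x. Omega_ideal S d e m +>\<^bsub>Lam S\<^esub> x"
    by (intro scalar_extension_map.intro scalar_extension_map_axioms.intro Q.scalar_extension_axioms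
        LK.scalar_extension_axioms)
  show ?thesis unfolding proj_K_def pq_def O_K_eq by (rule F.map_K_pt)
qed

lemma pq_multiplication:
  assumes g: "g \<in> carrier (Lam S)"
    and sub: "\<And>z. z \<in> Omega_ideal S d e m \<Longrightarrow> g \<otimes>\<^bsub>Lam S\<^esub> z \<in> Omega_ideal S d' e' m'"
    and x: "x \<in> carrier (Lam S)" "y \<in> carrier (Lam S)" and eq: "pq d e m x a = pq d e m y b"
  shows "pq d' e' m' (g \<otimes>\<^bsub>Lam S\<^esub> x) a = pq d' e' m' (g \<otimes>\<^bsub>Lam S\<^esub> y) b"
proof -
  have "\<exists>\<phi>. linear_map (scalars integers) (Lam_quot S d e m) (Lam_quot S d' e' m') \<phi> \<and>
    (\<forall>x\<in>carrier (Lam S). \<phi> (Omega_ideal S d e m +>\<^bsub>Lam S\<^esub> x) = Omega_ideal S d' e' m' +>\<^bsub>Lam S\<^esub> (g \<otimes>\<^bsub>Lam S\<^esub> x))"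
    unfolding Lam_quot_def by (rule E.quotient_multiplication[OF Omega_ideal_ideal g sub])
  then obtain \<phi> where \<phi>: "linear_map (scalars integers) (Lam_quot S d e m) (Lam_quot S d' e' m') \<phi>"
    "\<forall>x\<in>carrier (Lam S). \<phi> (Omega_ideal S d e m +>\<^bsub>Lam S\<^esub> x) = Omega_ideal S d' e' m' +>\<^bsub>Lam S\<^esub> (g \<otimes>\<^bsub>Lam S\<^esub> x)"
    by blast
  interpret F: scalar_extension_map "prm S" "val S" "fld S" "Lam_quot S d e m" "Lam_quot S d' e' m'" \<phi>
    by (intro scalar_extension_map.intro scalar_extension_map_axioms.intro Q.scalar_extension_axioms \<phi>(1))
  have "F.map_K (pq d e m z c) = pq d' e' m' (g \<otimes>\<^bsub>Lam S\<^esub> z) c" if "z \<in> carrier (Lam S)" for z c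
    unfolding pq_def F.map_K_pt using \<phi>(2) that by simp
  then show ?thesis using x eq by metis
qed

section \<open>Uniqueness\<close>

lemma box_PiE: "{d..e} = Pi\<^sub>E UNIV (\<lambda>t. {d t..e t})" for d e :: "'k \<Rightarrow> int"
  by (auto simp: le_fun_def PiE_iff)

lemma finite_box: "finite {d..e}" for d e :: "'k \<Rightarrow> int"
  unfolding box_PiE by (rule finite_PiE) auto

text \<open>The multiplier \<open>g i\<close> is the product over the coordinates \<open>t\<close> of the Lagrange polynomial
  that belongs to \<open>i t\<close>, evaluated at \<open>Y t (m t)\<close>. Multiplied by the factor of index
  \<open>i t\<close> it becomes a multiple of the full product in the coordinate \<open>t\<close>, and the sum of all
  multipliers is a nonzero scalar since the Lagrange polynomials of one coordinate sum to one.\<close>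

lemma interpolation_multipliers:
  assumes de: "d \<le> e"
  shows "\<exists>\<beta> g. \<beta> \<in> integers \<and> \<beta> \<noteq> 0 \<and> (\<forall>i\<in>{d..e}. g i \<in> carrier (Lam S) \<and>
      (\<forall>x\<in>Omega_ideal S i i m. g i \<otimes>\<^bsub>Lam S\<^esub> x \<in> Omega_ideal S d e m)) \<and>
    (\<Oplus>\<^bsub>Lam S\<^esub>i\<in>{d..e}. g i) = \<beta> \<odot>\<^bsub>Lam S\<^esub> \<one>\<^bsub>Lam S\<^esub>"
proof -
  let ?J = "\<lambda>t. {d t..e t}" and ?lin = "\<lambda>t i. [:- node t (m t) i, 1:]"
  define \<Phi> where "\<Phi> t \<beta> b \<longleftrightarrow> \<beta> \<in> integers \<and> \<beta> \<noteq> 0 \<and> (\<forall>j\<in>?J t. b j \<in> integers) \<and>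
      (\<Sum>j\<in>?J t. Polynomial.smult (b j) (\<Prod>i\<in>?J t - {j}. ?lin t i)) = [:\<beta>:]" for t \<beta> b
  have "\<exists>\<beta> b. \<Phi> t \<beta> b" for t
    unfolding \<Phi>_def
  proof (rule lagrange_one)
    show "?J t \<noteq> {}" using de by (simp add: le_fun_def)
    show "inj_on (node t (m t)) (?J t)" by (rule inj_onI) (rule node_inj)
  qed (auto intro: node_integer)
  then obtain \<beta> b where "\<And>t. \<Phi> t (\<beta> t) (b t)" by metis
  then have \<beta>: "\<And>t. \<beta> t \<in> integers" "\<And>t. \<beta> t \<noteq> 0"
    and b: "\<And>t j. j \<in> ?J t \<Longrightarrow> b t j \<in> integers"
    and sum: "\<And>t. (\<Sum>j\<in>?J t. Polynomial.smult (b t j) (\<Prod>i\<in>?J t - {j}. ?lin t i)) = [:\<beta> t:]"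
    unfolding \<Phi>_def by blast+
  define f where "f t j = Polynomial.smult (b t j) (\<Prod>i\<in>?J t - {j}. ?lin t i)" for t j
  define G where "G t j = A.ev (Y t (m t)) (f t j)" for t j
  define g where "g i = (\<Otimes>\<^bsub>Lam S\<^esub>t\<in>UNIV. G t (i t))" for i
  have f: "int_poly (f t j)" if "j \<in> ?J t" for t j
    unfolding f_def by (intro int_poly_smult b[OF that] int_poly_prod A.int_poly_linear node_integer)
  have G: "G t j \<in> carrier (Lam S)" if "j \<in> ?J t" for t j
    unfolding G_def by (intro A.ev_closed Y_closed f[OF that])
  have i: "i t \<in> ?J t" if "i \<in> {d..e}" for i t using that by (simp add: le_fun_def)
  have g: "g i \<in> carrier (Lam S)" if "i \<in> {d..e}" for i
    unfolding g_def using G i[OF that] by (intro A.L.finprod_closed) auto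
  have prod: "G t j \<otimes>\<^bsub>Lam S\<^esub> factor t (m t) j = b t j \<odot>\<^bsub>Lam S\<^esub> Omega S t (d t) (e t) (m t)"
    if j: "j \<in> ?J t" for t j
  proof -
    have P: "int_poly (\<Prod>i\<in>?J t. ?lin t i)"
      by (intro int_poly_prod A.int_poly_linear node_integer)
    have "G t j \<otimes>\<^bsub>Lam S\<^esub> factor t (m t) j = A.ev (Y t (m t)) (f t j * ?lin t j)"
      unfolding G_def factor_ev
      by (rule A.ev_mult[OF Y_closed f[OF j] A.int_poly_linear[OF node_integer], symmetric])
    also have "f t j * ?lin t j = Polynomial.smult (b t j) (\<Prod>i\<in>?J t. ?lin t i)"
      unfolding f_def using j prod.remove[of "?J t" j "?lin t"] by (simp add: mult.commute)
    also have "A.ev (Y t (m t)) \<dots> = b t j \<odot>\<^bsub>Lam S\<^esub> Omega S t (d t) (e t) (m t)"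
      unfolding Omega_ev by (rule A.ev_smult[OF Y_closed b[OF j] P])
    finally show ?thesis .
  qed
  have mem: "g i \<otimes>\<^bsub>Lam S\<^esub> x \<in> Omega_ideal S d e m" if i': "i \<in> {d..e}" and x: "x \<in> Omega_ideal S i i m" for i x
  proof -
    let ?J = "{x \<in> carrier (Lam S). g i \<otimes>\<^bsub>Lam S\<^esub> x \<in> Omega_ideal S d e m}"
    have "Omega_ideal S i i m \<subseteq> ?J"
    proof (rule Omega_ideal_subset)
      show "ideal ?J (Lam S)" by (rule A.L.colon_ideal[OF Omega_ideal_ideal g[OF i']])
      fix t
      let ?R = "\<Otimes>\<^bsub>Lam S\<^esub>s\<in>UNIV - {t}. G s (i s)" and ?o = "Omega S t (d t) (e t) (m t)"
      have R: "?R \<in> carrier (Lam S)" using G i[OF i'] by (intro A.L.finprod_closed) auto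
      have c: "G t (i t) \<in> carrier (Lam S)" "factor t (m t) (i t) \<in> carrier (Lam S)"
        using G i[OF i'] factor_closed by auto
      have "g i = G t (i t) \<otimes>\<^bsub>Lam S\<^esub> ?R"
        unfolding g_def using A.L.finprod_insert[of "UNIV - {t}" t "\<lambda>s. G s (i s)"] G i[OF i']
        by (simp add: insert_absorb insert_Diff)
      then have "g i \<otimes>\<^bsub>Lam S\<^esub> factor t (m t) (i t) = ?R \<otimes>\<^bsub>Lam S\<^esub> (G t (i t) \<otimes>\<^bsub>Lam S\<^esub> factor t (m t) (i t))"
        using R c by (simp add: A.L.m_ac)
      also have "\<dots> \<in> Omega_ideal S d e m"
        unfolding prod[OF i[OF i']]
        using b[OF i[OF i']] R by (intro E.I.I_l_closed E.ideal_smult Omega_in_ideal) auto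
      finally show "Omega S t (i t) (i t) (m t) \<in> ?J"
        unfolding Omega_self using factor_closed by simp
    qed
    then show ?thesis using x by blast
  qed
  have "(\<Oplus>\<^bsub>Lam S\<^esub>i\<in>{d..e}. g i) = (\<Otimes>\<^bsub>Lam S\<^esub>t\<in>UNIV. \<Oplus>\<^bsub>Lam S\<^esub>j\<in>?J t. G t j)"
    unfolding g_def box_PiE
    by (rule A.L.finprod_finsum_distrib[symmetric]) (auto intro: G)
  also have "\<dots> = (\<Otimes>\<^bsub>Lam S\<^esub>t\<in>UNIV. \<beta> t \<odot>\<^bsub>Lam S\<^esub> \<one>\<^bsub>Lam S\<^esub>)"
  proof (rule A.L.finprod_cong')
    fix t :: 'k
    have "(\<Oplus>\<^bsub>Lam S\<^esub>j\<in>?J t. G t j) = A.ev (Y t (m t)) (\<Sum>j\<in>?J t. f t j)"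
      unfolding G_def by (rule A.ev_sum[OF Y_closed, symmetric]) (auto intro: f)
    also have "\<dots> = \<beta> t \<odot>\<^bsub>Lam S\<^esub> \<one>\<^bsub>Lam S\<^esub>"
      unfolding f_def sum by (rule A.ev_const[OF Y_closed \<beta>(1)])
    finally show "(\<Oplus>\<^bsub>Lam S\<^esub>j\<in>?J t. G t j) = \<beta> t \<odot>\<^bsub>Lam S\<^esub> \<one>\<^bsub>Lam S\<^esub>" .
  qed (use \<beta> in auto)
  also have "\<dots> = (\<Prod>t\<in>UNIV. \<beta> t) \<odot>\<^bsub>Lam S\<^esub> \<one>\<^bsub>Lam S\<^esub>"
    by (rule A.finprod_scalars) (auto intro: \<beta>)
  finally have "(\<Oplus>\<^bsub>Lam S\<^esub>i\<in>{d..e}. g i) = (\<Prod>t\<in>UNIV. \<beta> t) \<odot>\<^bsub>Lam S\<^esub> \<one>\<^bsub>Lam S\<^esub>" .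
  moreover have "(\<Prod>t\<in>UNIV. \<beta> t) \<in> integers" "(\<Prod>t\<in>UNIV. \<beta> t) \<noteq> 0"
    using \<beta> by (auto intro: integers_prod)
  ultimately show ?thesis using g mem by blast
qed

text \<open>Multiplication by \<open>g i\<close> factors through the quotient at the point \<open>i\<close>, and the sum of
  these multiplications is an invertible scalar of the field.\<close>

lemma pq_unique:
  assumes de: "d \<le> e" and xy: "x \<in> carrier (Lam S)" "y \<in> carrier (Lam S)" and a: "a \<in> fld S"
    and eq: "\<And>i. i \<in> {d..e} \<Longrightarrow> pq i i m x a = pq i i m y a"
  shows "pq d e m x a = pq d e m y a"
proof -
  obtain \<beta> g where \<beta>: "\<beta> \<in> integers" "\<beta> \<noteq> 0"
    and gg: "\<forall>i\<in>{d..e}. g i \<in> carrier (Lam S) \<and>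
      (\<forall>x\<in>Omega_ideal S i i m. g i \<otimes>\<^bsub>Lam S\<^esub> x \<in> Omega_ideal S d e m)"
    and sum: "(\<Oplus>\<^bsub>Lam S\<^esub>i\<in>{d..e}. g i) = \<beta> \<odot>\<^bsub>Lam S\<^esub> \<one>\<^bsub>Lam S\<^esub>"
    using interpolation_multipliers[OF de, of m] by (elim exE conjE) (rule that)
  have g: "g i \<in> carrier (Lam S)" "z \<in> Omega_ideal S i i m \<Longrightarrow> g i \<otimes>\<^bsub>Lam S\<^esub> z \<in> Omega_ideal S d e m"
    if "i \<in> {d..e}" for i z using gg that by blast+
  interpret module "scalars (fld S)" "quot_K S d e m" by (rule module_quot_K)
  have *: "pq d e m z a = inverse \<beta> \<odot>\<^bsub>quot_K S d e m\<^esub> (\<Oplus>\<^bsub>quot_K S d e m\<^esub>i\<in>{d..e}. pq d e m (g i \<otimes>\<^bsub>Lam S\<^esub> z) a)"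
    if z: "z \<in> carrier (Lam S)" for z
  proof -
    have "(\<Oplus>\<^bsub>quot_K S d e m\<^esub>i\<in>{d..e}. pq d e m (g i \<otimes>\<^bsub>Lam S\<^esub> z) a)
        = pq d e m (\<Oplus>\<^bsub>Lam S\<^esub>i\<in>{d..e}. g i \<otimes>\<^bsub>Lam S\<^esub> z) a"
      by (rule pq_finsum[symmetric]) (use finite_box g z a in auto)
    also have "(\<Oplus>\<^bsub>Lam S\<^esub>i\<in>{d..e}. g i \<otimes>\<^bsub>Lam S\<^esub> z) = \<beta> \<odot>\<^bsub>Lam S\<^esub> z"
      using A.L.finsum_ldistr[OF finite_box z, of g d e] g z \<beta> by (simp add: sum A.sm_one_mult Pi_def)
    finally show ?thesis
      using \<beta> z a by (simp add: pq_smult smult_pq K_inverse integers_subset flip: mult.assoc)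
  qed
  have "(\<Oplus>\<^bsub>quot_K S d e m\<^esub>i\<in>{d..e}. pq d e m (g i \<otimes>\<^bsub>Lam S\<^esub> x) a)
      = (\<Oplus>\<^bsub>quot_K S d e m\<^esub>i\<in>{d..e}. pq d e m (g i \<otimes>\<^bsub>Lam S\<^esub> y) a)"
  proof (rule M.finsum_cong')
    fix i assume i: "i \<in> {d..e}"
    show "pq d e m (g i \<otimes>\<^bsub>Lam S\<^esub> x) a = pq d e m (g i \<otimes>\<^bsub>Lam S\<^esub> y) a"
      by (rule pq_multiplication[OF g(1)[OF i] g(2)[OF i] xy eq[OF i]])
  qed (use g xy a in \<open>auto intro!: pq_closed\<close>)
  then show ?thesis using * xy by simp
qed

lemma quot_K_unique:
  assumes de: "d \<le> e" and z: "z \<in> carrier (quot_K S d e m)" "z' \<in> carrier (quot_K S d e m)"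
    and eq: "\<And>i. i \<in> {d..e} \<Longrightarrow> red_K S i i m z = red_K S i i m z'"
  shows "z = z'"
proof -
  obtain a x y where a: "a \<in> fld S" "x \<in> carrier (Lam S)" "y \<in> carrier (Lam S)"
    "z = pq d e m x a" "z' = pq d e m y a" using quot_K_common[OF z] by blast
  show ?thesis
    unfolding a(4,5)
  proof (rule pq_unique[OF de a(2,3,1)])
    fix i assume "i \<in> {d..e}"
    then show "pq i i m x a = pq i i m y a"
      using eq[of i] red_K_map(1)[OF Omega_ideal_point] a by simp
  qed
qed

end


section \<open>Binomial inversion\<close>

lemma binomial_inversion:
  assumes "i \<le> N"
  shows "(\<Sum>n\<le>N. of_nat (i choose n) * (of_nat (n choose k) * (-1) ^ (n - k)))
    = (if i = k then 1 else (0 :: 'a::comm_ring_1))"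
proof (cases "k \<le> i")
  case False
  have "of_nat (i choose n) * (of_nat (n choose k) * (-1) ^ (n - k)) = (0 :: 'a)" for n
    using False by (cases "n \<le> i") (simp_all add: binomial_eq_0)
  then show ?thesis using False by simp
next
  case True
  let ?f = "\<lambda>n. of_nat (i choose n) * (of_nat (n choose k) * (-1) ^ (n - k)) :: 'a"
  have "sum ?f {..N} = sum ?f {k..i}"
    by (rule sum.mono_neutral_right) (use assms in \<open>auto simp: not_le binomial_eq_0\<close>)
  also have "\<dots> = (\<Sum>s\<le>i - k. of_nat (i choose k) * ((-1) ^ s * of_nat ((i - k) choose s)))"
  proof (rule sum.reindex_bij_witness[of _ "\<lambda>s. s + k" "\<lambda>n. n - k"])
    fix n assume n: "n \<in> {k..i}"
    then have "(i choose n) * (n choose k) = (i choose k) * ((i - k) choose (n - k))"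
      by (intro choose_mult) auto
    then have "of_nat (i choose n) * of_nat (n choose k)
        = (of_nat (i choose k) * of_nat ((i - k) choose (n - k)) :: 'a)"
      by (metis of_nat_mult)
    note eq = this
    have "?f n = (of_nat (i choose n) * of_nat (n choose k)) * (-1) ^ (n - k)"
      by (simp only: mult.assoc)
    also have "\<dots> = of_nat (i choose k) * ((-1) ^ (n - k) * of_nat ((i - k) choose (n - k)))"
      unfolding eq by (simp only: ac_simps)
    finally show "of_nat (i choose k) * ((-1) ^ (n - k) * of_nat ((i - k) choose (n - k))) = ?f n"
      by (rule sym)
  qed (use True in auto)
  also have "\<dots> = of_nat (i choose k) * (\<Sum>s\<le>i - k. (-1) ^ s * of_nat ((i - k) choose s))"
    by (simp add: sum_distrib_left)
  also have "\<dots> = (if i = k then 1 else 0)"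
    using choose_alternating_sum[of "i - k", where ?'a = 'a] True by (cases "i = k") auto
  finally show ?thesis .
qed

definition box_binomial :: "('k::finite \<Rightarrow> int) \<Rightarrow> ('k \<Rightarrow> int) \<Rightarrow> ('k \<Rightarrow> int) \<Rightarrow> nat" where
  "box_binomial d i j = (\<Prod>t\<in>UNIV. nat (i t - d t) choose nat (j t - d t))"

text \<open>The sum factors into one-dimensional ones. The terms with \<open>i'\<close> outside of the box vanish
  in any case, because then a binomial coefficient in \<open>box_binomial d j i'\<close> does.\<close>

lemma box_binomial_inversion:
  fixes d e :: "'k::finite \<Rightarrow> int"
  assumes i: "i \<in> {d..e}" and i': "i' \<in> {d..e}"
  shows "(\<Sum>j\<in>{d..e}. of_nat (box_binomial d i j) *
      (if i' \<in> {d..j} then of_nat (box_binomial d j i') * (-1) ^ nat (\<Sum>t\<in>UNIV. j t - i' t) else 0))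
    = (if i = i' then 1 else (0 :: 'a::comm_ring_1))"
proof -
  let ?b = "\<lambda>t j. of_nat (nat (i t - d t) choose nat (j - d t)) *
      (of_nat (nat (j - d t) choose nat (i' t - d t)) * (-1) ^ nat (j - i' t)) :: 'a"
  have box: "{d..e} = Pi\<^sub>E UNIV (\<lambda>t. {d t..e t})" by (auto simp: le_fun_def PiE_iff)
  have bounds: "d t \<le> i t" "i t \<le> e t" "d t \<le> i' t" "i' t \<le> e t" for t
    using i i' by (auto simp: le_fun_def)
  have "(\<Sum>j\<in>{d..e}. of_nat (box_binomial d i j) *
      (if i' \<in> {d..j} then of_nat (box_binomial d j i') * (-1) ^ nat (\<Sum>t\<in>UNIV. j t - i' t) else 0))
    = (\<Sum>j\<in>{d..e}. \<Prod>t\<in>UNIV. ?b t (j t))"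
  proof (rule sum.cong[OF refl])
    fix j assume j: "j \<in> {d..e}"
    have split: "(\<Prod>t\<in>UNIV. ?b t (j t)) = of_nat (box_binomial d i j) *
        (of_nat (box_binomial d j i') * (\<Prod>t\<in>UNIV. (-1) ^ nat (j t - i' t)))"
      by (simp add: box_binomial_def prod.distrib)
    show "of_nat (box_binomial d i j) *
        (if i' \<in> {d..j} then of_nat (box_binomial d j i') * (-1) ^ nat (\<Sum>t\<in>UNIV. j t - i' t) else 0)
      = (\<Prod>t\<in>UNIV. ?b t (j t))"
    proof (cases "i' \<in> {d..j}")
      case True
      then have "(\<Sum>t\<in>UNIV. j t - i' t) = int (\<Sum>t\<in>UNIV. nat (j t - i' t))"
        by (simp add: le_fun_def)
      then have "nat (\<Sum>t\<in>UNIV. j t - i' t) = (\<Sum>t\<in>UNIV. nat (j t - i' t))"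
        by (simp only: nat_int)
      then show ?thesis using True by (simp add: split power_sum)
    next
      case False
      then have "\<not> i' \<le> j" using i' by simp
      then obtain t where "j t < i' t" by (auto simp: le_fun_def not_le)
      moreover have "d t \<le> j t" using j by (simp add: le_fun_def)
      ultimately have "nat (j t - d t) choose nat (i' t - d t) = 0"
        by (intro binomial_eq_0) simp
      then have "box_binomial d j i' = 0" unfolding box_binomial_def by (intro prod_zero) auto
      then show ?thesis using False by (simp add: split)
    qed
  qed
  also have "\<dots> = (\<Prod>t\<in>UNIV. \<Sum>j\<in>{d t..e t}. ?b t j)"
    unfolding box by (rule prod_sum_PiE[symmetric]) auto
  also have "\<dots> = (\<Prod>t\<in>UNIV. if i t = i' t then 1 else 0)"
  proof (rule prod.cong[OF refl])
    fix t :: 'k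
    have "(\<Sum>j\<in>{d t..e t}. ?b t j) = (\<Sum>n\<le>nat (e t - d t). of_nat (nat (i t - d t) choose n) *
        (of_nat (n choose nat (i' t - d t)) * (-1) ^ (n - nat (i' t - d t))))"
    proof (rule sum.reindex_bij_witness[of _ "\<lambda>n. d t + int n" "\<lambda>j. nat (j - d t)"])
      fix j assume "j \<in> {d t..e t}"
      moreover have "nat (j - i' t) = nat (j - d t) - nat (i' t - d t)" using bounds[of t] by simp
      ultimately show "of_nat (nat (i t - d t) choose nat (j - d t)) *
        (of_nat (nat (j - d t) choose nat (i' t - d t)) * (-1) ^ (nat (j - d t) - nat (i' t - d t))) = ?b t j"
        by simp
    qed (use bounds[of t] in auto)
    also have "\<dots> = (if nat (i t - d t) = nat (i' t - d t) then 1 else 0)"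
      by (rule binomial_inversion) (use bounds[of t] in auto)
    also have "\<dots> = (if i t = i' t then 1 else 0)" using bounds[of t] by auto
    finally show "(\<Sum>j\<in>{d t..e t}. ?b t j) = (if i t = i' t then 1 else 0)" .
  qed
  also have "\<dots> = (if i = i' then 1 else 0)"
    by (auto simp: fun_eq_iff intro!: prod_zero)
  finally show ?thesis .
qed

context iwasawa begin

section \<open>Elements of prescribed valuation\<close>

text \<open>The values at which \<open>p_pow\<close> is a genuine choice.\<close>

definition is_value :: "real \<Rightarrow> bool" where
  "is_value r \<longleftrightarrow> (\<exists>z\<in>fld S. val S z = ereal r)"

lemma p_pow_spec:
  assumes "is_value r"
  shows "p_pow S r \<in> fld S" "val S (p_pow S r) = ereal r" "p_pow S r \<noteq> 0"
proof -
  have "\<exists>z. z \<in> fld S \<and> val S z = ereal r" using assms by (auto simp: is_value_def)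
  from someI_ex[OF this] show *: "p_pow S r \<in> fld S" "val S (p_pow S r) = ereal r"
    by (auto simp: p_pow_def)
  show "p_pow S r \<noteq> 0" using *(2) by auto
qed

lemma is_value_add: "is_value r \<Longrightarrow> is_value r' \<Longrightarrow> is_value (r + r')"
  unfolding is_value_def by (metis K_mult v_mult plus_ereal.simps(1))

lemma is_value_uminus: "is_value r \<Longrightarrow> is_value (- r)"
  unfolding is_value_def
proof (elim bexE)
  fix z assume z: "z \<in> fld S" "val S z = ereal r"
  then have "z \<noteq> 0" by auto
  then show "\<exists>z\<in>fld S. val S z = ereal (- r)"
    using z by (intro bexI[of _ "inverse z"]) (auto simp: v_inverse K_inverse)
qed

lemma is_value_one: "is_value 1"
  unfolding is_value_def using v_p K_of_nat by (auto simp: one_ereal_def)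

lemma is_value_nat_mult: "is_value r \<Longrightarrow> is_value (real n * r)"
proof (induction n)
  case 0
  then show ?case unfolding is_value_def using K_one by (auto simp: zero_ereal_def intro!: bexI[of _ 1])
next
  case (Suc n)
  then show ?case using is_value_add[of r "real n * r"] by (simp add: algebra_simps)
qed

lemma is_value_sum: "finite I \<Longrightarrow> (\<And>t. t \<in> I \<Longrightarrow> is_value (f t)) \<Longrightarrow> is_value (sum f I)"
  by (induction I rule: finite_induct) (use is_value_nat_mult[OF is_value_one, of 0] in \<open>auto intro: is_value_add\<close>)

lemma is_value_pairing:
  fixes h :: "'k \<Rightarrow> real"
  assumes "\<And>t. is_value (h t)"
  shows "is_value (pairing h (\<lambda>t. real (m t)))"
    and "is_value (pairing (\<lambda>t. real (m t)) (\<lambda>t. h t - real_of_int (l t)))"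
proof -
  have int: "is_value (real_of_int n)" for n
  proof (cases "0 \<le> n")
    case True
    then show ?thesis using is_value_nat_mult[OF is_value_one, of "nat n"] by simp
  next
    case False
    then show ?thesis using is_value_uminus[OF is_value_nat_mult[OF is_value_one, of "nat (- n)"]] by simp
  qed
  have "is_value (h t * real (m t))" for t
    using is_value_nat_mult[OF assms, of "m t" t] by (simp add: mult.commute)
  then show "is_value (pairing h (\<lambda>t. real (m t)))"
    unfolding pairing_def by (intro is_value_sum) auto
  have "is_value (h t - real_of_int (l t))" for t
    using is_value_add[OF assms is_value_uminus[OF int]] by simp
  then show "is_value (pairing (\<lambda>t. real (m t)) (\<lambda>t. h t - real_of_int (l t)))"
    unfolding pairing_def by (intro is_value_sum is_value_nat_mult) auto
qed

section \<open>Membership in the modules of compatible systems\<close>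

lemma limit_K_smult:
  assumes "s \<in> limit_K S d e" "r \<in> fld S"
  shows "(\<lambda>m. r \<odot>\<^bsub>quot_K S d e m\<^esub> s m) \<in> limit_K S d e"
proof -
  have s: "s m \<in> carrier (quot_K S d e m)" "m \<le> m' \<Longrightarrow> red_K S d e m (s m') = s m" for m m'
    using assms(1) by (auto simp: limit_K_def)
  show ?thesis
    unfolding limit_K_def mem_Collect_eq
  proof (intro conjI allI impI)
    fix m show "r \<odot>\<^bsub>quot_K S d e m\<^esub> s m \<in> carrier (quot_K S d e m)"
      using module.smult_closed[OF module_quot_K _ s(1)] assms(2) by simp
  next
    fix m m' :: "'k \<Rightarrow> nat" assume "m \<le> m'"
    then show "red_K S d e m (r \<odot>\<^bsub>quot_K S d e m'\<^esub> s m') = r \<odot>\<^bsub>quot_K S d e m\<^esub> s m"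
      using red_K_map(3)[OF Omega_ideal_antimono assms(2) s(1)] s(2) by simp
  qed
qed

text \<open>The twist cancels the inverse power of \<open>p\<close> in the coefficient, and leaves a family of pure
  tensors whose right factor does not depend on the level.\<close>

lemma I_mod_intro:
  assumes h: "\<And>t. is_value (h t)" and s: "s \<in> limit_K S d e" and r: "r \<in> fld S"
    and z: "\<And>m. z m \<in> carrier (Lam S)"
    and sz: "\<And>m. s m = pq d e m (z m) (inverse (p_pow S (pairing h (\<lambda>i. real (m i)))) * r)"
  shows "s \<in> I_mod S h d e" and "r = 1 \<Longrightarrow> s \<in> I_mod0 S h d e"
proof -
  let ?P = "prod_algebra (Lam_quot S d e)" and ?R = "scalars integers" and ?K = "scalars (fld S)"
  let ?c = "\<lambda>m. Omega_ideal S d e m +>\<^bsub>Lam S\<^esub> z m"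
  have twist: "twist S h d e s m = pq d e m (z m) r" for m
  proof -
    let ?\<rho> = "p_pow S (pairing h (\<lambda>i. real (m i)))"
    note \<rho> = p_pow_spec[OF is_value_pairing(1)[where h = h and m = m, OF h]]
    have "?\<rho> * (inverse ?\<rho> * r) = r" using \<rho>(3) by (simp flip: mult.assoc)
    then show ?thesis unfolding twist_def sz smult_pq[OF \<rho>(1)] by (rule arg_cong)
  qed
  have c: "?c m \<in> carrier (Lam_quot S d e m)" for m by (rule coset_closed[OF z])
  have tf: "tensor_factors ?R ?P ?K"
  proof
    fix x y assume "x \<in> carrier ?P" "y \<in> carrier ?P"
    then show "x \<oplus>\<^bsub>?P\<^esub> y \<in> carrier ?P"
      using Q.M.M.a_closed by (simp add: prod_algebra_def)
  next
    fix a x assume "a \<in> carrier ?R" "x \<in> carrier ?P"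
    then show "a \<odot>\<^bsub>?P\<^esub> x \<in> carrier ?P"
      using Q.M.smult_closed by (simp add: prod_algebra_def)
  qed (auto intro: K_add K_mult integers_subset)
  have tm: "tensor_factors_map ?R ?P ?K (Lam_quot S d e m) ?K (\<lambda>x. x m) id" for m
    by (intro tensor_factors_map.intro tensor_factors_map_axioms.intro tf Q.T.tensor_factors_axioms)
      (auto simp: linear_map_def prod_algebra_def)
  have P: "?c \<in> carrier ?P" using c by (simp add: prod_algebra_def)
  let ?t = "pure_tensor ?R ?P ?K ?c r"
  have "?t \<in> carrier (tensor ?R ?P ?K)"
    by (rule tensor_factors.pure_closed[OF tf P]) (use r in simp)
  moreover have "twist S h d e s m = tensor_map ?R (Lam_quot S d e m) ?K (\<lambda>x. x m) id ?t" for m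
    unfolding twist pq_def tensor_factors_map.tensor_map_pure[OF tm] by simp
  ultimately show I: "s \<in> I_mod S h d e"
    unfolding I_mod_def O_K_eq using s by blast
  assume "r = 1"
  then have "\<forall>m. twist S h d e s m = pure_tensor ?R (Lam_quot S d e m) ?K (?c m) 1"
    unfolding twist pq_def by simp
  then have "\<exists>t\<in>carrier ?P. \<forall>m. twist S h d e s m = pure_tensor ?R (Lam_quot S d e m) ?K (t m) 1"
    by (rule bexI[of _ ?c]) (rule P)
  with I show "s \<in> I_mod0 S h d e"
    unfolding I_mod0_def O_K_eq by blast
qed

section \<open>Existence\<close>

lemma c_const1_ge:
  "multiplicity (prm S) (fact (nat (b - a)) :: nat) + 2 * nat (b - a) \<le> c_const1 (prm S) a b"
  by (auto simp: c_const1_def)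

text \<open>The interpolation lemma for \<open>q = u t ^ (p ^ m)\<close>, whose distance to \<open>1\<close> has valuation
  \<open>m + v (2 p)\<close> with \<open>1 \<le> v (2 p) \<le> 2\<close>.\<close>

lemma node_interpolation:
  assumes "l \<le> nat (e t - d t)"
  shows "\<exists>P. int_poly P \<and> (\<forall>i\<in>{d t..e t}. poly P (node t m i)
    = of_nat (prm S) ^ (m * l + c_const1 (prm S) (d t) (e t)) * of_nat (nat (i - d t) choose l))"
proof -
  let ?q = "u t ^ (prm S ^ m)"
  have p0: "prm S ^ m \<noteq> 0" using prime_p by auto
  have v2: "val S 2 \<le> 1"
  proof (cases "prm S = 2")
    case True
    then show ?thesis using v_p by simp
  next
    case False
    then have "\<not> prm S dvd 2"
      using prime_p by (metis primes_dvd_imp_eq two_is_prime_nat)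
    then show ?thesis using v_of_nat_coprime[of 2] by simp
  qed
  have vq: "val S (?q - 1) = val S (2 * of_nat (prm S)) + ereal (real m)"
    using u_power_minus_one[OF p0, of t] v_p_power[of m] by simp
  have v2p: "val S (2 * of_nat (prm S)) = val S 2 + 1" by (simp add: v_mult v_p)
  have v20: "0 \<le> val S 2" using v_of_nat_nonneg[of 2] by simp
  have "\<exists>P. int_poly P \<and> (\<forall>i\<le>nat (e t - d t). poly P (?q powi (d t + int i))
      = of_nat (prm S) ^ (m * l + c_const1 (prm S) (d t) (e t)) * of_nat (i choose l))"
  proof (rule binomial_interpolation)
    show "?q \<in> fld S" by (rule K_power[OF u_K])
    show "?q \<noteq> 1" by (rule u_power_neq_one[OF p0])
    show "val S (2 * of_nat (prm S)) \<le> val S (?q - 1)"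
      "ereal (real m) \<le> val S (?q - 1)" "val S (?q - 1) \<le> ereal (real m + 2)"
      unfolding vq v2p using v2 v20 by (cases "val S 2"; auto simp: one_ereal_def)+
  qed (use c_const1_ge assms in auto)
  then obtain P where P: "int_poly P" "\<forall>i\<le>nat (e t - d t). poly P (?q powi (d t + int i))
      = of_nat (prm S) ^ (m * l + c_const1 (prm S) (d t) (e t)) * of_nat (i choose l)" by blast
  have "poly P (node t m i)
      = of_nat (prm S) ^ (m * l + c_const1 (prm S) (d t) (e t)) * of_nat (nat (i - d t) choose l)"
    if i: "i \<in> {d t..e t}" for i
  proof -
    have "node t m i = ?q powi (d t + int (nat (i - d t)))"
      using i unfolding node_def mult.commute[of i] power_int_mult power_int_of_nat by simp
    moreover have "nat (i - d t) \<le> nat (e t - d t)"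
      using i by (intro nat_mono diff_right_mono) simp
    ultimately show ?thesis using P(2) by metis
  qed
  then show ?thesis using P(1) by blast
qed

lemma pq_multiple:
  assumes x: "x \<in> carrier (Lam S)" and g: "g \<in> carrier (Lam S)" and r: "r \<in> integers"
    and a: "a \<in> fld S" and c: "g \<ominus>\<^bsub>Lam S\<^esub> r \<odot>\<^bsub>Lam S\<^esub> \<one>\<^bsub>Lam S\<^esub> \<in> Omega_ideal S d e m"
  shows "pq d e m (x \<otimes>\<^bsub>Lam S\<^esub> g) a = pq d e m x (r * a)"
proof -
  have "x \<otimes>\<^bsub>Lam S\<^esub> g \<ominus>\<^bsub>Lam S\<^esub> r \<odot>\<^bsub>Lam S\<^esub> x
      = x \<otimes>\<^bsub>Lam S\<^esub> (g \<ominus>\<^bsub>Lam S\<^esub> r \<odot>\<^bsub>Lam S\<^esub> \<one>\<^bsub>Lam S\<^esub>)"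
  proof -
    have "r \<odot>\<^bsub>Lam S\<^esub> x = x \<otimes>\<^bsub>Lam S\<^esub> (r \<odot>\<^bsub>Lam S\<^esub> \<one>\<^bsub>Lam S\<^esub>)"
      using A.sm_one_mult[OF r x] x r by (simp add: A.L.m_comm)
    then show ?thesis using x g r
      by (simp add: A.L.M.minus_eq A.L.r_distr A.L.r_minus)
  qed
  also have "\<dots> \<in> Omega_ideal S d e m" using E.I.I_l_closed[OF c x] .
  finally have "pq d e m (x \<otimes>\<^bsub>Lam S\<^esub> g) a = pq d e m (r \<odot>\<^bsub>Lam S\<^esub> x) a"
    using x g r by (intro pq_cong) auto
  then show ?thesis using pq_smult[OF r x a] by simp
qed

text \<open>The product over the coordinates of the interpolating polynomials: at the point \<open>i\<close> it is
  a power of \<open>p\<close> times the multi-dimensional binomial coefficient of \<open>i\<close> over \<open>j\<close>.\<close>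

lemma interpolating_element:
  assumes j: "j \<in> {d..e}"
  shows "\<exists>G\<in>carrier (Lam S). \<forall>i\<in>{d..e}.
    G \<ominus>\<^bsub>Lam S\<^esub> (of_nat (prm S) ^ ((\<Sum>t\<in>UNIV. m t * nat (j t - d t)) + c_const (prm S) d e)
      * of_nat (box_binomial d i j)) \<odot>\<^bsub>Lam S\<^esub> \<one>\<^bsub>Lam S\<^esub> \<in> Omega_ideal S i i m"
proof -
  let ?b = "\<lambda>t. of_nat (prm S) ^ (m t * nat (j t - d t) + c_const1 (prm S) (d t) (e t)) :: 'c"
  have "nat (j t - d t) \<le> nat (e t - d t)" for t
    using j by (intro nat_mono diff_right_mono) (simp add: le_fun_def)
  then have "\<exists>P. int_poly P \<and> (\<forall>i\<in>{d t..e t}. poly P (node t (m t) i)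
      = ?b t * of_nat (nat (i - d t) choose nat (j t - d t)))" for t
    by (rule node_interpolation)
  then obtain P where P: "\<And>t. int_poly (P t)" "\<And>t i. i \<in> {d t..e t} \<Longrightarrow> poly (P t) (node t (m t) i)
      = ?b t * of_nat (nat (i - d t) choose nat (j t - d t))" by metis
  let ?e = "\<lambda>t. A.ev (Y t (m t)) (P t)"
  have e: "?e t \<in> carrier (Lam S)" for t by (intro A.ev_closed Y_closed P(1))
  have "(\<Otimes>\<^bsub>Lam S\<^esub>t\<in>UNIV. ?e t) \<ominus>\<^bsub>Lam S\<^esub> (of_nat (prm S) ^ ((\<Sum>t\<in>UNIV. m t * nat (j t - d t)) + c_const (prm S) d e)
      * of_nat (box_binomial d i j)) \<odot>\<^bsub>Lam S\<^esub> \<one>\<^bsub>Lam S\<^esub> \<in> Omega_ideal S i i m"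
    if i: "i \<in> {d..e}" for i
  proof -
    let ?r = "\<lambda>t. poly (P t) (node t (m t) (i t))"
    have r: "?r t \<in> integers" for t by (rule int_poly_poly[OF P(1) node_integer])
    have "?e t \<ominus>\<^bsub>Lam S\<^esub> ?r t \<odot>\<^bsub>Lam S\<^esub> \<one>\<^bsub>Lam S\<^esub> \<in> Omega_ideal S i i m" for t
    proof (rule A.ev_cong_mod_ideal[OF Omega_ideal_ideal Y_closed node_integer _ P(1)])
      show "Y t (m t) \<ominus>\<^bsub>Lam S\<^esub> node t (m t) (i t) \<odot>\<^bsub>Lam S\<^esub> \<one>\<^bsub>Lam S\<^esub> \<in> Omega_ideal S i i m"
        using Omega_in_ideal[of t i i m] unfolding Omega_self factor_def .
    qed
    then have "(\<Otimes>\<^bsub>Lam S\<^esub>t\<in>UNIV. ?e t) \<ominus>\<^bsub>Lam S\<^esub> (\<Otimes>\<^bsub>Lam S\<^esub>t\<in>UNIV. ?r t \<odot>\<^bsub>Lam S\<^esub> \<one>\<^bsub>Lam S\<^esub>)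
        \<in> Omega_ideal S i i m"
      by (intro A.L.finprod_cong_mod_ideal[OF Omega_ideal_ideal]) (use e r in auto)
    also have "(\<Otimes>\<^bsub>Lam S\<^esub>t\<in>UNIV. ?r t \<odot>\<^bsub>Lam S\<^esub> \<one>\<^bsub>Lam S\<^esub>) = (\<Prod>t\<in>UNIV. ?r t) \<odot>\<^bsub>Lam S\<^esub> \<one>\<^bsub>Lam S\<^esub>"
      by (rule A.finprod_scalars) (auto intro: r)
    also have "(\<Prod>t\<in>UNIV. ?r t) = (\<Prod>t\<in>UNIV. ?b t * of_nat (nat (i t - d t) choose nat (j t - d t)))"
      by (rule prod.cong[OF refl], rule P(2)) (use i in \<open>auto simp: le_fun_def\<close>)
    also have "\<dots> = of_nat (prm S) ^ ((\<Sum>t\<in>UNIV. m t * nat (j t - d t)) + c_const (prm S) d e)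
      * of_nat (box_binomial d i j)"
      by (simp add: prod.distrib box_binomial_def c_const_def power_add power_sum)
    finally show ?thesis .
  qed
  moreover have "(\<Otimes>\<^bsub>Lam S\<^esub>t\<in>UNIV. ?e t) \<in> carrier (Lam S)"
    using e by (intro A.L.finprod_closed) auto
  ultimately show ?thesis by blast
qed

text \<open>By binomial inversion, the lift at the point \<open>i\<close> is the combination of the finite
  differences with coefficients \<open>box_binomial d i j\<close>. Replacing these coefficients by the
  elements that interpolate them gives one element with all the required classes. The growth
  condition on the \<open>j\<close>-th difference absorbs the powers \<open>m t * (j t - d t)\<close> of \<open>p\<close> in
  the denominator of the \<open>j\<close>-th interpolating element.\<close>

lemma existence_at_level:
  fixes n :: nat
  assumes h: "\<And>t. is_value (h t)"
    and lift: "\<And>i. i \<in> {d..e} \<Longrightarrow> sl i \<in> carrier (Lam_K S)"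
    and proj: "\<And>i. i \<in> {d..e} \<Longrightarrow> proj_K S i i m (sl i) = si i"
    and lattice: "\<And>j. j \<in> {d..e} \<Longrightarrow>
      p_pow S (pairing (\<lambda>t. real (m t)) (\<lambda>t. h t - real_of_int (j t - d t))) \<odot>\<^bsub>Lam_K S\<^esub>
        (\<Oplus>\<^bsub>Lam_K S\<^esub>i\<in>{d..j}. (of_nat (box_binomial d j i) * (-1) ^ nat (\<Sum>t\<in>UNIV. j t - i t))
          \<odot>\<^bsub>Lam_K S\<^esub> sl i) \<in> Lam_lattice S n"
  shows "\<exists>z\<in>carrier (Lam S). \<forall>i\<in>{d..e}. pq i i m z
    (inverse (p_pow S (pairing h (\<lambda>t. real (m t)))) * inverse (of_nat (prm S ^ (c_const (prm S) d e + n)))) = si i"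
proof -
  let ?p = "of_nat (prm S) :: 'c" and ?c = "c_const (prm S) d e"
  define \<rho> where "\<rho> = p_pow S (pairing h (\<lambda>t. real (m t)))"
  define \<pi> where "\<pi> j = p_pow S (pairing (\<lambda>t. real (m t)) (\<lambda>t. h t - real_of_int (j t - d t)))" for j
  define B where "B j = ?p ^ ((\<Sum>t\<in>UNIV. m t * nat (j t - d t)) + ?c)" for j :: "'k \<Rightarrow> int"
  define cf where "cf j i = (if i \<in> {d..j} then of_nat (box_binomial d j i) * (-1) ^ nat (\<Sum>t\<in>UNIV. j t - i t) else (0::'c))"
    for i j :: "'k \<Rightarrow> int"
  \<comment> \<open>the units by which the coefficient of the \<open>j\<close>-th difference differs from \<open>\<kappa>\<close>\<close>
  define w where "w j = ?p ^ ?c * \<rho> / (\<pi> j * B j)" for j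
  define \<kappa> where "\<kappa> = inverse \<rho> * inverse (?p ^ (?c + n))"
  note \<rho> = p_pow_spec[OF is_value_pairing(1)[where h = h and m = m, OF h], folded \<rho>_def]
  have \<pi>: "\<pi> j \<in> fld S" "\<pi> j \<noteq> 0"
    "val S (\<pi> j) = ereal (pairing (\<lambda>t. real (m t)) (\<lambda>t. h t - real_of_int (j t - d t)))" for j
    using p_pow_spec[OF is_value_pairing(2)[where h = h and m = m and l = "\<lambda>t. j t - d t", OF h]] by (auto simp: \<pi>_def)
  have B: "B j \<in> fld S" "B j \<noteq> 0" "B j \<in> integers" for j
    unfolding B_def using p_nonzero by (auto intro: K_power K_of_nat integers_power integers_of_nat)
  have \<kappa>: "\<kappa> \<in> fld S" unfolding \<kappa>_def by (intro K_mult K_inverse \<rho>(1) K_power K_of_nat)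
  have w: "w j \<in> integers" if j: "j \<in> {d..e}" for j
  proof (rule integersI)
    show "w j \<in> fld S" unfolding w_def by (intro K_divide K_mult K_power K_of_nat \<rho> \<pi> B)
    have "real_of_int (j t - d t) = real (nat (j t - d t))" for t
      using j by (simp add: le_fun_def)
    then have "pairing (\<lambda>t. real (m t)) (\<lambda>t. h t - real_of_int (j t - d t))
        = pairing h (\<lambda>t. real (m t)) - real (\<Sum>t\<in>UNIV. m t * nat (j t - d t))"
      by (simp add: pairing_def algebra_simps sum_subtractf)
    then have "val S (\<pi> j * B j) = val S (?p ^ ?c * \<rho>)"
      unfolding B_def v_mult v_p_power \<pi>(3) \<rho>(2) by simp
    then show "0 \<le> val S (w j)"
      unfolding w_def using \<pi>(2) B(2) by (intro v_divide_nonneg) auto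
  qed
  have w\<kappa>: "B j * (w j * \<kappa>) = inverse (\<pi> j) * inverse (?p ^ n)" for j
    using \<pi>(2)[of j] B(2)[of j] \<rho>(3) p_nonzero
    by (simp add: w_def \<kappa>_def power_add field_simps)
  have cf: "cf j i \<in> integers" for i j
    unfolding cf_def by (auto intro!: integers_mult integers_of_nat integers_power integers_zero
        integers_uminus integers_one)
  obtain a x where a: "a \<in> fld S" and x: "\<forall>i\<in>{d..e}. x i \<in> carrier (Lam S) \<and> sl i = LK.pt (x i) a"
    using LK.common_denominator[OF finite_box, of d e sl] lift unfolding Lam_K_eq by blast
  have xc: "x i \<in> carrier (Lam S)" if "i \<in> {d..e}" for i using x that by blast
  \<comment> \<open>\<open>X j\<close> is the \<open>j\<close>-th difference of the lifts, extended by zero coefficients to the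
    full box\<close>
  define X where "X j = (\<Oplus>\<^bsub>Lam S\<^esub>i\<in>{d..e}. cf j i \<odot>\<^bsub>Lam S\<^esub> x i)" for j
  have Xc: "X j \<in> carrier (Lam S)" for j
    unfolding X_def using cf xc by (intro A.L.M.finsum_closed) auto
  have "\<exists>y\<in>carrier (Lam S). LK.pt (X j) (\<pi> j * a) = LK.pt y (inverse (?p ^ n))" if j: "j \<in> {d..e}" for j
  proof -
    have sub: "{d..j} \<subseteq> {d..e}" using j by (auto intro: order_trans)
    have "cf j i \<odot>\<^bsub>Lam S\<^esub> x i = \<zero>\<^bsub>Lam S\<^esub>" if "i \<in> {d..e} - {d..j}" for i
    proof -
      have "cf j i = 0" using that by (simp add: cf_def)
      then show ?thesis using xc[of i] that by simp
    qed
    moreover have "cf j i \<odot>\<^bsub>Lam S\<^esub> x i \<in> carrier (Lam S)" if "i \<in> {d..e}" for i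
      using cf xc[OF that] by simp
    ultimately have X: "X j = (\<Oplus>\<^bsub>Lam S\<^esub>i\<in>{d..j}. cf j i \<odot>\<^bsub>Lam S\<^esub> x i)"
      unfolding X_def by (intro A.L.M.add.finprod_mono_neutral_cong_right finite_box sub) auto
    have "LK.pt (X j) a = (\<Oplus>\<^bsub>Lam_K S\<^esub>i\<in>{d..j}. LK.pt (cf j i \<odot>\<^bsub>Lam S\<^esub> x i) a)"
      unfolding X Lam_K_eq using sub cf xc a finite_box by (intro LK.pt_finsum) auto
    also have "\<dots> = (\<Oplus>\<^bsub>Lam_K S\<^esub>i\<in>{d..j}. (of_nat (box_binomial d j i) * (-1) ^ nat (\<Sum>t\<in>UNIV. j t - i t))
          \<odot>\<^bsub>Lam_K S\<^esub> sl i)"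
      unfolding Lam_K_eq
    proof (rule LK.T.T.finsum_cong')
      fix i assume i: "i \<in> {d..j}"
      have c: "of_nat (box_binomial d j i) * (-1) ^ nat (\<Sum>t\<in>UNIV. j t - i t) = cf j i"
        using i by (simp add: cf_def)
      have i': "i \<in> {d..e}" using i sub by blast
      have sl: "sl i = LK.pt (x i) a" using x i' by blast
      show "LK.pt (cf j i \<odot>\<^bsub>Lam S\<^esub> x i) a
        = (of_nat (box_binomial d j i) * (-1) ^ nat (\<Sum>t\<in>UNIV. j t - i t)) \<odot>\<^bsub>LK.TK\<^esub> sl i"
        unfolding c sl LK.smult_pt[OF integers_subset[OF cf]] by (rule LK.pt_smult[OF cf xc[OF i'] a])
    next
      show "(\<lambda>i. (of_nat (box_binomial d j i) * (-1) ^ nat (\<Sum>t\<in>UNIV. j t - i t)) \<odot>\<^bsub>LK.TK\<^esub> sl i) \<in> {d..j} \<rightarrow> carrier LK.TK"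
      proof
        fix i assume i: "i \<in> {d..j}"
        have c: "of_nat (box_binomial d j i) * (-1) ^ nat (\<Sum>t\<in>UNIV. j t - i t) = cf j i"
          using i by (simp add: cf_def)
        show "(of_nat (box_binomial d j i) * (-1) ^ nat (\<Sum>t\<in>UNIV. j t - i t)) \<odot>\<^bsub>LK.TK\<^esub> sl i \<in> carrier LK.TK"
          unfolding c using LK.TK.smult_closed[of "cf j i" "sl i"] integers_subset[OF cf] lift[of i] i sub
          by (auto simp: Lam_K_eq)
      qed
    qed simp
    finally have "\<pi> j \<odot>\<^bsub>Lam_K S\<^esub> LK.pt (X j) a \<in> Lam_lattice S n"
      using lattice[OF j] unfolding \<pi>_def by simp
    then have "LK.pt (X j) (\<pi> j * a) \<in> Lam_lattice S n"
      unfolding Lam_K_eq LK.smult_pt[OF \<pi>(1)] .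
    then show ?thesis unfolding Lam_lattice_def O_K_eq by (rule LK.lattice_elem)
  qed
  then obtain y where y: "\<And>j. j \<in> {d..e} \<Longrightarrow> y j \<in> carrier (Lam S)"
    "\<And>j. j \<in> {d..e} \<Longrightarrow> LK.pt (X j) (\<pi> j * a) = LK.pt (y j) (inverse (?p ^ n))"
    by metis
  have yX: "pq i i m (y j) (inverse (?p ^ n)) = pq i i m (X j) (\<pi> j * a)" if "j \<in> {d..e}" for i j
    using y(2)[OF that] proj_K_map[of i i m "X j" "\<pi> j * a"] proj_K_map[of i i m "y j" "inverse (?p ^ n)"] by simp
  have "\<forall>j\<in>{d..e}. \<exists>G. G \<in> carrier (Lam S) \<and> (\<forall>i\<in>{d..e}.
      G \<ominus>\<^bsub>Lam S\<^esub> (B j * of_nat (box_binomial d i j)) \<odot>\<^bsub>Lam S\<^esub> \<one>\<^bsub>Lam S\<^esub> \<in> Omega_ideal S i i m)"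
    using interpolating_element[of _ d e m] unfolding B_def Bex_def by (rule ballI)
  from bchoice[OF this] obtain G where "\<forall>j\<in>{d..e}. G j \<in> carrier (Lam S) \<and> (\<forall>i\<in>{d..e}.
      G j \<ominus>\<^bsub>Lam S\<^esub> (B j * of_nat (box_binomial d i j)) \<odot>\<^bsub>Lam S\<^esub> \<one>\<^bsub>Lam S\<^esub> \<in> Omega_ideal S i i m)"
    by blast
  then have G: "G j \<in> carrier (Lam S)"
    "i \<in> {d..e} \<Longrightarrow>
      G j \<ominus>\<^bsub>Lam S\<^esub> (B j * of_nat (box_binomial d i j)) \<odot>\<^bsub>Lam S\<^esub> \<one>\<^bsub>Lam S\<^esub> \<in> Omega_ideal S i i m"
    if "j \<in> {d..e}" for i j using that by blast+
  define z where "z = (\<Oplus>\<^bsub>Lam S\<^esub>j\<in>{d..e}. w j \<odot>\<^bsub>Lam S\<^esub> (y j \<otimes>\<^bsub>Lam S\<^esub> G j))"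
  have term_closed: "w j \<odot>\<^bsub>Lam S\<^esub> (y j \<otimes>\<^bsub>Lam S\<^esub> G j) \<in> carrier (Lam S)" if "j \<in> {d..e}" for j
    using w[OF that] y(1)[OF that] G(1)[OF that] by simp
  have "pq i i m z \<kappa> = si i" if i: "i \<in> {d..e}" for i
  proof -
    interpret M: module "scalars (fld S)" "quot_K S i i m" by (rule module_quot_K)
    let ?C = "\<lambda>j. of_nat (box_binomial d i j) :: 'c"
    have C: "?C j \<in> integers" for j by (rule integers_of_nat)
    have "pq i i m z \<kappa> = (\<Oplus>\<^bsub>quot_K S i i m\<^esub>j\<in>{d..e}. pq i i m (w j \<odot>\<^bsub>Lam S\<^esub> (y j \<otimes>\<^bsub>Lam S\<^esub> G j)) \<kappa>)"
      unfolding z_def using finite_box term_closed \<kappa> by (intro pq_finsum) auto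
    also have "\<dots> = (\<Oplus>\<^bsub>quot_K S i i m\<^esub>j\<in>{d..e}. pq i i m (?C j \<odot>\<^bsub>Lam S\<^esub> X j) a)"
    proof (rule M.M.finsum_cong')
      fix j assume j: "j \<in> {d..e}"
      have w': "w j * \<kappa> \<in> fld S" using integers_subset[OF w[OF j]] \<kappa> by (rule K_mult)
      have pn: "inverse (?p ^ n) \<in> fld S" by (intro K_inverse K_power K_of_nat)
      have \<pi>C: "inverse (\<pi> j) * ?C j \<in> fld S" by (intro K_mult K_inverse \<pi> K_of_nat)
      have "pq i i m (w j \<odot>\<^bsub>Lam S\<^esub> (y j \<otimes>\<^bsub>Lam S\<^esub> G j)) \<kappa> = pq i i m (y j \<otimes>\<^bsub>Lam S\<^esub> G j) (w j * \<kappa>)"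
        using pq_smult[OF w[OF j] _ \<kappa>] y(1)[OF j] G(1)[OF j] by simp
      also have "\<dots> = pq i i m (y j) (B j * ?C j * (w j * \<kappa>))"
        by (rule pq_multiple[OF y(1)[OF j] G(1)[OF j] integers_mult[OF B(3) C] w' G(2)[OF j i]])
      also have "B j * ?C j * (w j * \<kappa>) = (inverse (\<pi> j) * ?C j) * inverse (?p ^ n)"
        using w\<kappa>[of j] by (simp add: mult_ac)
      also have "pq i i m (y j) \<dots> = (inverse (\<pi> j) * ?C j) \<odot>\<^bsub>quot_K S i i m\<^esub> pq i i m (X j) (\<pi> j * a)"
        using smult_pq[OF \<pi>C, of i i m "y j" "inverse (?p ^ n)"] yX[OF j] by simp
      also have "\<dots> = pq i i m (X j) (?C j * a)"
      proof -
        have "inverse (\<pi> j) * ?C j * (\<pi> j * a) = ?C j * a" using \<pi>(2)[of j] by (simp add: field_simps)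
        then show ?thesis unfolding smult_pq[OF \<pi>C] by (rule arg_cong)
      qed
      also have "\<dots> = pq i i m (?C j \<odot>\<^bsub>Lam S\<^esub> X j) a"
        by (rule pq_smult[OF C Xc a, symmetric])
      finally show "pq i i m (w j \<odot>\<^bsub>Lam S\<^esub> (y j \<otimes>\<^bsub>Lam S\<^esub> G j)) \<kappa> = pq i i m (?C j \<odot>\<^bsub>Lam S\<^esub> X j) a" .
    qed (use Xc C a in \<open>auto intro!: pq_closed\<close>)
    also have "\<dots> = pq i i m (\<Oplus>\<^bsub>Lam S\<^esub>j\<in>{d..e}. ?C j \<odot>\<^bsub>Lam S\<^esub> X j) a"
      using finite_box Xc C a by (intro pq_finsum[symmetric]) auto
    also have "(\<Oplus>\<^bsub>Lam S\<^esub>j\<in>{d..e}. ?C j \<odot>\<^bsub>Lam S\<^esub> X j)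
        = (\<Oplus>\<^bsub>Lam S\<^esub>i'\<in>{d..e}. (\<Sum>j\<in>{d..e}. ?C j * cf j i') \<odot>\<^bsub>Lam S\<^esub> x i')"
      unfolding X_def by (rule matrix_combination[OF A.L.module]) (use finite_box xc C cf in auto)
    also have "\<dots> = (\<Oplus>\<^bsub>Lam S\<^esub>i'\<in>{d..e}. if i' = i then x i else \<zero>\<^bsub>Lam S\<^esub>)"
    proof (rule A.L.M.finsum_cong')
      fix i' assume i': "i' \<in> {d..e}"
      have "(\<Sum>j\<in>{d..e}. ?C j * cf j i') = (if i = i' then 1 else 0)"
        unfolding cf_def by (rule box_binomial_inversion[OF i i'])
      then show "(\<Sum>j\<in>{d..e}. ?C j * cf j i') \<odot>\<^bsub>Lam S\<^esub> x i' = (if i' = i then x i else \<zero>\<^bsub>Lam S\<^esub>)"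
        using xc[OF i'] by auto
    qed (use xc[OF i] in auto)
    also have "\<dots> = x i" by (rule A.L.M.finsum_singleton_support[OF finite_box i xc[OF i]])
    also have "pq i i m (x i) a = si i"
      using proj[OF i] x i proj_K_map[of i i m "x i" a] by simp
    finally show ?thesis .
  qed
  moreover have "z \<in> carrier (Lam S)"
    unfolding z_def using term_closed by (intro A.L.M.finsum_closed) auto
  ultimately show ?thesis unfolding \<kappa>_def \<rho>_def of_nat_power by blast
qed

end

theorem propositionC:
  fixes S :: "('c::field_char_0, 'g, 'k::finite) iwasawa_data"
    and h :: "'k \<Rightarrow> real"
    and d e :: "'k \<Rightarrow> int"
    and s :: "('k \<Rightarrow> int) \<Rightarrow> ('k \<Rightarrow> nat) \<Rightarrow> ('c, 'g, 'k) quot_K_elem"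
    and s_lift :: "('k \<Rightarrow> int) \<Rightarrow> ('k \<Rightarrow> nat) \<Rightarrow> ('c, 'g, 'k) Lam_K_elem"
    and n :: nat
  assumes "iwasawa_setting S"
    and "\<And>t. ereal (h t) \<in> val S ` (O_K S - {0})"
    and "d \<le> e"
    and "\<And>i. i \<in> {d..e} \<Longrightarrow> s i \<in> I_mod S h i i"
    and "\<And>i m. i \<in> {d..e} \<Longrightarrow> s_lift i m \<in> carrier (Lam_K S)"
    and "\<And>i m. i \<in> {d..e} \<Longrightarrow> proj_K S i i m (s_lift i m) = s i m"
    and "\<And>m j. j \<in> {d..e} \<Longrightarrow>
      p_pow S (pairing (\<lambda>t. real (m t)) (\<lambda>t. h t - real_of_int (j t - d t))) \<odot>\<^bsub>Lam_K S\<^esub>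
        (\<Oplus>\<^bsub>Lam_K S\<^esub> i\<in>{d..j}.
          (of_nat (\<Prod>t\<in>UNIV. nat (j t - d t) choose nat (i t - d t))
            * (-1) ^ nat (\<Sum>t\<in>UNIV. j t - i t)) \<odot>\<^bsub>Lam_K S\<^esub> s_lift i m)
      \<in> Lam_lattice S n"
  shows "\<exists>!s'. s' \<in> I_lattice S h d e (c_const (prm S) d e + n) \<and>
           (\<forall>i\<in>{d..e}. I_proj S i s' = s i)"
proof -
  interpret iwasawa S by unfold_locales (rule assms(1))
  let ?N = "c_const (prm S) d e + n"
  define \<rho> where "\<rho> m = p_pow S (pairing h (\<lambda>t. real (m t)))" for m :: "'k \<Rightarrow> nat"
  define \<kappa> where "\<kappa> m = inverse (\<rho> m) * inverse (of_nat (prm S ^ ?N))" for m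
  have h: "is_value (h t)" for t
    using assms(2)[of t] unfolding is_value_def O_K_def by force
  have pN: "of_nat (prm S ^ ?N) \<in> fld S" "(of_nat (prm S ^ ?N) :: 'c) \<noteq> 0"
    by (rule K_of_nat) (use p_nonzero in simp)
  have \<kappa>: "\<kappa> m \<in> fld S" for m
    unfolding \<kappa>_def \<rho>_def by (intro K_mult K_inverse pN p_pow_spec(1) is_value_pairing(1) h)
  have "\<exists>z\<in>carrier (Lam S). \<forall>i\<in>{d..e}. pq i i m z (\<kappa> m) = s i m" for m
    unfolding \<kappa>_def \<rho>_def
    by (rule existence_at_level[OF h assms(5,6)]) (use assms(7)[of _ m] in \<open>simp_all only: box_binomial_def\<close>)
  then obtain z where z: "\<And>m. z m \<in> carrier (Lam S)" "\<And>i m. i \<in> {d..e} \<Longrightarrow> pq i i m (z m) (\<kappa> m) = s i m"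
    by metis
  define s' where "s' m = pq d e m (z m) (\<kappa> m)" for m
  have s'_closed: "s' m \<in> carrier (quot_K S d e m)" for m
    unfolding s'_def by (rule pq_closed[OF z(1) \<kappa>])
  have red_point: "red_K S i i m (s' m) = s i m" if "i \<in> {d..e}" for i m
    unfolding s'_def red_K_map(1)[OF Omega_ideal_point[OF that] z(1)] by (rule z(2)[OF that])
  have lim: "s' \<in> limit_K S d e"
    unfolding limit_K_def mem_Collect_eq
  proof (intro conjI allI impI)
    fix m m' :: "'k \<Rightarrow> nat" assume mm': "m \<le> m'"
    show "red_K S d e m (s' m') = s' m"
    proof (rule quot_K_unique[OF assms(3) _ s'_closed])
      show "red_K S d e m (s' m') \<in> carrier (quot_K S d e m)"
        by (rule red_K_map(2)[OF Omega_ideal_antimono[OF mm'] s'_closed])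
      fix i assume i: "i \<in> {d..e}"
      have "red_K S d e m (s' m') = pq d e m (z m') (\<kappa> m')"
        unfolding s'_def by (rule red_K_map(1)[OF Omega_ideal_antimono[OF mm'] z(1)])
      then have "red_K S i i m (red_K S d e m (s' m')) = pq i i m (z m') (\<kappa> m')"
        using red_K_map(1)[OF Omega_ideal_point[OF i] z(1)] by simp
      also have "\<dots> = red_K S i i m (s i m')"
        unfolding z(2)[OF i, symmetric] by (rule red_K_map(1)[OF Omega_ideal_antimono[OF mm'] z(1), symmetric])
      also have "\<dots> = s i m"
        using assms(4)[OF i] mm' by (auto simp: I_mod_def limit_K_def)
      finally show "red_K S i i m (red_K S d e m (s' m')) = red_K S i i m (s' m)"
        using red_point[OF i] by simp
    qed
  qed (rule s'_closed)
  have "s' \<in> I_mod S h d e"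
    by (rule I_mod_intro(1)[OF h lim K_inverse[OF pN(1)] z(1)]) (simp only: s'_def \<kappa>_def \<rho>_def)
  moreover have "(\<lambda>m. of_nat (prm S ^ ?N) \<odot>\<^bsub>quot_K S d e m\<^esub> s' m) \<in> I_mod0 S h d e"
  proof (rule I_mod_intro(2)[OF h limit_K_smult[OF lim pN(1)] K_one z(1) _ refl])
    fix m
    have "of_nat (prm S ^ ?N) * \<kappa> m = inverse (\<rho> m) * 1"
      unfolding \<kappa>_def using pN(2) by simp
    then show "of_nat (prm S ^ ?N) \<odot>\<^bsub>quot_K S d e m\<^esub> s' m
        = pq d e m (z m) (inverse (p_pow S (pairing h (\<lambda>i. real (m i)))) * 1)"
      unfolding s'_def smult_pq[OF pN(1)] \<rho>_def by (rule arg_cong)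
  qed
  ultimately have "s' \<in> I_lattice S h d e ?N" by (simp add: I_lattice_def)
  moreover have "I_proj S i s' = s i" if "i \<in> {d..e}" for i
    using red_point[OF that] by (simp add: I_proj_def)
  moreover have "r = s'" if r: "r \<in> I_lattice S h d e ?N" "\<forall>i\<in>{d..e}. I_proj S i r = s i" for r
  proof
    fix m
    have "r m \<in> carrier (quot_K S d e m)"
      using r(1) by (simp add: I_lattice_def I_mod_def limit_K_def)
    then show "r m = s' m"
    proof (rule quot_K_unique[OF assms(3) _ s'_closed])
      fix i assume i: "i \<in> {d..e}"
      then have "I_proj S i r m = s i m" using r(2) by simp
      then have "red_K S i i m (r m) = s i m" unfolding I_proj_def .
      then show "red_K S i i m (r m) = red_K S i i m (s' m)" using red_point[OF i] by simp
    qed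
  qed
  ultimately show ?thesis by blast
qed

end
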